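(* Let $(\mathcal B,S)$ be an $\mathrm{SO}(2)$-dagger 2-category. Then there is an equivalence of $\mathrm{SO}(2)$-dagger 2-categories $$(\mathcal B,S)_{\mathrm{eu}}\;\cong\;(S_{\mathrm{SO}(2)}\circ T_{\mathrm{SO}(2)})(\mathcal B,S)$$ between the Euler completion of $(\mathcal B,S)$ and the strictification of $(\mathcal B,S)$ viewed as an $\mathrm{SO}(2)$-volutive 2-category.
   Context: "2-category" means bicategory, etc. For a 2-category $\mathcal B$ with (chosen) right adjoints $X^\vee$, let $(-)^{\vee\vee}$ be the double right adjoint 2-endofunctor. An $\mathrm{SO}(2)$-volutive structure on $\mathcal B$ is an invertible 2-transformation $S\colon\mathrm{id}_{\mathcal B}\Rightarrow(-)^{\vee\vee}$, with components $S_a\colon a\to a$ and $S_X\colon X^{\vee\vee}\circ S_a\to S_b\circ X$ for $X\colon a\to b$. It is an $\mathrm{SO}(2)$-dagger structure (equivalently, a pivotal structure) if $S_a=\mathrm{id}_a$ for all $a$. An $\mathrm{SO}(2)$-dagger 2-functor $(\mathcal B,S)\to(\mathcal B',S')$ is a 2-functor $F$ such that $S'_{F(X)}$ corresponds to $F(S_X)$ under the canonical isomorphism $F(X^{\vee\vee})\cong F(X)^{\vee\vee}$; an equivalence of $\mathrm{SO}(2)$-dagger 2-categories is a pair of $\mathrm{SO}(2)$-dagger 2-functors that are mutually inverse up to invertible 2-transformations $\alpha$ for which the component of the target's dagger structure at $\alpha_a$ is the canonical isomorphism $\alpha_a^{\vee\vee}\cong\alpha_a$. $T_{\mathrm{SO}(2)}$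 regards an $\mathrm{SO}(2)$-dagger 2-category as an $\mathrm{SO}(2)$-volutive one. For an $\mathrm{SO}(2)$-volutive 2-category $(\mathcal B,S)$, $S_{\mathrm{SO}(2)}(\mathcal B,S)$ has objects the pairs $(a,\lambda_a)$ with $\lambda_a\colon S_a\to\mathrm{id}_a$ a 2-isomorphism, 1- and 2-morphisms those of $\mathcal B$, and dagger structure with component $X^{\vee\vee}\xrightarrow{\mathrm{id}\circ\lambda_a^{-1}}X^{\vee\vee}\circ S_a\xrightarrow{S_X}S_b\circ X\xrightarrow{\lambda_b\circ\mathrm{id}}X$ at $X\colon(a,\lambda_a)\to(b,\lambda_b)$. The Euler completion $(\mathcal B,S)_{\mathrm{eu}}$ of an $\mathrm{SO}(2)$-dagger 2-category has objects the pairs $(a,\psi_a)$ with $\psi_a\colon\mathrm{id}_a\to\mathrm{id}_a$ a 2-isomorphism, 1- and 2-morphisms those of $\mathcal B$, and $\mathrm{SO}(2)$-dagger structure with component $X^{\vee\vee}\cong X^{\vee\vee}\circ\mathrm{id}_a\xrightarrow{\mathrm{id}\circ\psi_a^{-1}}X^{\vee\vee}\circ\mathrm{id}_a\xrightarrow{S_X}\mathrm{id}_b\circ X\xrightarrow{\psi_b\circ\mathrm{id}}\mathrm{id}_b\circ X\cong X$ at $X\colon(a,\psi_a)\to(b,\psi_b)$. *)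

theory Defs
  imports Main
begin

text \<open>
  Conventions.  Bicategories are given by carrier families: \<open>Hom B a b\<close> is the set of 1-morphisms
  \<open>a \<rightarrow> b\<close> and \<open>Cell B f g\<close> the set of 2-morphisms between parallel 1-morphisms \<open>f\<close>, \<open>g\<close>.  The
  families need not be disjoint, so that one can change the objects of a bicategory while keeping
  its 1- and 2-morphisms.  For the same reason everything that may depend on the source and target
  objects of a 1-morphism (pseudofunctors, transformations) takes these objects as arguments.
  Composition is written in the order of functions: \<open>g \<odot> f\<close> for \<open>f : a \<rightarrow> b\<close>, \<open>g : b \<rightarrow> c\<close>; the
  horizontal composite of 2-morphisms is \<open>\<star>\<close>, the vertical one is \<open>\<cdot>\<close>.
\<close>

section \<open>Bicategories\<close>

record ('o, 'm, 'c) bicat =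
  Ob :: "'o set"
  Hom :: "'o \<Rightarrow> 'o \<Rightarrow> 'm set"
  Cell :: "'m \<Rightarrow> 'm \<Rightarrow> 'c set"
  Id1 :: "'o \<Rightarrow> 'm" ("\<one>\<index>")
  Comp1 :: "'m \<Rightarrow> 'm \<Rightarrow> 'm" (infixr "\<odot>\<index>" 75)
  Id2 :: "'m \<Rightarrow> 'c" ("\<iota>\<index>")
  VComp :: "'c \<Rightarrow> 'c \<Rightarrow> 'c" (infixr "\<cdot>\<index>" 60)
  HComp :: "'c \<Rightarrow> 'c \<Rightarrow> 'c" (infixr "\<star>\<index>" 70)
  Assoc :: "'m \<Rightarrow> 'm \<Rightarrow> 'm \<Rightarrow> 'c" ("\<a>\<index>")
  LUnit :: "'m \<Rightarrow> 'c" ("\<l>\<index>")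
  RUnit :: "'m \<Rightarrow> 'c" ("\<r>\<index>")

context
  fixes B :: "('o, 'm, 'c, 'z) bicat_scheme" (structure)
begin

definition inverse2 :: "'m \<Rightarrow> 'm \<Rightarrow> 'c \<Rightarrow> 'c \<Rightarrow> bool" where
  "inverse2 f g \<phi> \<psi> \<longleftrightarrow> \<psi> \<in> Cell B g f \<and> \<psi> \<cdot> \<phi> = \<iota> f \<and> \<phi> \<cdot> \<psi> = \<iota> g"

definition Iso2 :: "'m \<Rightarrow> 'm \<Rightarrow> 'c set" where
  "Iso2 f g = {\<phi> \<in> Cell B f g. \<exists>\<psi>. inverse2 f g \<phi> \<psi>}"

definition inv2 :: "'m \<Rightarrow> 'm \<Rightarrow> 'c \<Rightarrow> 'c" where
  "inv2 f g \<phi> = (THE \<psi>. inverse2 f g \<phi> \<psi>)"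

definition AssocI :: "'m \<Rightarrow> 'm \<Rightarrow> 'm \<Rightarrow> 'c" where
  "AssocI h g f = inv2 ((h \<odot> g) \<odot> f) (h \<odot> g \<odot> f) (\<a> h g f)"

text \<open>For \<open>f : a \<rightarrow> b\<close>, the unitor at \<open>f\<close> starts at \<open>\<one> b \<odot> f\<close>, respectively \<open>f \<odot> \<one> a\<close>; its
  inverse therefore needs the object as an argument.\<close>

definition LUnitI :: "'o \<Rightarrow> 'm \<Rightarrow> 'c" where
  "LUnitI b f = inv2 (\<one> b \<odot> f) f (\<l> f)"

definition RUnitI :: "'o \<Rightarrow> 'm \<Rightarrow> 'c" where
  "RUnitI a f = inv2 (f \<odot> \<one> a) f (\<r> f)"

definition equivalence1 :: "'o \<Rightarrow> 'o \<Rightarrow> 'm \<Rightarrow> bool" where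
  "equivalence1 a b f \<longleftrightarrow> f \<in> Hom B a b \<and>
     (\<exists>g \<in> Hom B b a. Iso2 (\<one> a) (g \<odot> f) \<noteq> {} \<and> Iso2 (f \<odot> g) (\<one> b) \<noteq> {})"

end

locale bicategory =
  fixes B :: "('o, 'm, 'c, 'z) bicat_scheme" (structure)
  assumes Id1_in: "a \<in> Ob B \<Longrightarrow> \<one> a \<in> Hom B a a"
    and Comp1_in: "\<lbrakk>a \<in> Ob B; b \<in> Ob B; c \<in> Ob B; f \<in> Hom B a b; g \<in> Hom B b c\<rbrakk>
      \<Longrightarrow> g \<odot> f \<in> Hom B a c"
    \<comment> \<open>the hom-categories\<close>
    and Id2_in: "\<lbrakk>a \<in> Ob B; b \<in> Ob B; f \<in> Hom B a b\<rbrakk> \<Longrightarrow> \<iota> f \<in> Cell B f f"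
    and VComp_in: "\<lbrakk>a \<in> Ob B; b \<in> Ob B; f \<in> Hom B a b; g \<in> Hom B a b; h \<in> Hom B a b;
      \<phi> \<in> Cell B f g; \<psi> \<in> Cell B g h\<rbrakk> \<Longrightarrow> \<psi> \<cdot> \<phi> \<in> Cell B f h"
    and VComp_Id2_left: "\<lbrakk>a \<in> Ob B; b \<in> Ob B; f \<in> Hom B a b; g \<in> Hom B a b; \<phi> \<in> Cell B f g\<rbrakk>
      \<Longrightarrow> \<iota> g \<cdot> \<phi> = \<phi>"
    and VComp_Id2_right: "\<lbrakk>a \<in> Ob B; b \<in> Ob B; f \<in> Hom B a b; g \<in> Hom B a b; \<phi> \<in> Cell B f g\<rbrakk>
      \<Longrightarrow> \<phi> \<cdot> \<iota> f = \<phi>"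
    and VComp_assoc: "\<lbrakk>a \<in> Ob B; b \<in> Ob B; f \<in> Hom B a b; g \<in> Hom B a b; h \<in> Hom B a b;
      k \<in> Hom B a b; \<phi> \<in> Cell B f g; \<psi> \<in> Cell B g h; \<chi> \<in> Cell B h k\<rbrakk>
      \<Longrightarrow> (\<chi> \<cdot> \<psi>) \<cdot> \<phi> = \<chi> \<cdot> \<psi> \<cdot> \<phi>"
    \<comment> \<open>functoriality of horizontal composition\<close>
    and HComp_in: "\<lbrakk>a \<in> Ob B; b \<in> Ob B; c \<in> Ob B; f \<in> Hom B a b; f' \<in> Hom B a b;
      g \<in> Hom B b c; g' \<in> Hom B b c; \<phi> \<in> Cell B f f'; \<psi> \<in> Cell B g g'\<rbrakk>
      \<Longrightarrow> \<psi> \<star> \<phi> \<in> Cell B (g \<odot> f) (g' \<odot> f')"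
    and HComp_Id2: "\<lbrakk>a \<in> Ob B; b \<in> Ob B; c \<in> Ob B; f \<in> Hom B a b; g \<in> Hom B b c\<rbrakk>
      \<Longrightarrow> \<iota> g \<star> \<iota> f = \<iota> (g \<odot> f)"
    and interchange: "\<lbrakk>a \<in> Ob B; b \<in> Ob B; c \<in> Ob B; f \<in> Hom B a b; f' \<in> Hom B a b;
      f'' \<in> Hom B a b; g \<in> Hom B b c; g' \<in> Hom B b c; g'' \<in> Hom B b c; \<phi> \<in> Cell B f f';
      \<phi>' \<in> Cell B f' f''; \<psi> \<in> Cell B g g'; \<psi>' \<in> Cell B g' g''\<rbrakk>
      \<Longrightarrow> (\<psi>' \<star> \<phi>') \<cdot> (\<psi> \<star> \<phi>) = (\<psi>' \<cdot> \<psi>) \<star> (\<phi>' \<cdot> \<phi>)"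
    \<comment> \<open>associators and unitors\<close>
    and Assoc_iso: "\<lbrakk>a \<in> Ob B; b \<in> Ob B; c \<in> Ob B; d \<in> Ob B; f \<in> Hom B a b; g \<in> Hom B b c;
      h \<in> Hom B c d\<rbrakk> \<Longrightarrow> \<a> h g f \<in> Iso2 B ((h \<odot> g) \<odot> f) (h \<odot> g \<odot> f)"
    and LUnit_iso: "\<lbrakk>a \<in> Ob B; b \<in> Ob B; f \<in> Hom B a b\<rbrakk> \<Longrightarrow> \<l> f \<in> Iso2 B (\<one> b \<odot> f) f"
    and RUnit_iso: "\<lbrakk>a \<in> Ob B; b \<in> Ob B; f \<in> Hom B a b\<rbrakk> \<Longrightarrow> \<r> f \<in> Iso2 B (f \<odot> \<one> a) f"
    and Assoc_natural: "\<lbrakk>a \<in> Ob B; b \<in> Ob B; c \<in> Ob B; d \<in> Ob B; f \<in> Hom B a b; f' \<in> Hom B a b;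
      g \<in> Hom B b c; g' \<in> Hom B b c; h \<in> Hom B c d; h' \<in> Hom B c d; \<phi> \<in> Cell B f f';
      \<psi> \<in> Cell B g g'; \<chi> \<in> Cell B h h'\<rbrakk>
      \<Longrightarrow> \<a> h' g' f' \<cdot> ((\<chi> \<star> \<psi>) \<star> \<phi>) = (\<chi> \<star> \<psi> \<star> \<phi>) \<cdot> \<a> h g f"
    and LUnit_natural: "\<lbrakk>a \<in> Ob B; b \<in> Ob B; f \<in> Hom B a b; f' \<in> Hom B a b; \<phi> \<in> Cell B f f'\<rbrakk>
      \<Longrightarrow> \<l> f' \<cdot> (\<iota> (\<one> b) \<star> \<phi>) = \<phi> \<cdot> \<l> f"
    and RUnit_natural: "\<lbrakk>a \<in> Ob B; b \<in> Ob B; f \<in> Hom B a b; f' \<in> Hom B a b; \<phi> \<in> Cell B f f'\<rbrakk>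
      \<Longrightarrow> \<r> f' \<cdot> (\<phi> \<star> \<iota> (\<one> a)) = \<phi> \<cdot> \<r> f"
    and pentagon: "\<lbrakk>a \<in> Ob B; b \<in> Ob B; c \<in> Ob B; d \<in> Ob B; e \<in> Ob B; f \<in> Hom B a b;
      g \<in> Hom B b c; h \<in> Hom B c d; k \<in> Hom B d e\<rbrakk>
      \<Longrightarrow> (\<iota> k \<star> \<a> h g f) \<cdot> \<a> k (h \<odot> g) f \<cdot> (\<a> k h g \<star> \<iota> f)
        = \<a> k h (g \<odot> f) \<cdot> \<a> (k \<odot> h) g f"
    and triangle: "\<lbrakk>a \<in> Ob B; b \<in> Ob B; c \<in> Ob B; f \<in> Hom B a b; g \<in> Hom B b c\<rbrakk>
      \<Longrightarrow> (\<iota> g \<star> \<l> f) \<cdot> \<a> g (\<one> b) f = \<r> g \<star> \<iota> f"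


section \<open>2-functors and 2-transformations\<close>

text \<open>The comparison 2-morphisms are \<open>FComp F a b c g f : F g \<odot> F f \<Rightarrow> F (g \<odot> f)\<close> and
  \<open>FUnit F a : \<one> (F a) \<Rightarrow> F (\<one> a)\<close>.\<close>

record ('o, 'm, 'c, 'p, 'n, 'd) psfun =
  FOb :: "'o \<Rightarrow> 'p"
  FHom :: "'o \<Rightarrow> 'o \<Rightarrow> 'm \<Rightarrow> 'n"
  FCell :: "'o \<Rightarrow> 'o \<Rightarrow> 'm \<Rightarrow> 'm \<Rightarrow> 'c \<Rightarrow> 'd"
  FComp :: "'o \<Rightarrow> 'o \<Rightarrow> 'o \<Rightarrow> 'm \<Rightarrow> 'm \<Rightarrow> 'd"
  FUnit :: "'o \<Rightarrow> 'd"

locale pseudofunctor = B: bicategory B + C: bicategory C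
  for B :: "('o, 'm, 'c, 'y) bicat_scheme" (structure)
    and C :: "('p, 'n, 'd, 'z) bicat_scheme" (structure) +
  fixes F :: "('o, 'm, 'c, 'p, 'n, 'd) psfun"
  assumes FOb_in: "a \<in> Ob B \<Longrightarrow> FOb F a \<in> Ob C"
    and FHom_in: "\<lbrakk>a \<in> Ob B; b \<in> Ob B; f \<in> Hom B a b\<rbrakk>
      \<Longrightarrow> FHom F a b f \<in> Hom C (FOb F a) (FOb F b)"
    and FCell_in: "\<lbrakk>a \<in> Ob B; b \<in> Ob B; f \<in> Hom B a b; g \<in> Hom B a b; \<phi> \<in> Cell B f g\<rbrakk>
      \<Longrightarrow> FCell F a b f g \<phi> \<in> Cell C (FHom F a b f) (FHom F a b g)"
    and FCell_Id2: "\<lbrakk>a \<in> Ob B; b \<in> Ob B; f \<in> Hom B a b\<rbrakk>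
      \<Longrightarrow> FCell F a b f f (\<iota> f) = \<iota>\<^bsub>C\<^esub> (FHom F a b f)"
    and FCell_VComp: "\<lbrakk>a \<in> Ob B; b \<in> Ob B; f \<in> Hom B a b; g \<in> Hom B a b; h \<in> Hom B a b;
      \<phi> \<in> Cell B f g; \<psi> \<in> Cell B g h\<rbrakk>
      \<Longrightarrow> FCell F a b f h (\<psi> \<cdot> \<phi>) = FCell F a b g h \<psi> \<cdot>\<^bsub>C\<^esub> FCell F a b f g \<phi>"
    and FComp_iso: "\<lbrakk>a \<in> Ob B; b \<in> Ob B; c \<in> Ob B; f \<in> Hom B a b; g \<in> Hom B b c\<rbrakk>
      \<Longrightarrow> FComp F a b c g f \<in> Iso2 C (FHom F b c g \<odot>\<^bsub>C\<^esub> FHom F a b f) (FHom F a c (g \<odot> f))"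
    and FUnit_iso: "a \<in> Ob B \<Longrightarrow> FUnit F a \<in> Iso2 C (\<one>\<^bsub>C\<^esub> (FOb F a)) (FHom F a a (\<one> a))"
    and FComp_natural: "\<lbrakk>a \<in> Ob B; b \<in> Ob B; c \<in> Ob B; f \<in> Hom B a b; f' \<in> Hom B a b;
      g \<in> Hom B b c; g' \<in> Hom B b c; \<phi> \<in> Cell B f f'; \<psi> \<in> Cell B g g'\<rbrakk>
      \<Longrightarrow> FComp F a b c g' f' \<cdot>\<^bsub>C\<^esub> (FCell F b c g g' \<psi> \<star>\<^bsub>C\<^esub> FCell F a b f f' \<phi>)
        = FCell F a c (g \<odot> f) (g' \<odot> f') (\<psi> \<star> \<phi>) \<cdot>\<^bsub>C\<^esub> FComp F a b c g f"
    and FComp_assoc: "\<lbrakk>a \<in> Ob B; b \<in> Ob B; c \<in> Ob B; d \<in> Ob B; f \<in> Hom B a b; g \<in> Hom B b c;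
      h \<in> Hom B c d\<rbrakk>
      \<Longrightarrow> FCell F a d ((h \<odot> g) \<odot> f) (h \<odot> g \<odot> f) (\<a> h g f)
          \<cdot>\<^bsub>C\<^esub> FComp F a b d (h \<odot> g) f \<cdot>\<^bsub>C\<^esub> (FComp F b c d h g \<star>\<^bsub>C\<^esub> \<iota>\<^bsub>C\<^esub> (FHom F a b f))
        = FComp F a c d h (g \<odot> f) \<cdot>\<^bsub>C\<^esub> (\<iota>\<^bsub>C\<^esub> (FHom F c d h) \<star>\<^bsub>C\<^esub> FComp F a b c g f)
          \<cdot>\<^bsub>C\<^esub> \<a>\<^bsub>C\<^esub> (FHom F c d h) (FHom F b c g) (FHom F a b f)"
    and FUnit_left: "\<lbrakk>a \<in> Ob B; b \<in> Ob B; f \<in> Hom B a b\<rbrakk>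
      \<Longrightarrow> FCell F a b (\<one> b \<odot> f) f (\<l> f) \<cdot>\<^bsub>C\<^esub> FComp F a b b (\<one> b) f
          \<cdot>\<^bsub>C\<^esub> (FUnit F b \<star>\<^bsub>C\<^esub> \<iota>\<^bsub>C\<^esub> (FHom F a b f))
        = \<l>\<^bsub>C\<^esub> (FHom F a b f)"
    and FUnit_right: "\<lbrakk>a \<in> Ob B; b \<in> Ob B; f \<in> Hom B a b\<rbrakk>
      \<Longrightarrow> FCell F a b (f \<odot> \<one> a) f (\<r> f) \<cdot>\<^bsub>C\<^esub> FComp F a a b f (\<one> a)
          \<cdot>\<^bsub>C\<^esub> (\<iota>\<^bsub>C\<^esub> (FHom F a b f) \<star>\<^bsub>C\<^esub> FUnit F a)
        = \<r>\<^bsub>C\<^esub> (FHom F a b f)"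

definition id_psfun :: "('o, 'm, 'c, 'z) bicat_scheme \<Rightarrow> ('o, 'm, 'c, 'o, 'm, 'c) psfun" where
  "id_psfun B =
    \<lparr> FOb = (\<lambda>a. a),
      FHom = (\<lambda>a b f. f),
      FCell = (\<lambda>a b f g \<phi>. \<phi>),
      FComp = (\<lambda>a b c g f. \<iota>\<^bsub>B\<^esub> (g \<odot>\<^bsub>B\<^esub> f)),
      FUnit = (\<lambda>a. \<iota>\<^bsub>B\<^esub> (\<one>\<^bsub>B\<^esub> a)) \<rparr>"

text \<open>The composite \<open>G \<circ> F\<close> of \<open>F : B \<rightarrow> C\<close> and \<open>G : C \<rightarrow> D\<close>.\<close>

definition comp_psfun ::
  "('o, 'm, 'c, 'x) bicat_scheme \<Rightarrow> ('p, 'n, 'd, 'y) bicat_scheme \<Rightarrow> ('q, 'k, 'e, 'z) bicat_scheme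
    \<Rightarrow> ('p, 'n, 'd, 'q, 'k, 'e) psfun \<Rightarrow> ('o, 'm, 'c, 'p, 'n, 'd) psfun
    \<Rightarrow> ('o, 'm, 'c, 'q, 'k, 'e) psfun" where
  "comp_psfun B C D G F =
    \<lparr> FOb = (\<lambda>a. FOb G (FOb F a)),
      FHom = (\<lambda>a b f. FHom G (FOb F a) (FOb F b) (FHom F a b f)),
      FCell = (\<lambda>a b f g \<phi>.
        FCell G (FOb F a) (FOb F b) (FHom F a b f) (FHom F a b g) (FCell F a b f g \<phi>)),
      FComp = (\<lambda>a b c g f.
        FCell G (FOb F a) (FOb F c) (FHom F b c g \<odot>\<^bsub>C\<^esub> FHom F a b f) (FHom F a c (g \<odot>\<^bsub>B\<^esub> f))
          (FComp F a b c g f)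
        \<cdot>\<^bsub>D\<^esub> FComp G (FOb F a) (FOb F b) (FOb F c) (FHom F b c g) (FHom F a b f)),
      FUnit = (\<lambda>a.
        FCell G (FOb F a) (FOb F a) (\<one>\<^bsub>C\<^esub> (FOb F a)) (FHom F a a (\<one>\<^bsub>B\<^esub> a)) (FUnit F a)
        \<cdot>\<^bsub>D\<^esub> FUnit G (FOb F a)) \<rparr>"

text \<open>A transformation \<open>T : F \<Rightarrow> G\<close> has components \<open>TOb T a : F a \<rightarrow> G a\<close> and
  \<open>THom T a b f : G f \<odot> TOb T a \<Rightarrow> TOb T b \<odot> F f\<close>.\<close>

record ('o, 'm, 'n, 'd) trans =
  TOb :: "'o \<Rightarrow> 'n"
  THom :: "'o \<Rightarrow> 'o \<Rightarrow> 'm \<Rightarrow> 'd"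

locale transformation = B: bicategory B + C: bicategory C
  for B :: "('o, 'm, 'c, 'y) bicat_scheme" (structure)
    and C :: "('p, 'n, 'd, 'z) bicat_scheme" (structure) +
  fixes F :: "('o, 'm, 'c, 'p, 'n, 'd) psfun"
    and G :: "('o, 'm, 'c, 'p, 'n, 'd) psfun"
    and T :: "('o, 'm, 'n, 'd) trans"
  assumes TOb_in: "a \<in> Ob B \<Longrightarrow> TOb T a \<in> Hom C (FOb F a) (FOb G a)"
    and THom_iso: "\<lbrakk>a \<in> Ob B; b \<in> Ob B; f \<in> Hom B a b\<rbrakk>
      \<Longrightarrow> THom T a b f \<in> Iso2 C (FHom G a b f \<odot>\<^bsub>C\<^esub> TOb T a) (TOb T b \<odot>\<^bsub>C\<^esub> FHom F a b f)"
    and THom_natural: "\<lbrakk>a \<in> Ob B; b \<in> Ob B; f \<in> Hom B a b; g \<in> Hom B a b; \<phi> \<in> Cell B f g\<rbrakk>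
      \<Longrightarrow> THom T a b g \<cdot>\<^bsub>C\<^esub> (FCell G a b f g \<phi> \<star>\<^bsub>C\<^esub> \<iota>\<^bsub>C\<^esub> (TOb T a))
        = (\<iota>\<^bsub>C\<^esub> (TOb T b) \<star>\<^bsub>C\<^esub> FCell F a b f g \<phi>) \<cdot>\<^bsub>C\<^esub> THom T a b f"
    and THom_Comp1: "\<lbrakk>a \<in> Ob B; b \<in> Ob B; c \<in> Ob B; f \<in> Hom B a b; g \<in> Hom B b c\<rbrakk>
      \<Longrightarrow> THom T a c (g \<odot> f) \<cdot>\<^bsub>C\<^esub> (FComp G a b c g f \<star>\<^bsub>C\<^esub> \<iota>\<^bsub>C\<^esub> (TOb T a))
        = (\<iota>\<^bsub>C\<^esub> (TOb T c) \<star>\<^bsub>C\<^esub> FComp F a b c g f)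
          \<cdot>\<^bsub>C\<^esub> \<a>\<^bsub>C\<^esub> (TOb T c) (FHom F b c g) (FHom F a b f)
          \<cdot>\<^bsub>C\<^esub> (THom T b c g \<star>\<^bsub>C\<^esub> \<iota>\<^bsub>C\<^esub> (FHom F a b f))
          \<cdot>\<^bsub>C\<^esub> AssocI C (FHom G b c g) (TOb T b) (FHom F a b f)
          \<cdot>\<^bsub>C\<^esub> (\<iota>\<^bsub>C\<^esub> (FHom G b c g) \<star>\<^bsub>C\<^esub> THom T a b f)
          \<cdot>\<^bsub>C\<^esub> \<a>\<^bsub>C\<^esub> (FHom G b c g) (FHom G a b f) (TOb T a)"
    and THom_Id1: "a \<in> Ob B
      \<Longrightarrow> THom T a a (\<one> a) \<cdot>\<^bsub>C\<^esub> (FUnit G a \<star>\<^bsub>C\<^esub> \<iota>\<^bsub>C\<^esub> (TOb T a))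
        = (\<iota>\<^bsub>C\<^esub> (TOb T a) \<star>\<^bsub>C\<^esub> FUnit F a)
          \<cdot>\<^bsub>C\<^esub> RUnitI C (FOb F a) (TOb T a) \<cdot>\<^bsub>C\<^esub> \<l>\<^bsub>C\<^esub> (TOb T a)"

text \<open>Invertibility is meant in the weak sense: the components at objects are equivalences, those
  at 1-morphisms are isomorphisms.\<close>

locale invertible_transformation = transformation +
  assumes TOb_equivalence: "a \<in> Ob B \<Longrightarrow> equivalence1 C (FOb F a) (FOb G a) (TOb T a)"


section \<open>Right adjoints\<close>

context
  fixes B :: "('o, 'm, 'c, 'z) bicat_scheme" (structure)
begin

text \<open>\<open>l : a \<rightarrow> b\<close> is left adjoint to \<open>r : b \<rightarrow> a\<close>, with unit \<open>\<eta> : \<one> a \<Rightarrow> r \<odot> l\<close> and counit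
  \<open>\<epsilon> : l \<odot> r \<Rightarrow> \<one> b\<close>.\<close>

definition adjunction :: "'o \<Rightarrow> 'o \<Rightarrow> 'm \<Rightarrow> 'm \<Rightarrow> 'c \<Rightarrow> 'c \<Rightarrow> bool" where
  "adjunction a b l r \<eta> \<epsilon> \<longleftrightarrow>
     l \<in> Hom B a b \<and> r \<in> Hom B b a \<and> \<eta> \<in> Cell B (\<one> a) (r \<odot> l) \<and> \<epsilon> \<in> Cell B (l \<odot> r) (\<one> b) \<and>
     \<l> l \<cdot> (\<epsilon> \<star> \<iota> l) \<cdot> AssocI B l r l \<cdot> (\<iota> l \<star> \<eta>) = \<r> l \<and>
     \<r> r \<cdot> (\<iota> r \<star> \<epsilon>) \<cdot> \<a> r l r \<cdot> (\<eta> \<star> \<iota> r) = \<l> r"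

text \<open>The mate \<open>r \<Rightarrow> r'\<close> of \<open>\<phi> : l' \<Rightarrow> l\<close>, where \<open>l, l' : a \<rightarrow> b\<close> have right adjoints \<open>r\<close>
  (with counit \<open>\<epsilon>\<close>) and \<open>r'\<close> (with unit \<open>\<eta>'\<close>).\<close>

definition mate :: "'o \<Rightarrow> 'm \<Rightarrow> 'm \<Rightarrow> 'c \<Rightarrow> 'm \<Rightarrow> 'c \<Rightarrow> 'c \<Rightarrow> 'c" where
  "mate a l r \<epsilon> r' \<eta>' \<phi> =
     \<r> r' \<cdot> (\<iota> r' \<star> \<epsilon>) \<cdot> \<a> r' l r \<cdot> ((\<iota> r' \<star> \<phi>) \<star> \<iota> r) \<cdot> (\<eta>' \<star> \<iota> r) \<cdot> LUnitI B a r"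

text \<open>The canonical isomorphism \<open>r \<Rightarrow> r'\<close> between two right adjoints of \<open>l : a \<rightarrow> b\<close>.\<close>

definition radj_iso :: "'o \<Rightarrow> 'm \<Rightarrow> 'm \<Rightarrow> 'c \<Rightarrow> 'm \<Rightarrow> 'c \<Rightarrow> 'c" where
  "radj_iso a l r \<epsilon> r' \<eta>' = mate a l r \<epsilon> r' \<eta>' (\<iota> l)"

text \<open>Unit and counit of the composite of the adjunctions \<open>f \<stileturn> f'\<close> (with \<open>\<eta>\<close>, \<open>\<epsilon>\<close>) and
  \<open>g \<stileturn> g'\<close> (with \<open>\<theta>\<close>, \<open>\<zeta>\<close>), where \<open>f : a \<rightarrow> b\<close> and \<open>g : b \<rightarrow> c\<close>.\<close>

definition comp_unit :: "'o \<Rightarrow> 'm \<Rightarrow> 'm \<Rightarrow> 'c \<Rightarrow> 'm \<Rightarrow> 'm \<Rightarrow> 'c \<Rightarrow> 'c" where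
  "comp_unit b f f' \<eta> g g' \<theta> =
     AssocI B f' g' (g \<odot> f) \<cdot> (\<iota> f' \<star> \<a> g' g f) \<cdot> (\<iota> f' \<star> \<theta> \<star> \<iota> f) \<cdot> (\<iota> f' \<star> LUnitI B b f) \<cdot> \<eta>"

definition comp_counit :: "'m \<Rightarrow> 'm \<Rightarrow> 'c \<Rightarrow> 'm \<Rightarrow> 'm \<Rightarrow> 'c \<Rightarrow> 'c" where
  "comp_counit f f' \<epsilon> g g' \<zeta> =
     \<zeta> \<cdot> (\<iota> g \<star> \<l> g') \<cdot> (\<iota> g \<star> \<epsilon> \<star> \<iota> g') \<cdot> (\<iota> g \<star> AssocI B f f' g') \<cdot> \<a> g f (f' \<odot> g')"

end

record ('o, 'm, 'c) adj_bicat = "('o, 'm, 'c) bicat" +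
  Dual :: "'m \<Rightarrow> 'm" ("_\<^sup>\<or>\<index>" [1000] 1000)
  Coev :: "'m \<Rightarrow> 'c" ("\<eta>\<index>")
  Ev :: "'m \<Rightarrow> 'c" ("\<epsilon>\<index>")

locale adj_bicategory = bicategory B
  for B :: "('o, 'm, 'c, 'z) adj_bicat_scheme" (structure) +
  assumes Dual_adjunction: "\<lbrakk>a \<in> Ob B; b \<in> Ob B; X \<in> Hom B a b\<rbrakk>
    \<Longrightarrow> adjunction B a b X (X\<^sup>\<or>) (\<eta> X) (\<epsilon> X)"

context
  fixes B :: "('o, 'm, 'c, 'z) adj_bicat_scheme" (structure)
begin

text \<open>For \<open>\<phi> : X \<Rightarrow> Y\<close> between 1-morphisms with source \<open>a\<close>, the 2-morphism \<open>Y\<^sup>\<or> \<Rightarrow> X\<^sup>\<or>\<close>.\<close>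

definition dual_cell :: "'o \<Rightarrow> 'm \<Rightarrow> 'm \<Rightarrow> 'c \<Rightarrow> 'c" where
  "dual_cell a X Y \<phi> = mate B a Y (Y\<^sup>\<or>) (\<epsilon> Y) (X\<^sup>\<or>) (\<eta> X) \<phi>"

text \<open>The canonical isomorphisms \<open>(Y \<odot> X)\<^sup>\<or> \<Rightarrow> X\<^sup>\<or> \<odot> Y\<^sup>\<or>\<close> for \<open>X : a \<rightarrow> b\<close>, \<open>Y : b \<rightarrow> c\<close>, and
  \<open>(\<one> a)\<^sup>\<or> \<Rightarrow> \<one> a\<close>.\<close>

definition dual_comp :: "'o \<Rightarrow> 'o \<Rightarrow> 'm \<Rightarrow> 'm \<Rightarrow> 'c" where
  "dual_comp a b Y X =
     radj_iso B a (Y \<odot> X) ((Y \<odot> X)\<^sup>\<or>) (\<epsilon> (Y \<odot> X)) (X\<^sup>\<or> \<odot> Y\<^sup>\<or>)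
       (comp_unit B b X (X\<^sup>\<or>) (\<eta> X) Y (Y\<^sup>\<or>) (\<eta> Y))"

definition dual_unit :: "'o \<Rightarrow> 'c" where
  "dual_unit a = radj_iso B a (\<one> a) ((\<one> a)\<^sup>\<or>) (\<epsilon> (\<one> a)) (\<one> a) (LUnitI B a (\<one> a))"

text \<open>The double right adjoint 2-endofunctor.  Its comparison 2-morphisms
  \<open>Y\<^sup>\<or>\<^sup>\<or> \<odot> X\<^sup>\<or>\<^sup>\<or> \<Rightarrow> (Y \<odot> X)\<^sup>\<or>\<^sup>\<or>\<close> and \<open>\<one> a \<Rightarrow> (\<one> a)\<^sup>\<or>\<^sup>\<or>\<close> are the mates of the canonical isomorphisms
  above, where \<open>Y\<^sup>\<or>\<^sup>\<or> \<odot> X\<^sup>\<or>\<^sup>\<or>\<close> is right adjoint to \<open>X\<^sup>\<or> \<odot> Y\<^sup>\<or>\<close> as a composite and \<open>\<one> a\<close> is right adjoint to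
  itself via the unitors.\<close>

definition double_dual :: "('o, 'm, 'c, 'o, 'm, 'c) psfun" where
  "double_dual =
    \<lparr> FOb = (\<lambda>a. a),
      FHom = (\<lambda>a b X. X\<^sup>\<or>\<^sup>\<or>),
      FCell = (\<lambda>a b X Y \<phi>. dual_cell b (Y\<^sup>\<or>) (X\<^sup>\<or>) (dual_cell a X Y \<phi>)),
      FComp = (\<lambda>a b c Y X.
        mate B c (X\<^sup>\<or> \<odot> Y\<^sup>\<or>) (Y\<^sup>\<or>\<^sup>\<or> \<odot> X\<^sup>\<or>\<^sup>\<or>)
          (comp_counit B (Y\<^sup>\<or>) (Y\<^sup>\<or>\<^sup>\<or>) (\<epsilon> (Y\<^sup>\<or>)) (X\<^sup>\<or>) (X\<^sup>\<or>\<^sup>\<or>) (\<epsilon> (X\<^sup>\<or>)))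
          ((Y \<odot> X)\<^sup>\<or>\<^sup>\<or>) (\<eta> ((Y \<odot> X)\<^sup>\<or>)) (dual_comp a b Y X)),
      FUnit = (\<lambda>a.
        mate B a (\<one> a) (\<one> a) (\<l> (\<one> a)) ((\<one> a)\<^sup>\<or>\<^sup>\<or>) (\<eta> ((\<one> a)\<^sup>\<or>)) (dual_unit a)) \<rparr>"

text \<open>For an equivalence \<open>X : a \<rightarrow> b\<close> the unit and counit of the adjunction between \<open>X\<close> and \<open>X\<^sup>\<or>\<close> are
  invertible, and their inverses make \<open>X\<close> right adjoint to \<open>X\<^sup>\<or>\<close>.  This gives the canonical
  isomorphism \<open>X\<^sup>\<or>\<^sup>\<or> \<Rightarrow> X\<close>.\<close>

definition equivalence_dd_iso :: "'o \<Rightarrow> 'o \<Rightarrow> 'm \<Rightarrow> 'c" where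
  "equivalence_dd_iso a b X =
     radj_iso B b (X\<^sup>\<or>) (X\<^sup>\<or>\<^sup>\<or>) (\<epsilon> (X\<^sup>\<or>)) X (inv2 B (X \<odot> X\<^sup>\<or>) (\<one> b) (\<epsilon> X))"

end

text \<open>A 2-functor \<open>F\<close> carries the adjunction between \<open>X : a \<rightarrow> b\<close> and \<open>X\<^sup>\<or>\<close> to one between \<open>F X\<close> and
  \<open>F (X\<^sup>\<or>)\<close>, with the following unit and counit.\<close>

context
  fixes B :: "('o, 'm, 'c, 'y) adj_bicat_scheme" (structure)
    and C :: "('p, 'n, 'd, 'z) adj_bicat_scheme" (structure)
    and F :: "('o, 'm, 'c, 'p, 'n, 'd) psfun"
begin

definition image_unit :: "'o \<Rightarrow> 'o \<Rightarrow> 'm \<Rightarrow> 'd" where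
  "image_unit a b X =
     inv2 C (FHom F b a (X\<^sup>\<or>) \<odot>\<^bsub>C\<^esub> FHom F a b X) (FHom F a a (X\<^sup>\<or> \<odot> X)) (FComp F a b a (X\<^sup>\<or>) X)
     \<cdot>\<^bsub>C\<^esub> FCell F a a (\<one> a) (X\<^sup>\<or> \<odot> X) (\<eta> X)
     \<cdot>\<^bsub>C\<^esub> FUnit F a"

definition image_counit :: "'o \<Rightarrow> 'o \<Rightarrow> 'm \<Rightarrow> 'd" where
  "image_counit a b X =
     inv2 C (\<one>\<^bsub>C\<^esub> (FOb F b)) (FHom F b b (\<one> b)) (FUnit F b)
     \<cdot>\<^bsub>C\<^esub> FCell F b b (X \<odot> X\<^sup>\<or>) (\<one> b) (\<epsilon> X)
     \<cdot>\<^bsub>C\<^esub> FComp F b a b X (X\<^sup>\<or>)"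

text \<open>The canonical isomorphisms \<open>(F X)\<^sup>\<or> \<Rightarrow> F (X\<^sup>\<or>)\<close> and \<open>F (X\<^sup>\<or>\<^sup>\<or>) \<Rightarrow> (F X)\<^sup>\<or>\<^sup>\<or>\<close>; the latter is the
  mate of the former.\<close>

definition image_dual_iso :: "'o \<Rightarrow> 'o \<Rightarrow> 'm \<Rightarrow> 'd" where
  "image_dual_iso a b X =
     radj_iso C (FOb F a) (FHom F a b X) ((FHom F a b X)\<^sup>\<or>\<^bsub>C\<^esub>) (\<epsilon>\<^bsub>C\<^esub> (FHom F a b X))
       (FHom F b a (X\<^sup>\<or>)) (image_unit a b X)"

definition image_dd_iso :: "'o \<Rightarrow> 'o \<Rightarrow> 'm \<Rightarrow> 'd" where
  "image_dd_iso a b X =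
     mate C (FOb F b) (FHom F b a (X\<^sup>\<or>)) (FHom F a b (X\<^sup>\<or>\<^sup>\<or>)) (image_counit b a (X\<^sup>\<or>))
       ((FHom F a b X)\<^sup>\<or>\<^bsub>C\<^esub>\<^sup>\<or>\<^bsub>C\<^esub>) (\<eta>\<^bsub>C\<^esub> ((FHom F a b X)\<^sup>\<or>\<^bsub>C\<^esub>)) (image_dual_iso a b X)"

end


section \<open>Volutive and dagger structures\<close>

record ('o, 'm, 'c) vol_bicat = "('o, 'm, 'c) adj_bicat" +
  Vol :: "('o, 'm, 'm, 'c) trans"

locale SO2_volutive = adj_bicategory V
  for V :: "('o, 'm, 'c) vol_bicat" +
  assumes Vol_invertible: "invertible_transformation V V (id_psfun V) (double_dual V) (Vol V)"

locale SO2_dagger = SO2_volutive +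
  assumes TOb_Vol: "a \<in> Ob V \<Longrightarrow> TOb (Vol V) a = \<one>\<^bsub>V\<^esub> a"

text \<open>The component \<open>X\<^sup>\<or>\<^sup>\<or> \<cong> X\<^sup>\<or>\<^sup>\<or> \<odot> \<one> a \<Rightarrow> \<one> b \<odot> X \<cong> X\<close> of a dagger structure at \<open>X : a \<rightarrow> b\<close>.\<close>

definition dag :: "('o, 'm, 'c) vol_bicat \<Rightarrow> 'o \<Rightarrow> 'o \<Rightarrow> 'm \<Rightarrow> 'c" where
  "dag V a b X = \<l>\<^bsub>V\<^esub> X \<cdot>\<^bsub>V\<^esub> THom (Vol V) a b X \<cdot>\<^bsub>V\<^esub> RUnitI V a (X\<^sup>\<or>\<^bsub>V\<^esub>\<^sup>\<or>\<^bsub>V\<^esub>)"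

locale SO2_dagger_functor = pseudofunctor V W F + V: SO2_dagger V + W: SO2_dagger W
  for V :: "('o, 'm, 'c) vol_bicat"
    and W :: "('p, 'n, 'd) vol_bicat"
    and F :: "('o, 'm, 'c, 'p, 'n, 'd) psfun" +
  assumes FCell_dag: "\<lbrakk>a \<in> Ob V; b \<in> Ob V; X \<in> Hom V a b\<rbrakk>
    \<Longrightarrow> FCell F a b (X\<^sup>\<or>\<^bsub>V\<^esub>\<^sup>\<or>\<^bsub>V\<^esub>) X (dag V a b X)
      = dag W (FOb F a) (FOb F b) (FHom F a b X) \<cdot>\<^bsub>W\<^esub> image_dd_iso V W F a b X"

text \<open>An invertible 2-transformation \<open>T : F \<Rightarrow> G\<close> of 2-functors \<open>V \<rightarrow> W\<close> such that the component of the
  dagger structure of \<open>W\<close> at each \<open>T\<^sub>a\<close> is the canonical isomorphism \<open>T\<^sub>a\<^sup>\<or>\<^sup>\<or> \<cong> T\<^sub>a\<close>.\<close>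

definition SO2_dagger_transformation ::
  "('o, 'm, 'c) vol_bicat \<Rightarrow> ('p, 'n, 'd) vol_bicat \<Rightarrow> ('o, 'm, 'c, 'p, 'n, 'd) psfun
    \<Rightarrow> ('o, 'm, 'c, 'p, 'n, 'd) psfun \<Rightarrow> ('o, 'm, 'n, 'd) trans \<Rightarrow> bool" where
  "SO2_dagger_transformation V W F G T \<longleftrightarrow>
     invertible_transformation V W F G T \<and>
     (\<forall>a \<in> Ob V. dag W (FOb F a) (FOb G a) (TOb T a)
        = equivalence_dd_iso W (FOb F a) (FOb G a) (TOb T a))"

definition SO2_dagger_equivalent ::
  "('o, 'm, 'c) vol_bicat \<Rightarrow> ('p, 'n, 'd) vol_bicat \<Rightarrow> bool" where
  "SO2_dagger_equivalent V W \<longleftrightarrow>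
     SO2_dagger V \<and> SO2_dagger W \<and>
     (\<exists>F G \<alpha> \<beta>.
        SO2_dagger_functor V W F \<and> SO2_dagger_functor W V G \<and>
        SO2_dagger_transformation V V (id_psfun V) (comp_psfun V W V G F) \<alpha> \<and>
        SO2_dagger_transformation W W (comp_psfun W V W F G) (id_psfun W) \<beta>)"


section \<open>Strictification and Euler completion\<close>

text \<open>A dagger 2-category is a volutive 2-category with \<open>S\<^sub>a = \<one> a\<close>, so nothing changes on data.\<close>

definition T_SO2 :: "('o, 'm, 'c) vol_bicat \<Rightarrow> ('o, 'm, 'c) vol_bicat" where
  "T_SO2 V = V"

text \<open>The objects of the strictification are pairs \<open>(a, \<lambda>)\<close> with \<open>\<lambda> : S\<^sub>a \<Rightarrow> \<one> a\<close> invertible, those of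
  the Euler completion are pairs \<open>(a, \<psi>)\<close> with \<open>\<psi> : \<one> a \<Rightarrow> \<one> a\<close> invertible.  The new structures
  are recorded in the form \<open>X\<^sup>\<or>\<^sup>\<or> \<odot> \<one> a \<Rightarrow> \<one> b \<odot> X\<close>; composing with the unitors as in
  \<open>dag\<close> gives the components \<open>X\<^sup>\<or>\<^sup>\<or> \<Rightarrow> X\<close>.\<close>

definition S_SO2 :: "('o, 'm, 'c) vol_bicat \<Rightarrow> ('o \<times> 'c, 'm, 'c) vol_bicat" where
  "S_SO2 V =
    \<lparr> Ob = {(a, \<mu>). a \<in> Ob V \<and> \<mu> \<in> Iso2 V (TOb (Vol V) a) (\<one>\<^bsub>V\<^esub> a)},
      Hom = (\<lambda>p q. Hom V (fst p) (fst q)),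
      Cell = Cell V,
      Id1 = (\<lambda>p. \<one>\<^bsub>V\<^esub> (fst p)), Comp1 = Comp1 V,
      Id2 = Id2 V, VComp = VComp V, HComp = HComp V,
      Assoc = Assoc V, LUnit = LUnit V, RUnit = RUnit V,
      Dual = Dual V, Coev = Coev V, Ev = Ev V,
      Vol =
        \<lparr> TOb = (\<lambda>p. \<one>\<^bsub>V\<^esub> (fst p)),
          THom = (\<lambda>(a, \<mu>a) (b, \<mu>b) X.
            (\<mu>b \<star>\<^bsub>V\<^esub> \<iota>\<^bsub>V\<^esub> X) \<cdot>\<^bsub>V\<^esub> THom (Vol V) a b X
            \<cdot>\<^bsub>V\<^esub> (\<iota>\<^bsub>V\<^esub> (X\<^sup>\<or>\<^bsub>V\<^esub>\<^sup>\<or>\<^bsub>V\<^esub>) \<star>\<^bsub>V\<^esub> inv2 V (TOb (Vol V) a) (\<one>\<^bsub>V\<^esub> a) \<mu>a)) \<rparr> \<rparr>"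

definition euler :: "('o, 'm, 'c) vol_bicat \<Rightarrow> ('o \<times> 'c, 'm, 'c) vol_bicat" where
  "euler V =
    \<lparr> Ob = {(a, \<psi>). a \<in> Ob V \<and> \<psi> \<in> Iso2 V (\<one>\<^bsub>V\<^esub> a) (\<one>\<^bsub>V\<^esub> a)},
      Hom = (\<lambda>p q. Hom V (fst p) (fst q)),
      Cell = Cell V,
      Id1 = (\<lambda>p. \<one>\<^bsub>V\<^esub> (fst p)), Comp1 = Comp1 V,
      Id2 = Id2 V, VComp = VComp V, HComp = HComp V,
      Assoc = Assoc V, LUnit = LUnit V, RUnit = RUnit V,
      Dual = Dual V, Coev = Coev V, Ev = Ev V,
      Vol =
        \<lparr> TOb = (\<lambda>p. \<one>\<^bsub>V\<^esub> (fst p)),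
          THom = (\<lambda>(a, \<psi>a) (b, \<psi>b) X.
            (\<psi>b \<star>\<^bsub>V\<^esub> \<iota>\<^bsub>V\<^esub> X) \<cdot>\<^bsub>V\<^esub> THom (Vol V) a b X
            \<cdot>\<^bsub>V\<^esub> (\<iota>\<^bsub>V\<^esub> (X\<^sup>\<or>\<^bsub>V\<^esub>\<^sup>\<or>\<^bsub>V\<^esub>) \<star>\<^bsub>V\<^esub> inv2 V (\<one>\<^bsub>V\<^esub> a) (\<one>\<^bsub>V\<^esub> a) \<psi>a)) \<rparr> \<rparr>"

end

theory Submission
  imports Defs
begin

text \<open>
  As \<open>S\<^sub>a = \<one> a\<close>, the objects of the Euler completion and of the strictification are literally the
  same, and the identity is a dagger 2-functor in both directions.  Two points need an argument.
  First, the strictification is again a dagger 2-category: its \<open>S\<close> arises from the old one by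
  transport along the isomorphisms \<open>S\<^sub>a \<cong> \<one> a\<close> that are part of the objects.  Secondly, the identity
  transformation has to be a dagger transformation: the axiom for \<open>S\<close> at \<open>\<one> a\<close> says that the dagger
  structure at \<open>\<one> a\<close> is inverse to the unit comparison \<open>\<one> a \<Rightarrow> (\<one> a)\<^sup>\<or>\<^sup>\<or>\<close> of the double dual, and a
  computation with mates shows the same of the canonical isomorphism \<open>(\<one> a)\<^sup>\<or>\<^sup>\<or> \<Rightarrow> \<one> a\<close>.
\<close>

section \<open>Typed 2-morphisms\<close>

text \<open>Two features of the setting shape the work. First, nothing is strict: the axioms contain
  only the pentagon and the triangle, so the other unit coherences have to be derived, above all
  that the two unitors agree at a unit 1-morphism; every computation with mates of units rests on
  this. The transport of \<open>S\<close> is carried out axiom by axiom, with the comparison cells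
  of the double dual as variables, so that of the nested mates behind them only the types enter.
  Secondly, the data are total functions, and S_a = \<one> a is known for objects a only. The two
  dagger structures to be compared may therefore differ outside the carriers, just as a composite of
  identity 2-functors differs there from the identity record. Hence the equivalence is proved for
  any two dagger structures on one bicategory that agree on the carriers.\<close>

text \<open>Morphisms bundled with their source and target, so that every typing condition is an equation
  the simplifier can decide; in a bicategory the carrier sets may overlap and determine neither.\<close>

datatype ('o, 'm) arrow = Arrow (src: 'o) (tgt: 'o) (mor: 'm)

datatype ('o, 'm, 'c) twocell =
  TwoCell (dm: "('o, 'm) arrow") (cd: "('o, 'm) arrow") (und: 'c)

text \<open>Makes the definite description in \<open>inv2\<close> meaningful. The typing hypotheses
  are those under which associativity and the unit laws may be applied.\<close>

lemma inverse2_unique: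
  assumes "bicategory B" "a \<in> Ob B" "b \<in> Ob B" "f \<in> Hom B a b" "g \<in> Hom B a b" "\<phi> \<in> Cell B f g"
    and "inverse2 B f g \<phi> \<psi>" "inverse2 B f g \<phi> \<psi>'"
  shows "\<psi> = \<psi>'"
proof -
  interpret bicategory B by fact
  have \<psi>: "\<psi> \<in> Cell B g f" "\<psi>' \<in> Cell B g f"
    using assms by (auto simp: inverse2_def)
  have "\<psi> = VComp B \<psi> (Id2 B g)"
    using VComp_Id2_right assms \<psi> by metis
  also have "\<dots> = VComp B \<psi> (VComp B \<phi> \<psi>')"
    using assms by (simp add: inverse2_def)
  also have "\<dots> = VComp B (VComp B \<psi> \<phi>) \<psi>'"
    using VComp_assoc[of a b g f g f \<psi>' \<phi> \<psi>] assms \<psi> by simp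
  also have "\<dots> = VComp B (Id2 B f) \<psi>'"
    using assms by (simp add: inverse2_def)
  also have "\<dots> = \<psi>'"
    using VComp_Id2_left assms \<psi> by metis
  finally show ?thesis .
qed

context bicategory
begin

definition arr :: "('o, 'm) arrow \<Rightarrow> bool" where
  "arr F \<longleftrightarrow> src F \<in> Ob B \<and> tgt F \<in> Ob B \<and> mor F \<in> Hom B (src F) (tgt F)"

definition cell :: "('o, 'm, 'c) twocell \<Rightarrow> bool" where
  "cell \<phi> \<longleftrightarrow> arr (dm \<phi>) \<and> arr (cd \<phi>) \<and> src (cd \<phi>) = src (dm \<phi>) \<and> tgt (cd \<phi>) = tgt (dm \<phi>) \<and>
     und \<phi> \<in> Cell B (mor (dm \<phi>)) (mor (cd \<phi>))"

definition cmp (infixr "\<circ>\<circ>" 75) where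
  "G \<circ>\<circ> F = Arrow (src F) (tgt G) (mor G \<odot> mor F)"

definition unit :: "'o \<Rightarrow> ('o, 'm) arrow" where
  "unit a = Arrow a a (\<one> a)"

definition idc :: "('o, 'm) arrow \<Rightarrow> ('o, 'm, 'c) twocell" where
  "idc F = TwoCell F F (\<iota> (mor F))"

definition vc :: "('o, 'm, 'c) twocell \<Rightarrow> ('o, 'm, 'c) twocell \<Rightarrow> ('o, 'm, 'c) twocell" (infixr "\<bullet>" 60)
  where "\<psi> \<bullet> \<phi> = TwoCell (dm \<phi>) (cd \<psi>) (und \<psi> \<cdot> und \<phi>)"

definition hc :: "('o, 'm, 'c) twocell \<Rightarrow> ('o, 'm, 'c) twocell \<Rightarrow> ('o, 'm, 'c) twocell" (infixr "\<diamondop>" 70)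
  where "\<psi> \<diamondop> \<phi> = TwoCell (dm \<psi> \<circ>\<circ> dm \<phi>) (cd \<psi> \<circ>\<circ> cd \<phi>) (und \<psi> \<star> und \<phi>)"

definition asc where
  "asc H G F = TwoCell ((H \<circ>\<circ> G) \<circ>\<circ> F) (H \<circ>\<circ> G \<circ>\<circ> F) (\<a> (mor H) (mor G) (mor F))"

definition lu where "lu F = TwoCell (unit (tgt F) \<circ>\<circ> F) F (\<l> (mor F))"

definition ru where "ru F = TwoCell (F \<circ>\<circ> unit (src F)) F (\<r> (mor F))"

definition inv where
  "inv \<phi> = TwoCell (cd \<phi>) (dm \<phi>) (inv2 B (mor (dm \<phi>)) (mor (cd \<phi>)) (und \<phi>))"

definition iso :: "('o, 'm, 'c) twocell \<Rightarrow> bool" where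
  "iso \<phi> \<longleftrightarrow> cell \<phi> \<and> und \<phi> \<in> Iso2 B (mor (dm \<phi>)) (mor (cd \<phi>))"

lemma arrow_simps [simp]:
  "src (G \<circ>\<circ> F) = src F" "tgt (G \<circ>\<circ> F) = tgt G" "mor (G \<circ>\<circ> F) = mor G \<odot> mor F"
  "src (unit a) = a" "tgt (unit a) = a" "mor (unit a) = \<one> a"
  by (simp_all add: cmp_def unit_def)

lemma cell_simps [simp]:
  "dm (idc F) = F" "cd (idc F) = F" "und (idc F) = \<iota> (mor F)"
  "dm (\<psi> \<bullet> \<phi>) = dm \<phi>" "cd (\<psi> \<bullet> \<phi>) = cd \<psi>" "und (\<psi> \<bullet> \<phi>) = und \<psi> \<cdot> und \<phi>"
  "dm (\<psi> \<diamondop> \<phi>) = dm \<psi> \<circ>\<circ> dm \<phi>" "cd (\<psi> \<diamondop> \<phi>) = cd \<psi> \<circ>\<circ> cd \<phi>" "und (\<psi> \<diamondop> \<phi>) = und \<psi> \<star> und \<phi>"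
  "dm (asc H G F) = (H \<circ>\<circ> G) \<circ>\<circ> F" "cd (asc H G F) = H \<circ>\<circ> G \<circ>\<circ> F"
  "und (asc H G F) = \<a> (mor H) (mor G) (mor F)"
  "dm (lu F) = unit (tgt F) \<circ>\<circ> F" "cd (lu F) = F" "und (lu F) = \<l> (mor F)"
  "dm (ru F) = F \<circ>\<circ> unit (src F)" "cd (ru F) = F" "und (ru F) = \<r> (mor F)"
  "dm (inv \<phi>) = cd \<phi>" "cd (inv \<phi>) = dm \<phi>"
  "und (inv \<phi>) = inv2 B (mor (dm \<phi>)) (mor (cd \<phi>)) (und \<phi>)"
  by (simp_all add: idc_def vc_def hc_def asc_def lu_def ru_def inv_def)

lemma arr_cmp [simp]: "\<lbrakk>arr F; arr G; src G = tgt F\<rbrakk> \<Longrightarrow> arr (G \<circ>\<circ> F)"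
  using Comp1_in by (auto simp: arr_def)

lemma arr_unit [simp]: "a \<in> Ob B \<Longrightarrow> arr (unit a)"
  using Id1_in by (simp add: arr_def)

lemma arr_Ob: "arr F \<Longrightarrow> src F \<in> Ob B" "arr F \<Longrightarrow> tgt F \<in> Ob B"
  by (auto simp: arr_def)

lemma cellD:
  "cell \<phi> \<Longrightarrow> arr (dm \<phi>)" "cell \<phi> \<Longrightarrow> arr (cd \<phi>)"
  "cell \<phi> \<Longrightarrow> src (cd \<phi>) = src (dm \<phi>)" "cell \<phi> \<Longrightarrow> tgt (cd \<phi>) = tgt (dm \<phi>)"
  by (auto simp: cell_def)

lemma cell_iff:
  "cell \<phi> \<longleftrightarrow> src (dm \<phi>) \<in> Ob B \<and> tgt (dm \<phi>) \<in> Ob B \<and>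
     src (cd \<phi>) = src (dm \<phi>) \<and> tgt (cd \<phi>) = tgt (dm \<phi>) \<and>
     mor (dm \<phi>) \<in> Hom B (src (dm \<phi>)) (tgt (dm \<phi>)) \<and>
     mor (cd \<phi>) \<in> Hom B (src (dm \<phi>)) (tgt (dm \<phi>)) \<and>
     und \<phi> \<in> Cell B (mor (dm \<phi>)) (mor (cd \<phi>))"
  by (auto simp: cell_def arr_def)

lemma cell_idc [simp]: "arr F \<Longrightarrow> cell (idc F)"
  using Id2_in by (auto simp: cell_iff arr_def)

lemma cell_vc [simp]: "\<lbrakk>cell \<phi>; cell \<psi>; dm \<psi> = cd \<phi>\<rbrakk> \<Longrightarrow> cell (\<psi> \<bullet> \<phi>)"
  using VComp_in by (auto simp: cell_iff arr_def)

lemma cell_hc [simp]: "\<lbrakk>cell \<phi>; cell \<psi>; src (dm \<psi>) = tgt (dm \<phi>)\<rbrakk> \<Longrightarrow> cell (\<psi> \<diamondop> \<phi>)"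
  using HComp_in[of "src (dm \<phi>)" "tgt (dm \<phi>)" "tgt (dm \<psi>)"] Comp1_in
  by (auto simp: cell_iff arr_def)

lemma vc_assoc [simp]:
  "\<lbrakk>cell \<phi>; cell \<psi>; cell \<chi>; dm \<psi> = cd \<phi>; dm \<chi> = cd \<psi>\<rbrakk> \<Longrightarrow> (\<chi> \<bullet> \<psi>) \<bullet> \<phi> = \<chi> \<bullet> \<psi> \<bullet> \<phi>"
  using VComp_assoc[of "src (dm \<phi>)" "tgt (dm \<phi>)" "mor (dm \<phi>)" "mor (cd \<phi>)" "mor (cd \<psi>)"
      "mor (cd \<chi>)" "und \<phi>" "und \<psi>" "und \<chi>"] by (simp add: cell_iff arr_def vc_def)

lemma vc_idc [simp]:
  "\<lbrakk>cell \<phi>; F = cd \<phi>\<rbrakk> \<Longrightarrow> idc F \<bullet> \<phi> = \<phi>" "\<lbrakk>cell \<phi>; F = dm \<phi>\<rbrakk> \<Longrightarrow> \<phi> \<bullet> idc F = \<phi>"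
proof -
  assume "cell \<phi>"
  then have "und (idc (cd \<phi>) \<bullet> \<phi>) = und \<phi>" "und (\<phi> \<bullet> idc (dm \<phi>)) = und \<phi>"
    using VComp_Id2_left[of "src (dm \<phi>)" "tgt (dm \<phi>)" "mor (dm \<phi>)" "mor (cd \<phi>)" "und \<phi>"]
      VComp_Id2_right[of "src (dm \<phi>)" "tgt (dm \<phi>)" "mor (dm \<phi>)" "mor (cd \<phi>)" "und \<phi>"]
    by (auto simp: cell_iff)
  then show "F = cd \<phi> \<Longrightarrow> idc F \<bullet> \<phi> = \<phi>" "F = dm \<phi> \<Longrightarrow> \<phi> \<bullet> idc F = \<phi>"
    by (auto intro: twocell.expand)
qed

lemma hc_idc [simp]: "\<lbrakk>arr F; arr G; src G = tgt F\<rbrakk> \<Longrightarrow> idc G \<diamondop> idc F = idc (G \<circ>\<circ> F)"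
  using HComp_Id2[of "src F" "tgt F" "tgt G"] by (simp add: hc_def idc_def arr_def)

lemma interchange_cells:
  "\<lbrakk>cell \<phi>; cell \<phi>'; cell \<psi>; cell \<psi>'; dm \<phi>' = cd \<phi>; dm \<psi>' = cd \<psi>; src (dm \<psi>) = tgt (dm \<phi>)\<rbrakk>
    \<Longrightarrow> (\<psi>' \<diamondop> \<phi>') \<bullet> (\<psi> \<diamondop> \<phi>) = (\<psi>' \<bullet> \<psi>) \<diamondop> (\<phi>' \<bullet> \<phi>)"
  using interchange[of "src (dm \<phi>)" "tgt (dm \<phi>)" "tgt (dm \<psi>)" "mor (dm \<phi>)" "mor (cd \<phi>)"
      "mor (cd \<phi>')" "mor (dm \<psi>)" "mor (cd \<psi>)" "mor (cd \<psi>')" "und \<phi>" "und \<phi>'" "und \<psi>" "und \<psi>'"]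
  by (simp add: hc_def vc_def cell_iff arr_def)

section \<open>Invertible 2-morphisms\<close>

lemma inverse2_inv2:
  assumes "iso \<phi>"
  shows "inverse2 B (mor (dm \<phi>)) (mor (cd \<phi>)) (und \<phi>) (und (inv \<phi>))"
proof -
  obtain \<psi> where "inverse2 B (mor (dm \<phi>)) (mor (cd \<phi>)) (und \<phi>) \<psi>"
    using assms by (auto simp: iso_def Iso2_def)
  moreover have "\<psi>' = \<psi>''" if "inverse2 B (mor (dm \<phi>)) (mor (cd \<phi>)) (und \<phi>) \<psi>'"
    "inverse2 B (mor (dm \<phi>)) (mor (cd \<phi>)) (und \<phi>) \<psi>''" for \<psi>' \<psi>''
    using inverse2_unique[OF bicategory_axioms, of "src (dm \<phi>)" "tgt (dm \<phi>)"] that assms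
    by (auto simp: iso_def cell_iff arr_def)
  ultimately have "\<exists>!\<psi>. inverse2 B (mor (dm \<phi>)) (mor (cd \<phi>)) (und \<phi>) \<psi>"
    by blast
  from theI'[OF this] show ?thesis
    by (simp add: inv2_def)
qed

lemma iso_cell [simp]: "iso \<phi> \<Longrightarrow> cell \<phi>"
  by (simp add: iso_def)

lemma cell_inv [simp]: "iso \<phi> \<Longrightarrow> cell (inv \<phi>)"
  using inverse2_inv2[of \<phi>] iso_cell[of \<phi>] by (simp add: cell_iff inverse2_def del: iso_cell)

lemma vc_inv [simp]: "iso \<phi> \<Longrightarrow> inv \<phi> \<bullet> \<phi> = idc (dm \<phi>)" "iso \<phi> \<Longrightarrow> \<phi> \<bullet> inv \<phi> = idc (cd \<phi>)"
  using inverse2_inv2[of \<phi>] by (auto simp: vc_def idc_def inverse2_def)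

lemma vc_inv_cancel [simp]:
  assumes "iso \<phi>" "cell \<psi>"
  shows "cd \<psi> = dm \<phi> \<Longrightarrow> inv \<phi> \<bullet> \<phi> \<bullet> \<psi> = \<psi>" "cd \<psi> = cd \<phi> \<Longrightarrow> \<phi> \<bullet> inv \<phi> \<bullet> \<psi> = \<psi>"
  by (simp_all add: assms vc_assoc[symmetric] del: vc_assoc)

text \<open>Uniqueness of inverses turns any explicit two-sided inverse into the value of
  \<open>inv\<close>; the rules for inverses of identities and of vertical and horizontal composites
  all come from here.\<close>

lemma isoI:
  assumes "cell \<phi>" "cell \<psi>" "dm \<psi> = cd \<phi>" "cd \<psi> = dm \<phi>"
    and "\<psi> \<bullet> \<phi> = idc (dm \<phi>)" "\<phi> \<bullet> \<psi> = idc (cd \<phi>)"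
  shows "iso \<phi>" "inv \<phi> = \<psi>"
proof -
  show *: "iso \<phi>"
    using assms by (auto simp: iso_def Iso2_def inverse2_def vc_def idc_def cell_iff simp del: iso_cell)
  have "inv \<phi> = inv \<phi> \<bullet> \<phi> \<bullet> \<psi>"
    using * assms by simp
  also have "\<dots> = \<psi>"
    using * assms(2,4) by simp
  finally show "inv \<phi> = \<psi>" .
qed

declare arr_Ob [simp] cellD [simp]

lemma iso_idc [simp]: "arr F \<Longrightarrow> iso (idc F)" and inv_idc [simp]: "arr F \<Longrightarrow> inv (idc F) = idc F"
  using isoI[of "idc F" "idc F"] by simp_all

lemma iso_inv [simp]: "iso \<phi> \<Longrightarrow> iso (inv \<phi>)" and inv_inv [simp]: "iso \<phi> \<Longrightarrow> inv (inv \<phi>) = \<phi>"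
  using isoI[of "inv \<phi>" \<phi>] by simp_all

lemma iso_vc [simp]: "\<lbrakk>iso \<phi>; iso \<psi>; dm \<psi> = cd \<phi>\<rbrakk> \<Longrightarrow> iso (\<psi> \<bullet> \<phi>)"
  and inv_vc: "\<lbrakk>iso \<phi>; iso \<psi>; dm \<psi> = cd \<phi>\<rbrakk> \<Longrightarrow> inv (\<psi> \<bullet> \<phi>) = inv \<phi> \<bullet> inv \<psi>"
  using isoI[of "\<psi> \<bullet> \<phi>" "inv \<phi> \<bullet> inv \<psi>"] by simp_all

lemma iso_hc [simp]: "\<lbrakk>iso \<phi>; iso \<psi>; src (dm \<psi>) = tgt (dm \<phi>)\<rbrakk> \<Longrightarrow> iso (\<psi> \<diamondop> \<phi>)"
  and inv_hc: "\<lbrakk>iso \<phi>; iso \<psi>; src (dm \<psi>) = tgt (dm \<phi>)\<rbrakk> \<Longrightarrow> inv (\<psi> \<diamondop> \<phi>) = inv \<psi> \<diamondop> inv \<phi>"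
  using isoI[of "\<psi> \<diamondop> \<phi>" "inv \<psi> \<diamondop> inv \<phi>"] by (simp_all add: interchange_cells)

lemma iso_asc [simp]:
  "\<lbrakk>arr F; arr G; arr H; src G = tgt F; src H = tgt G\<rbrakk> \<Longrightarrow> iso (asc H G F)"
  using Assoc_iso[of "src F" "src G" "src H" "tgt H"] Comp1_in
  by (auto simp: iso_def cell_iff arr_def Iso2_def simp del: iso_cell arr_Ob cellD)

lemma iso_lu [simp]: "arr F \<Longrightarrow> iso (lu F)"
  using LUnit_iso[of "src F" "tgt F"] Comp1_in Id1_in by (auto simp: iso_def cell_iff arr_def Iso2_def simp del: iso_cell arr_Ob cellD)

lemma iso_ru [simp]: "arr F \<Longrightarrow> iso (ru F)"
  using RUnit_iso[of "src F" "tgt F"] Comp1_in Id1_in by (auto simp: iso_def cell_iff arr_def Iso2_def simp del: iso_cell arr_Ob cellD)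

lemma asc_natural:
  assumes "cell \<phi>" "cell \<psi>" "cell \<chi>" "src (dm \<psi>) = tgt (dm \<phi>)" "src (dm \<chi>) = tgt (dm \<psi>)"
  shows "asc (cd \<chi>) (cd \<psi>) (cd \<phi>) \<bullet> ((\<chi> \<diamondop> \<psi>) \<diamondop> \<phi>) =
    (\<chi> \<diamondop> \<psi> \<diamondop> \<phi>) \<bullet> asc (dm \<chi>) (dm \<psi>) (dm \<phi>)"
  using Assoc_natural[of "src (dm \<phi>)" "src (dm \<psi>)" "src (dm \<chi>)" "tgt (dm \<chi>)"
      "mor (dm \<phi>)" "mor (cd \<phi>)" "mor (dm \<psi>)" "mor (cd \<psi>)" "mor (dm \<chi>)" "mor (cd \<chi>)"] assms
  by (simp add: vc_def hc_def asc_def cell_iff arr_def del: arr_Ob cellD)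

lemma lu_natural: "cell \<phi> \<Longrightarrow> lu (cd \<phi>) \<bullet> (idc (unit (tgt (dm \<phi>))) \<diamondop> \<phi>) = \<phi> \<bullet> lu (dm \<phi>)"
  using LUnit_natural[of "src (dm \<phi>)" "tgt (dm \<phi>)" "mor (dm \<phi>)" "mor (cd \<phi>)"]
  by (simp add: vc_def hc_def lu_def idc_def cell_iff arr_def del: arr_Ob cellD)

lemma ru_natural: "cell \<phi> \<Longrightarrow> ru (cd \<phi>) \<bullet> (\<phi> \<diamondop> idc (unit (src (dm \<phi>)))) = \<phi> \<bullet> ru (dm \<phi>)"
  using RUnit_natural[of "src (dm \<phi>)" "tgt (dm \<phi>)" "mor (dm \<phi>)" "mor (cd \<phi>)"]
  by (simp add: vc_def hc_def ru_def idc_def cell_iff arr_def del: arr_Ob cellD)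

lemma pentagon_cells:
  "\<lbrakk>arr F; arr G; arr H; arr K; src G = tgt F; src H = tgt G; src K = tgt H\<rbrakk>
    \<Longrightarrow> (idc K \<diamondop> asc H G F) \<bullet> asc K (H \<circ>\<circ> G) F \<bullet> (asc K H G \<diamondop> idc F)
      = asc K H (G \<circ>\<circ> F) \<bullet> asc (K \<circ>\<circ> H) G F"
  using pentagon[of "src F" "src G" "src H" "src K" "tgt K"]
  by (simp add: vc_def hc_def asc_def idc_def arr_def cmp_def del: arr_Ob cellD)

lemma triangle_cells:
  "\<lbrakk>arr F; arr G; src G = tgt F\<rbrakk>
    \<Longrightarrow> (idc G \<diamondop> lu F) \<bullet> asc G (unit (tgt F)) F = ru G \<diamondop> idc F"
  using triangle[of "src F" "src G" "tgt G"]
  by (simp add: vc_def hc_def asc_def idc_def lu_def ru_def arr_def cmp_def unit_def del: arr_Ob cellD)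

subsection \<open>Coherence of the unitors\<close>

lemma whisker_left:
  "\<lbrakk>arr G; cell \<phi>; cell \<psi>; dm \<psi> = cd \<phi>; src G = tgt (dm \<phi>)\<rbrakk>
    \<Longrightarrow> idc G \<diamondop> (\<psi> \<bullet> \<phi>) = (idc G \<diamondop> \<psi>) \<bullet> (idc G \<diamondop> \<phi>)"
  by (simp add: interchange_cells)

lemma whisker_right:
  "\<lbrakk>arr F; cell \<phi>; cell \<psi>; dm \<psi> = cd \<phi>; src (dm \<phi>) = tgt F\<rbrakk>
    \<Longrightarrow> (\<psi> \<bullet> \<phi>) \<diamondop> idc F = (\<psi> \<diamondop> idc F) \<bullet> (\<phi> \<diamondop> idc F)"
  by (simp add: interchange_cells)

text \<open>Composites are normalised to the right, so an equation for
  \<open>\<psi> \<bullet> \<phi>\<close> does not match in the middle of a longer composite. This is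
  the same equation with a tail \<open>\<xi>\<close>.\<close>

lemma vc_reduce:
  "\<lbrakk>\<psi> \<bullet> \<phi> = \<chi>; cell \<phi>; cell \<psi>; cell \<xi>; dm \<psi> = cd \<phi>; dm \<phi> = cd \<xi>\<rbrakk> \<Longrightarrow> \<psi> \<bullet> \<phi> \<bullet> \<xi> = \<chi> \<bullet> \<xi>"
  using vc_assoc by metis

lemma vc_cancel_right:
  assumes "\<psi> \<bullet> \<chi> = \<psi>' \<bullet> \<chi>" "iso \<chi>" "cell \<psi>" "cell \<psi>'" "dm \<psi> = cd \<chi>" "dm \<psi>' = cd \<chi>"
  shows "\<psi> = \<psi>'"
proof -
  have "(\<psi> \<bullet> \<chi>) \<bullet> inv \<chi> = (\<psi>' \<bullet> \<chi>) \<bullet> inv \<chi>"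
    using assms by simp
  then show ?thesis
    using assms(2-) by simp
qed

lemma vc_cancel_left:
  assumes "\<chi> \<bullet> \<psi> = \<chi> \<bullet> \<psi>'" "iso \<chi>" "cell \<psi>" "cell \<psi>'" "cd \<psi> = dm \<chi>" "cd \<psi>' = dm \<chi>"
  shows "\<psi> = \<psi>'"
proof -
  have "inv \<chi> \<bullet> \<chi> \<bullet> \<psi> = inv \<chi> \<bullet> \<chi> \<bullet> \<psi>'"
    using assms by simp
  then show ?thesis
    using assms(2-) by simp
qed

text \<open>Naturality of \<open>lu\<close> conjugates the whiskered cell back to
  \<open>\<phi>\<close>, so whiskering with a unit is faithful. Together with its right-hand version
  this reduces the unit coherences below to the pentagon.\<close>

lemma whisker_unit_left_cancel:
  assumes "idc (unit (tgt (dm \<phi>))) \<diamondop> \<phi> = idc (unit (tgt (dm \<phi>))) \<diamondop> \<psi>"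
    and "cell \<phi>" "cell \<psi>" "dm \<psi> = dm \<phi>" "cd \<psi> = cd \<phi>"
  shows "\<phi> = \<psi>"
proof (rule vc_cancel_right)
  show "\<phi> \<bullet> lu (dm \<phi>) = \<psi> \<bullet> lu (dm \<phi>)"
    using lu_natural[of \<phi>] lu_natural[of \<psi>] assms by simp
qed (use assms in simp_all)

lemma whisker_unit_right_cancel:
  assumes "\<phi> \<diamondop> idc (unit (src (dm \<phi>))) = \<psi> \<diamondop> idc (unit (src (dm \<phi>)))"
    and "cell \<phi>" "cell \<psi>" "dm \<psi> = dm \<phi>" "cd \<psi> = cd \<phi>"
  shows "\<phi> = \<psi>"
proof (rule vc_cancel_right)
  show "\<phi> \<bullet> ru (dm \<phi>) = \<psi> \<bullet> ru (dm \<phi>)"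
    using ru_natural[of \<phi>] ru_natural[of \<psi>] assms by simp
qed (use assms in simp_all)

text \<open>Kelly's argument that this coherence follows from the pentagon and the triangle: after
  whiskering with the unit \<open>U\<close>, the pentagon for \<open>U\<close>, \<open>U\<close>,
  \<open>G\<close>, \<open>F\<close> and two instances of the triangle connect the two
  sides.\<close>

lemma lu_cmp:
  assumes [simp]: "arr F" "arr G" "src G = tgt F"
  shows "lu (G \<circ>\<circ> F) \<bullet> asc (unit (tgt G)) G F = lu G \<diamondop> idc F"
proof -
  define U where "U = unit (tgt G)"
  have [simp]: "arr U" "src U = tgt G" "tgt U = tgt G" "unit (tgt G) = U"
    by (simp_all add: U_def)
  \<comment> \<open>These two associators complete the pentagon; their composite is invertible and
    is cancelled at the end.\<close>
  let ?X = "asc U (U \<circ>\<circ> G) F \<bullet> (asc U U G \<diamondop> idc F)"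
  have "(idc U \<diamondop> (lu (G \<circ>\<circ> F) \<bullet> asc U G F)) \<bullet> ?X
      = (idc U \<diamondop> lu (G \<circ>\<circ> F)) \<bullet> (idc U \<diamondop> asc U G F) \<bullet> ?X"
    by (simp add: whisker_left)
  also have "\<dots> = (idc U \<diamondop> lu (G \<circ>\<circ> F)) \<bullet> asc U U (G \<circ>\<circ> F) \<bullet> asc (U \<circ>\<circ> U) G F"
    by (simp add: pentagon_cells)
  also have "\<dots> = (ru U \<diamondop> idc G \<diamondop> idc F) \<bullet> asc (U \<circ>\<circ> U) G F"
    using vc_reduce[OF triangle_cells[of "G \<circ>\<circ> F" U], of "asc (U \<circ>\<circ> U) G F"] by simp
  also have "\<dots> = asc U G F \<bullet> ((ru U \<diamondop> idc G) \<diamondop> idc F)"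
    using asc_natural[of "idc F" "idc G" "ru U"] by simp
  also have "\<dots> = asc U G F \<bullet> ((idc U \<diamondop> lu G) \<diamondop> idc F) \<bullet> (asc U U G \<diamondop> idc F)"
    using triangle_cells[of G U] whisker_right[of F "asc U U G" "idc U \<diamondop> lu G"] by simp
  also have "\<dots> = (idc U \<diamondop> (lu G \<diamondop> idc F)) \<bullet> ?X"
    using vc_reduce[OF asc_natural[of "idc F" "lu G" "idc U"], of "asc U U G \<diamondop> idc F"] by simp
  finally have "idc U \<diamondop> (lu (G \<circ>\<circ> F) \<bullet> asc U G F) = idc U \<diamondop> (lu G \<diamondop> idc F)"
    by (rule vc_cancel_right) simp_all
  then show ?thesis
    using whisker_unit_left_cancel[of "lu (G \<circ>\<circ> F) \<bullet> asc U G F" "lu G \<diamondop> idc F"] by simp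
qed

text \<open>The mirror image of \<open>lu_cmp\<close>: the pentagon is that of \<open>G\<close>,
  \<open>F\<close> and two units on the right, and the cell to be cancelled stands on the
  left.\<close>

lemma ru_cmp:
  assumes [simp]: "arr F" "arr G" "src G = tgt F"
  shows "(idc G \<diamondop> ru F) \<bullet> asc G F (unit (src F)) = ru (G \<circ>\<circ> F)"
proof -
  define U where "U = unit (src F)"
  have [simp]: "arr U" "src U = src F" "tgt U = src F" "unit (src F) = U"
    by (simp_all add: U_def)
  have "asc G F U \<bullet> (((idc G \<diamondop> ru F) \<bullet> asc G F U) \<diamondop> idc U)
      = asc G F U \<bullet> ((idc G \<diamondop> ru F) \<diamondop> idc U) \<bullet> (asc G F U \<diamondop> idc U)"
    by (simp add: whisker_right)
  also have "\<dots> = (idc G \<diamondop> (ru F \<diamondop> idc U)) \<bullet> asc G (F \<circ>\<circ> U) U \<bullet> (asc G F U \<diamondop> idc U)"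
    using vc_reduce[OF asc_natural[of "idc U" "ru F" "idc G"], of "asc G F U \<diamondop> idc U"] by simp
  also have "\<dots> = (idc G \<diamondop> idc F \<diamondop> lu U) \<bullet> (idc G \<diamondop> asc F U U) \<bullet> asc G (F \<circ>\<circ> U) U \<bullet> (asc G F U \<diamondop> idc U)"
    using triangle_cells[of U F] whisker_left[of G "asc F U U" "idc F \<diamondop> lu U"] by simp
  also have "\<dots> = (idc G \<diamondop> idc F \<diamondop> lu U) \<bullet> asc G F (U \<circ>\<circ> U) \<bullet> asc (G \<circ>\<circ> F) U U"
    by (simp add: pentagon_cells)
  also have "\<dots> = asc G F U \<bullet> (idc (G \<circ>\<circ> F) \<diamondop> lu U) \<bullet> asc (G \<circ>\<circ> F) U U"
    using vc_reduce[OF asc_natural[of "lu U" "idc F" "idc G", symmetric], of "asc (G \<circ>\<circ> F) U U"] by simp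
  also have "\<dots> = asc G F U \<bullet> (ru (G \<circ>\<circ> F) \<diamondop> idc U)"
    using triangle_cells[of U "G \<circ>\<circ> F"] by simp
  finally have "((idc G \<diamondop> ru F) \<bullet> asc G F U) \<diamondop> idc U = ru (G \<circ>\<circ> F) \<diamondop> idc U"
    by (rule vc_cancel_left) simp_all
  then show ?thesis
    using whisker_unit_right_cancel[of "(idc G \<diamondop> ru F) \<bullet> asc G F U" "ru (G \<circ>\<circ> F)"] by simp
qed

text \<open>Naturality of \<open>lu\<close> at \<open>lu ?U\<close> itself identifies
  \<open>idc ?U \<diamondop> lu ?U\<close> with \<open>lu (?U \<circ>\<circ> ?U)\<close>; after
  that, \<open>lu_cmp\<close> and the triangle have the same left-hand side.\<close>

lemma lu_unit:
  assumes [simp]: "a \<in> Ob B"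
  shows "lu (unit a) = ru (unit a)"
proof -
  let ?U = "unit a"
  have "lu ?U \<bullet> (idc ?U \<diamondop> lu ?U) = lu ?U \<bullet> lu (?U \<circ>\<circ> ?U)"
    using lu_natural[of "lu ?U"] by simp
  then have "idc ?U \<diamondop> lu ?U = lu (?U \<circ>\<circ> ?U)"
    by (rule vc_cancel_left) simp_all
  then have "lu ?U \<diamondop> idc ?U = ru ?U \<diamondop> idc ?U"
    using lu_cmp[of ?U ?U] triangle_cells[of ?U ?U] by simp
  then show ?thesis
    using whisker_unit_right_cancel[of "lu ?U" "ru ?U"] by simp
qed

lemma inv_lu_natural:
  assumes [simp]: "cell \<phi>"
  shows "(idc (unit (tgt (dm \<phi>))) \<diamondop> \<phi>) \<bullet> inv (lu (dm \<phi>)) = inv (lu (cd \<phi>)) \<bullet> \<phi>"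
proof (rule vc_cancel_left)
  show "lu (cd \<phi>) \<bullet> (idc (unit (tgt (dm \<phi>))) \<diamondop> \<phi>) \<bullet> inv (lu (dm \<phi>))
      = lu (cd \<phi>) \<bullet> inv (lu (cd \<phi>)) \<bullet> \<phi>"
    using vc_reduce[OF lu_natural[of \<phi>], of "inv (lu (dm \<phi>))"] by simp
qed simp_all

lemma inv_ru_natural:
  assumes [simp]: "cell \<phi>"
  shows "(\<phi> \<diamondop> idc (unit (src (dm \<phi>)))) \<bullet> inv (ru (dm \<phi>)) = inv (ru (cd \<phi>)) \<bullet> \<phi>"
proof (rule vc_cancel_left)
  show "ru (cd \<phi>) \<bullet> (\<phi> \<diamondop> idc (unit (src (dm \<phi>)))) \<bullet> inv (ru (dm \<phi>))
      = ru (cd \<phi>) \<bullet> inv (ru (cd \<phi>)) \<bullet> \<phi>"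
    using vc_reduce[OF ru_natural[of \<phi>], of "inv (ru (dm \<phi>))"] by simp
qed simp_all

lemma inv_asc_natural:
  assumes [simp]: "cell \<phi>" "cell \<psi>" "cell \<chi>" "src (dm \<psi>) = tgt (dm \<phi>)" "src (dm \<chi>) = tgt (dm \<psi>)"
  shows "inv (asc (cd \<chi>) (cd \<psi>) (cd \<phi>)) \<bullet> (\<chi> \<diamondop> \<psi> \<diamondop> \<phi>) =
    ((\<chi> \<diamondop> \<psi>) \<diamondop> \<phi>) \<bullet> inv (asc (dm \<chi>) (dm \<psi>) (dm \<phi>))"
proof (rule vc_cancel_left)
  show "asc (cd \<chi>) (cd \<psi>) (cd \<phi>) \<bullet> inv (asc (cd \<chi>) (cd \<psi>) (cd \<phi>)) \<bullet> (\<chi> \<diamondop> \<psi> \<diamondop> \<phi>) =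
    asc (cd \<chi>) (cd \<psi>) (cd \<phi>) \<bullet> ((\<chi> \<diamondop> \<psi>) \<diamondop> \<phi>) \<bullet> inv (asc (dm \<chi>) (dm \<psi>) (dm \<phi>))"
    using vc_reduce[OF asc_natural[of \<phi> \<psi> \<chi>], of "inv (asc (dm \<chi>) (dm \<psi>) (dm \<phi>))"] by simp
qed simp_all

lemma inv_lu_cmp:
  assumes [simp]: "arr F" "arr G" "src G = tgt F"
  shows "asc (unit (tgt G)) G F \<bullet> (inv (lu G) \<diamondop> idc F) = inv (lu (G \<circ>\<circ> F))"
proof -
  have "inv (lu G) \<diamondop> idc F = inv (asc (unit (tgt G)) G F) \<bullet> inv (lu (G \<circ>\<circ> F))"
    using lu_cmp[of F G] inv_vc[of "asc (unit (tgt G)) G F" "lu (G \<circ>\<circ> F)"] inv_hc[of "idc F" "lu G"]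
    by simp
  then show ?thesis by simp
qed

subsection \<open>Adjunctions and mates\<close>

definition adj where
  "adj L R \<theta> \<zeta> \<longleftrightarrow> arr L \<and> arr R \<and> src R = tgt L \<and> tgt R = src L \<and>
     cell \<theta> \<and> dm \<theta> = unit (src L) \<and> cd \<theta> = R \<circ>\<circ> L \<and>
     cell \<zeta> \<and> dm \<zeta> = L \<circ>\<circ> R \<and> cd \<zeta> = unit (tgt L) \<and>
     lu L \<bullet> (\<zeta> \<diamondop> idc L) \<bullet> inv (asc L R L) \<bullet> (idc L \<diamondop> \<theta>) = ru L \<and>
     ru R \<bullet> (idc R \<diamondop> \<zeta>) \<bullet> asc R L R \<bullet> (\<theta> \<diamondop> idc R) = lu R"

definition mat where
  "mat L R \<zeta> R' \<theta> \<phi> =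
     ru R' \<bullet> (idc R' \<diamondop> \<zeta>) \<bullet> asc R' L R \<bullet> ((idc R' \<diamondop> \<phi>) \<diamondop> idc R) \<bullet> (\<theta> \<diamondop> idc R) \<bullet> inv (lu R)"

text \<open>For one and the same adjunction the mate formula contains the second triangle identity,
  and the remaining unitors cancel. So the canonical isomorphism of a right adjoint with itself is
  trivial.\<close>

lemma mat_adj: "adj L R \<theta> \<zeta> \<Longrightarrow> mat L R \<zeta> R \<theta> (idc L) = idc R"
proof -
  assume *: "adj L R \<theta> \<zeta>"
  then have [simp]: "arr L" "arr R" "src R = tgt L" "tgt R = src L"
    "cell \<theta>" "dm \<theta> = unit (src L)" "cd \<theta> = R \<circ>\<circ> L" "cell \<zeta>" "dm \<zeta> = L \<circ>\<circ> R" "cd \<zeta> = unit (tgt L)"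
    by (simp_all add: adj_def)
  have "mat L R \<zeta> R \<theta> (idc L) = (ru R \<bullet> (idc R \<diamondop> \<zeta>) \<bullet> asc R L R \<bullet> (\<theta> \<diamondop> idc R)) \<bullet> inv (lu R)"
    by (simp add: mat_def)
  also have "\<dots> = lu R \<bullet> inv (lu R)"
    using * by (simp add: adj_def)
  also have "\<dots> = idc R"
    by simp
  finally show ?thesis .
qed

text \<open>A right adjoint of a unit 1-morphism is isomorphic to it. Each triangle identity, once
  its unitors are removed, gives one of the two inverse laws.\<close>

lemma adj_unit_inverse:
  assumes *: "adj (unit a) L \<theta> \<zeta>" and [simp]: "a \<in> Ob B"
  shows "(\<zeta> \<bullet> inv (lu L)) \<bullet> (ru L \<bullet> \<theta>) = idc (unit a)"
    and "(ru L \<bullet> \<theta>) \<bullet> (\<zeta> \<bullet> inv (lu L)) = idc L"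
proof -
  define U where "U = unit a"
  have [simp]: "arr U" "src U = a" "tgt U = a" "unit a = U"
    by (simp_all add: U_def)
  have [simp]: "arr L" "src L = a" "tgt L = a"
    "cell \<theta>" "dm \<theta> = U" "cd \<theta> = L \<circ>\<circ> U" "cell \<zeta>" "dm \<zeta> = U \<circ>\<circ> L" "cd \<zeta> = U"
    and tri: "lu U \<bullet> (\<zeta> \<diamondop> idc U) \<bullet> inv (asc U L U) \<bullet> (idc U \<diamondop> \<theta>) = ru U"
      "ru L \<bullet> (idc L \<diamondop> \<zeta>) \<bullet> asc L U L \<bullet> (\<theta> \<diamondop> idc L) = lu L"
    using * by (simp_all add: adj_def)
  have lr [simp]: "lu U = ru U"
    using lu_unit[of a] by simp
  \<comment> \<open>Counit and unit with the unit 1-morphism stripped off: \<open>d\<close> goes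
    from \<open>L\<close> to \<open>U\<close> and \<open>j\<close> from \<open>U\<close> to
    \<open>L\<close>.\<close>
  define d j where "d = \<zeta> \<bullet> inv (lu L)" and "j = ru L \<bullet> \<theta>"
  have [simp]: "cell d" "dm d = L" "cd d = U" "cell j" "dm j = U" "cd j = L"
    by (simp_all add: d_def j_def)
  have \<zeta>: "\<zeta> = d \<bullet> lu L"
    by (simp add: d_def)
  have "d \<bullet> j = (d \<bullet> ru L) \<bullet> \<theta>"
    by (simp add: j_def)
  also have "d \<bullet> ru L = ru U \<bullet> (d \<diamondop> idc U)"
    using ru_natural[of d] by simp
  also have "d \<diamondop> idc U = (\<zeta> \<diamondop> idc U) \<bullet> (inv (lu L) \<diamondop> idc U)"
    by (simp add: d_def whisker_right)
  also have "inv (lu L) \<diamondop> idc U = inv (asc U L U) \<bullet> inv (lu (L \<circ>\<circ> U))"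
    using inv_lu_cmp[of U L, symmetric] by simp
  also have "(ru U \<bullet> (\<zeta> \<diamondop> idc U) \<bullet> inv (asc U L U) \<bullet> inv (lu (L \<circ>\<circ> U))) \<bullet> \<theta>
      = ru U \<bullet> (\<zeta> \<diamondop> idc U) \<bullet> inv (asc U L U) \<bullet> (idc U \<diamondop> \<theta>) \<bullet> inv (lu U)"
    using inv_lu_natural[of \<theta>] by simp
  also have "\<dots> = (lu U \<bullet> (\<zeta> \<diamondop> idc U) \<bullet> inv (asc U L U) \<bullet> (idc U \<diamondop> \<theta>)) \<bullet> inv (lu U)"
    by simp
  also have "\<dots> = idc U"
    unfolding tri by simp
  finally show "(\<zeta> \<bullet> inv (lu L)) \<bullet> (ru L \<bullet> \<theta>) = idc (unit a)"
    by (simp add: d_def j_def)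
  have "lu L = ru L \<bullet> (idc L \<diamondop> d) \<bullet> (idc L \<diamondop> lu L) \<bullet> asc L U L \<bullet> (\<theta> \<diamondop> idc L)"
    using tri(2) by (simp add: \<zeta> whisker_left)
  also have "\<dots> = ru L \<bullet> (idc L \<diamondop> d) \<bullet> (ru L \<diamondop> idc L) \<bullet> (\<theta> \<diamondop> idc L)"
    using vc_reduce[OF triangle_cells[of L L], of "\<theta> \<diamondop> idc L"] by simp
  \<comment> \<open>\<open>d\<close> and \<open>j\<close> now sit on different factors, so
    interchange swaps them.\<close>
  also have "\<dots> = ru L \<bullet> (j \<diamondop> idc U) \<bullet> (idc U \<diamondop> d)"
    by (simp add: interchange_cells j_def)
  also have "\<dots> = (j \<bullet> ru U) \<bullet> (idc U \<diamondop> d)"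
    using vc_reduce[OF ru_natural[of j], of "idc U \<diamondop> d"] by simp
  also have "\<dots> = (j \<bullet> d) \<bullet> lu L"
    using lu_natural[of d] by simp
  finally have "idc L \<bullet> lu L = (j \<bullet> d) \<bullet> lu L"
    by simp
  then have "idc L = j \<bullet> d"
    by (rule vc_cancel_right) simp_all
  then show "(ru L \<bullet> \<theta>) \<bullet> (\<zeta> \<bullet> inv (lu L)) = idc L"
    by (simp add: d_def j_def)
qed

text \<open>The outer mate in the unit comparison of the double dual has this shape, the unit
  1-morphism being adjoint to itself. The associator and the counit \<open>lu\<close> contract by
  the triangle; naturality of \<open>ru\<close> then strips off the whiskering with the
  unit.\<close>

lemma mat_unit_unit:
  assumes [simp]: "a \<in> Ob B" "arr R" "src R = a" "tgt R = a" "cell \<theta>" "dm \<theta> = unit a" "cd \<theta> = R \<circ>\<circ> L"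
    "cell \<phi>" "dm \<phi> = L" "cd \<phi> = unit a"
  shows "mat (unit a) (unit a) (lu (unit a)) R \<theta> \<phi> = ru R \<bullet> (idc R \<diamondop> \<phi>) \<bullet> \<theta>"
proof -
  define U where "U = unit a"
  have [simp]: "arr U" "src U = a" "tgt U = a" "unit a = U"
    by (simp_all add: U_def)
  have lr [simp]: "lu U = ru U"
    using lu_unit[of a] by simp
  have [simp]: "arr L" "src L = a" "tgt L = a"
    using \<open>cell \<phi>\<close> cellD[of \<phi>] by auto
  have "mat U U (lu U) R \<theta> \<phi>
      = ru R \<bullet> (ru R \<diamondop> idc U) \<bullet> ((idc R \<diamondop> \<phi>) \<diamondop> idc U) \<bullet> (\<theta> \<diamondop> idc U) \<bullet> inv (ru U)"
    using vc_reduce[OF triangle_cells[of U R], of "((idc R \<diamondop> \<phi>) \<diamondop> idc U) \<bullet> (\<theta> \<diamondop> idc U) \<bullet> inv (ru U)"]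
    by (simp add: mat_def)
  also have "\<dots> = ru R \<bullet> ((ru R \<bullet> (idc R \<diamondop> \<phi>) \<bullet> \<theta>) \<diamondop> idc U) \<bullet> inv (ru U)"
    by (simp add: whisker_right)
  also have "\<dots> = ru R \<bullet> (idc R \<diamondop> \<phi>) \<bullet> \<theta>"
    using inv_ru_natural[of "ru R \<bullet> (idc R \<diamondop> \<phi>) \<bullet> \<theta>"] by simp
  finally show ?thesis by simp
qed

text \<open>The shape \<open>inv (lu L) \<bullet> \<kappa>\<close> of the adjunction unit covers
  both mates with target \<open>unit a\<close> that occur: \<open>\<kappa>\<close> is an identity
  for the self-adjoint unit 1-morphism, and the inverse of the counit of a right adjoint of
  \<open>unit a\<close> can be written in this form too.\<close>

lemma mat_to_unit:
  assumes [simp]: "a \<in> Ob B" "arr L" "arr R" "src L = a" "tgt L = a" "src R = a" "tgt R = a"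
    "cell \<zeta>" "dm \<zeta> = L \<circ>\<circ> R" "cd \<zeta> = unit a" "cell \<kappa>" "dm \<kappa> = unit a" "cd \<kappa> = L"
  shows "mat L R \<zeta> (unit a) (inv (lu L) \<bullet> \<kappa>) (idc L) = \<zeta> \<bullet> (\<kappa> \<diamondop> idc R) \<bullet> inv (lu R)"
proof -
  define U where "U = unit a"
  have [simp]: "arr U" "src U = a" "tgt U = a" "unit a = U" "dm \<kappa> = U" "cd \<zeta> = U"
    by (simp_all add: U_def)
  have lr [simp]: "lu U = ru U"
    using lu_unit[of a] by simp
  have "mat L R \<zeta> U (inv (lu L) \<bullet> \<kappa>) (idc L)
      = ru U \<bullet> (idc U \<diamondop> \<zeta>) \<bullet> asc U L R \<bullet> (inv (lu L) \<diamondop> idc R) \<bullet> (\<kappa> \<diamondop> idc R) \<bullet> inv (lu R)"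
    by (simp add: mat_def whisker_right)
  also have "\<dots> = lu U \<bullet> (idc U \<diamondop> \<zeta>) \<bullet> inv (lu (L \<circ>\<circ> R)) \<bullet> (\<kappa> \<diamondop> idc R) \<bullet> inv (lu R)"
    using vc_reduce[OF inv_lu_cmp[of R L], of "(\<kappa> \<diamondop> idc R) \<bullet> inv (lu R)"] by simp
  also have "\<dots> = \<zeta> \<bullet> (\<kappa> \<diamondop> idc R) \<bullet> inv (lu R)"
    using vc_reduce[OF inv_lu_natural[of \<zeta>], of "(\<kappa> \<diamondop> idc R) \<bullet> inv (lu R)"] by simp
  finally show ?thesis by simp
qed

text \<open>For \<open>L = (\<one> a)\<^sup>\<or>\<close> and \<open>P = (\<one> a)\<^sup>\<or>\<^sup>\<or>\<close> the second factor is the unit comparison of the double dual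
  and the first one the canonical isomorphism \<open>(\<one> a)\<^sup>\<or>\<^sup>\<or> \<Rightarrow> \<one> a\<close>.\<close>

lemma double_dual_unit:
  assumes adj1: "adj (unit a) L \<theta> \<zeta>" and adj2: "adj L P \<theta>' \<zeta>'" and [simp]: "a \<in> Ob B"
  shows "iso \<zeta>"
    and "mat L P \<zeta>' (unit a) (inv \<zeta>) (idc L) \<bullet> mat (unit a) (unit a) (lu (unit a)) P \<theta>'
      (mat (unit a) L \<zeta> (unit a) (inv (lu (unit a))) (idc (unit a))) = idc (unit a)"
proof -
  define U where "U = unit a"
  have [simp]: "arr U" "src U = a" "tgt U = a" "unit a = U"
    by (simp_all add: U_def)
  have [simp]: "arr L" "src L = a" "tgt L = a"
    "cell \<theta>" "dm \<theta> = U" "cd \<theta> = L \<circ>\<circ> U" "cell \<zeta>" "dm \<zeta> = U \<circ>\<circ> L" "cd \<zeta> = U"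
    using adj1 by (simp_all add: adj_def)
  have [simp]: "arr P" "src P = a" "tgt P = a"
    "cell \<theta>'" "dm \<theta>' = U" "cd \<theta>' = P \<circ>\<circ> L" "cell \<zeta>'" "dm \<zeta>' = L \<circ>\<circ> P" "cd \<zeta>' = U"
    and tri: "lu L \<bullet> (\<zeta>' \<diamondop> idc L) \<bullet> inv (asc L P L) \<bullet> (idc L \<diamondop> \<theta>') = ru L"
    using adj2 by (simp_all add: adj_def)
  have lr [simp]: "lu U = ru U"
    using lu_unit[of a] by simp
  define d j where "d = \<zeta> \<bullet> inv (lu L)" and "j = ru L \<bullet> \<theta>"
  have [simp]: "cell d" "dm d = L" "cd d = U" "cell j" "dm j = U" "cd j = L"
    by (simp_all add: d_def j_def)
  have dj: "d \<bullet> j = idc U" "j \<bullet> d = idc L"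
    using adj_unit_inverse[OF adj1] by (simp_all add: d_def j_def)
  have iso_d [simp]: "iso d" and inv_d: "inv d = j"
    using isoI[of d j] dj by simp_all
  have \<zeta>: "\<zeta> = d \<bullet> lu L"
    by (simp add: d_def)
  show "iso \<zeta>"
    by (simp add: \<zeta>)
  \<comment> \<open>The form expected by \<open>mat_to_unit\<close>, with \<open>j\<close> as
    \<open>\<kappa>\<close>.\<close>
  have inv_counit: "inv \<zeta> = inv (lu L) \<bullet> j"
    by (simp add: \<zeta> inv_vc inv_d)
  define e where "e = \<zeta>' \<bullet> (j \<diamondop> idc P) \<bullet> inv (lu P)"
  have [simp]: "cell e" "dm e = P" "cd e = U"
    by (simp_all add: e_def)
  have "mat U L \<zeta> U (inv (lu U)) (idc U) = d"
    using mat_to_unit[of a U L \<zeta> "idc U"] by (simp add: d_def)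
  moreover have "mat L P \<zeta>' U (inv \<zeta>) (idc L) = e"
    using mat_to_unit[of a L P \<zeta>' j] by (simp add: e_def inv_counit)
  moreover have "mat U U (lu U) P \<theta>' d = ru P \<bullet> (idc P \<diamondop> d) \<bullet> \<theta>'"
    using mat_unit_unit[of a P \<theta>' L d] by simp
  \<comment> \<open>\<open>e\<close> is moved past \<open>ru P\<close> and exchanged with
    \<open>d\<close>, using that both unitors of \<open>U\<close> agree. This brings
    \<open>d\<close> to the front and \<open>j\<close> to the end and leaves between them the first
    triangle identity of \<open>L\<close> and \<open>P\<close>.\<close>
  moreover have "e \<bullet> ru P \<bullet> (idc P \<diamondop> d) \<bullet> \<theta>' = idc U"
  proof -
    have "e \<bullet> ru P \<bullet> (idc P \<diamondop> d) \<bullet> \<theta>' = ru U \<bullet> (e \<diamondop> idc U) \<bullet> (idc P \<diamondop> d) \<bullet> \<theta>'"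
      using vc_reduce[OF ru_natural[of e], of "(idc P \<diamondop> d) \<bullet> \<theta>'"] by simp
    also have "\<dots> = lu U \<bullet> (idc U \<diamondop> d) \<bullet> (e \<diamondop> idc L) \<bullet> \<theta>'"
      using vc_reduce[OF interchange_cells[of d "idc U" "idc P" e], of \<theta>']
        vc_reduce[OF interchange_cells[of "idc L" d e "idc U"], of \<theta>'] by simp
    also have "\<dots> = d \<bullet> lu L \<bullet> (e \<diamondop> idc L) \<bullet> \<theta>'"
      using vc_reduce[OF lu_natural[of d], of "(e \<diamondop> idc L) \<bullet> \<theta>'"] by simp
    also have "(e \<diamondop> idc L) \<bullet> \<theta>'
        = (\<zeta>' \<diamondop> idc L) \<bullet> ((j \<diamondop> idc P) \<diamondop> idc L) \<bullet> (inv (lu P) \<diamondop> idc L) \<bullet> \<theta>'"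
      by (simp add: e_def whisker_right)
    also have "inv (lu P) \<diamondop> idc L = inv (asc U P L) \<bullet> inv (lu (P \<circ>\<circ> L))"
      using inv_lu_cmp[of L P, symmetric] by simp
    also have "((j \<diamondop> idc P) \<diamondop> idc L) \<bullet> (inv (asc U P L) \<bullet> inv (lu (P \<circ>\<circ> L))) \<bullet> \<theta>'
        = inv (asc L P L) \<bullet> (j \<diamondop> idc (P \<circ>\<circ> L)) \<bullet> inv (lu (P \<circ>\<circ> L)) \<bullet> \<theta>'"
      using vc_reduce[OF inv_asc_natural[of "idc L" "idc P" j, symmetric], of "inv (lu (P \<circ>\<circ> L)) \<bullet> \<theta>'"]
      by simp
    also have "inv (lu (P \<circ>\<circ> L)) \<bullet> \<theta>' = (idc U \<diamondop> \<theta>') \<bullet> inv (lu U)"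
      using inv_lu_natural[of \<theta>'] by simp
    also have "(j \<diamondop> idc (P \<circ>\<circ> L)) \<bullet> (idc U \<diamondop> \<theta>') \<bullet> inv (lu U)
        = (idc L \<diamondop> \<theta>') \<bullet> (j \<diamondop> idc U) \<bullet> inv (ru U)"
      using vc_reduce[OF interchange_cells[of \<theta>' "idc (P \<circ>\<circ> L)" "idc U" j], of "inv (lu U)"]
        vc_reduce[OF interchange_cells[of "idc U" \<theta>' j "idc L"], of "inv (lu U)"] by simp
    also have "(j \<diamondop> idc U) \<bullet> inv (ru U) = inv (ru L) \<bullet> j"
      using inv_ru_natural[of j] by simp
    also have "d \<bullet> lu L \<bullet> (\<zeta>' \<diamondop> idc L) \<bullet> inv (asc L P L) \<bullet> (idc L \<diamondop> \<theta>') \<bullet> inv (ru L) \<bullet> j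
        = d \<bullet> (lu L \<bullet> (\<zeta>' \<diamondop> idc L) \<bullet> inv (asc L P L) \<bullet> (idc L \<diamondop> \<theta>')) \<bullet> inv (ru L) \<bullet> j"
      by simp
    also have "\<dots> = idc U"
      unfolding tri using dj by simp
    finally show ?thesis .
  qed
  ultimately show "mat L P \<zeta>' (unit a) (inv \<zeta>) (idc L) \<bullet> mat (unit a) (unit a) (lu (unit a)) P \<theta>'
      (mat (unit a) L \<zeta> (unit a) (inv (lu (unit a))) (idc (unit a))) = idc (unit a)"
    by simp
qed

subsection \<open>Transport of transformations\<close>

text \<open>Here \<open>\<sigma>\<close>, \<open>\<tau>\<close>, \<open>\<rho>\<close> are the components of a transformation \<open>F \<Rightarrow> G\<close> at two 1-morphisms and at their
  composite, \<open>\<phi>\<close> and \<open>\<gamma>\<close> the comparison 2-morphisms of \<open>F\<close> and \<open>G\<close>, and \<open>\<alpha>\<close>, \<open>\<beta>\<close>, \<open>\<delta>\<close> replace the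
  components at the three objects.\<close>

lemma transport_cmp:
  assumes [simp]: "cell \<sigma>" "dm \<sigma> = G\<^sub>1 \<circ>\<circ> T\<^sub>a" "cd \<sigma> = T\<^sub>b \<circ>\<circ> F\<^sub>1"
    "cell \<tau>" "dm \<tau> = G\<^sub>2 \<circ>\<circ> T\<^sub>b" "cd \<tau> = T\<^sub>c \<circ>\<circ> F\<^sub>2"
    "cell \<rho>" "dm \<rho> = G\<^sub>3 \<circ>\<circ> T\<^sub>a" "cd \<rho> = T\<^sub>c \<circ>\<circ> F\<^sub>3"
    "cell \<gamma>" "dm \<gamma> = G\<^sub>2 \<circ>\<circ> G\<^sub>1" "cd \<gamma> = G\<^sub>3" "cell \<phi>" "dm \<phi> = F\<^sub>2 \<circ>\<circ> F\<^sub>1" "cd \<phi> = F\<^sub>3"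
    "iso \<alpha>" "dm \<alpha> = T\<^sub>a" "cd \<alpha> = T\<^sub>a'" "iso \<beta>" "dm \<beta> = T\<^sub>b" "cd \<beta> = T\<^sub>b'"
    "iso \<delta>" "dm \<delta> = T\<^sub>c" "cd \<delta> = T\<^sub>c'"
    "arr F\<^sub>1" "arr F\<^sub>2" "arr G\<^sub>1" "arr G\<^sub>2" "arr T\<^sub>a" "arr T\<^sub>b" "arr T\<^sub>c" "arr T\<^sub>a'" "arr T\<^sub>b'" "arr T\<^sub>c'"
    "src G\<^sub>1 = tgt T\<^sub>a" "src T\<^sub>b = tgt F\<^sub>1" "src G\<^sub>2 = tgt T\<^sub>b" "src T\<^sub>c = tgt F\<^sub>2"
    "src F\<^sub>2 = tgt F\<^sub>1" "tgt G\<^sub>1 = tgt T\<^sub>b" "src T\<^sub>a = src F\<^sub>1" "tgt G\<^sub>2 = tgt T\<^sub>c"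
    and eq: "\<rho> \<bullet> (\<gamma> \<diamondop> idc T\<^sub>a) = (idc T\<^sub>c \<diamondop> \<phi>) \<bullet> asc T\<^sub>c F\<^sub>2 F\<^sub>1 \<bullet> (\<tau> \<diamondop> idc F\<^sub>1) \<bullet> inv (asc G\<^sub>2 T\<^sub>b F\<^sub>1)
      \<bullet> (idc G\<^sub>2 \<diamondop> \<sigma>) \<bullet> asc G\<^sub>2 G\<^sub>1 T\<^sub>a"
  shows "((\<delta> \<diamondop> idc F\<^sub>3) \<bullet> \<rho> \<bullet> (idc G\<^sub>3 \<diamondop> inv \<alpha>)) \<bullet> (\<gamma> \<diamondop> idc T\<^sub>a') =
    (idc T\<^sub>c' \<diamondop> \<phi>) \<bullet> asc T\<^sub>c' F\<^sub>2 F\<^sub>1 \<bullet> (((\<delta> \<diamondop> idc F\<^sub>2) \<bullet> \<tau> \<bullet> (idc G\<^sub>2 \<diamondop> inv \<beta>)) \<diamondop> idc F\<^sub>1)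
      \<bullet> inv (asc G\<^sub>2 T\<^sub>b' F\<^sub>1) \<bullet> (idc G\<^sub>2 \<diamondop> ((\<beta> \<diamondop> idc F\<^sub>1) \<bullet> \<sigma> \<bullet> (idc G\<^sub>1 \<diamondop> inv \<alpha>))) \<bullet> asc G\<^sub>2 G\<^sub>1 T\<^sub>a'"
proof -
  have [simp]: "src T\<^sub>a' = src F\<^sub>1" "tgt T\<^sub>a' = tgt T\<^sub>a" "src T\<^sub>b' = tgt F\<^sub>1" "tgt T\<^sub>b' = tgt T\<^sub>b"
    "src T\<^sub>c' = tgt F\<^sub>2" "tgt T\<^sub>c' = tgt T\<^sub>c"
    using cellD[of \<alpha>] cellD[of \<beta>] cellD[of \<delta>] by simp_all
  have [simp]: "arr F\<^sub>3" "arr G\<^sub>3" "src F\<^sub>3 = src F\<^sub>1" "tgt F\<^sub>3 = tgt F\<^sub>2" "src G\<^sub>3 = tgt T\<^sub>a" "tgt G\<^sub>3 = tgt T\<^sub>c"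
    using cellD[of \<phi>] cellD[of \<gamma>] by simp_all
  have "(idc T\<^sub>c' \<diamondop> \<phi>) \<bullet> asc T\<^sub>c' F\<^sub>2 F\<^sub>1 \<bullet> (((\<delta> \<diamondop> idc F\<^sub>2) \<bullet> \<tau> \<bullet> (idc G\<^sub>2 \<diamondop> inv \<beta>)) \<diamondop> idc F\<^sub>1)
      \<bullet> inv (asc G\<^sub>2 T\<^sub>b' F\<^sub>1) \<bullet> (idc G\<^sub>2 \<diamondop> ((\<beta> \<diamondop> idc F\<^sub>1) \<bullet> \<sigma> \<bullet> (idc G\<^sub>1 \<diamondop> inv \<alpha>))) \<bullet> asc G\<^sub>2 G\<^sub>1 T\<^sub>a'
    = (idc T\<^sub>c' \<diamondop> \<phi>) \<bullet> asc T\<^sub>c' F\<^sub>2 F\<^sub>1 \<bullet> ((\<delta> \<diamondop> idc F\<^sub>2) \<diamondop> idc F\<^sub>1) \<bullet> (\<tau> \<diamondop> idc F\<^sub>1) \<bullet> ((idc G\<^sub>2 \<diamondop> inv \<beta>) \<diamondop> idc F\<^sub>1)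
      \<bullet> inv (asc G\<^sub>2 T\<^sub>b' F\<^sub>1) \<bullet> (idc G\<^sub>2 \<diamondop> \<beta> \<diamondop> idc F\<^sub>1) \<bullet> (idc G\<^sub>2 \<diamondop> \<sigma>) \<bullet> (idc G\<^sub>2 \<diamondop> idc G\<^sub>1 \<diamondop> inv \<alpha>) \<bullet> asc G\<^sub>2 G\<^sub>1 T\<^sub>a'"
    by (simp add: whisker_left whisker_right)
  also have "(idc G\<^sub>2 \<diamondop> idc G\<^sub>1 \<diamondop> inv \<alpha>) \<bullet> asc G\<^sub>2 G\<^sub>1 T\<^sub>a' = asc G\<^sub>2 G\<^sub>1 T\<^sub>a \<bullet> (idc (G\<^sub>2 \<circ>\<circ> G\<^sub>1) \<diamondop> inv \<alpha>)"
    using asc_natural[of "inv \<alpha>" "idc G\<^sub>1" "idc G\<^sub>2"] by simp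
  \<comment> \<open>At the middle object \<open>inv \<beta>\<close> and \<open>\<beta>\<close> are
    separated by an associator; naturality brings them together, and they cancel in the next step.
    \<open>\<alpha>\<close> and \<open>\<delta>\<close> only move to the two ends.\<close>
  also have "((idc G\<^sub>2 \<diamondop> inv \<beta>) \<diamondop> idc F\<^sub>1) \<bullet> inv (asc G\<^sub>2 T\<^sub>b' F\<^sub>1) \<bullet> (idc G\<^sub>2 \<diamondop> \<beta> \<diamondop> idc F\<^sub>1) \<bullet> (idc G\<^sub>2 \<diamondop> \<sigma>)
      \<bullet> asc G\<^sub>2 G\<^sub>1 T\<^sub>a \<bullet> (idc (G\<^sub>2 \<circ>\<circ> G\<^sub>1) \<diamondop> inv \<alpha>)
    = inv (asc G\<^sub>2 T\<^sub>b F\<^sub>1) \<bullet> (idc G\<^sub>2 \<diamondop> inv \<beta> \<diamondop> idc F\<^sub>1) \<bullet> (idc G\<^sub>2 \<diamondop> \<beta> \<diamondop> idc F\<^sub>1) \<bullet> (idc G\<^sub>2 \<diamondop> \<sigma>)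
      \<bullet> asc G\<^sub>2 G\<^sub>1 T\<^sub>a \<bullet> (idc (G\<^sub>2 \<circ>\<circ> G\<^sub>1) \<diamondop> inv \<alpha>)"
    using vc_reduce[OF inv_asc_natural[of "idc F\<^sub>1" "inv \<beta>" "idc G\<^sub>2", symmetric],
        of "(idc G\<^sub>2 \<diamondop> \<beta> \<diamondop> idc F\<^sub>1) \<bullet> (idc G\<^sub>2 \<diamondop> \<sigma>) \<bullet> asc G\<^sub>2 G\<^sub>1 T\<^sub>a \<bullet> (idc (G\<^sub>2 \<circ>\<circ> G\<^sub>1) \<diamondop> inv \<alpha>)"] by simp
  also have "(idc G\<^sub>2 \<diamondop> inv \<beta> \<diamondop> idc F\<^sub>1) \<bullet> (idc G\<^sub>2 \<diamondop> \<beta> \<diamondop> idc F\<^sub>1) \<bullet> (idc G\<^sub>2 \<diamondop> \<sigma>)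
      \<bullet> asc G\<^sub>2 G\<^sub>1 T\<^sub>a \<bullet> (idc (G\<^sub>2 \<circ>\<circ> G\<^sub>1) \<diamondop> inv \<alpha>)
    = (idc G\<^sub>2 \<diamondop> \<sigma>) \<bullet> asc G\<^sub>2 G\<^sub>1 T\<^sub>a \<bullet> (idc (G\<^sub>2 \<circ>\<circ> G\<^sub>1) \<diamondop> inv \<alpha>)"
    using vc_inv_cancel(1)[of "idc G\<^sub>2 \<diamondop> \<beta> \<diamondop> idc F\<^sub>1"
        "(idc G\<^sub>2 \<diamondop> \<sigma>) \<bullet> asc G\<^sub>2 G\<^sub>1 T\<^sub>a \<bullet> (idc (G\<^sub>2 \<circ>\<circ> G\<^sub>1) \<diamondop> inv \<alpha>)"]
    by (simp add: inv_hc)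
  also have "asc T\<^sub>c' F\<^sub>2 F\<^sub>1 \<bullet> ((\<delta> \<diamondop> idc F\<^sub>2) \<diamondop> idc F\<^sub>1) \<bullet> (\<tau> \<diamondop> idc F\<^sub>1) \<bullet> inv (asc G\<^sub>2 T\<^sub>b F\<^sub>1) \<bullet> (idc G\<^sub>2 \<diamondop> \<sigma>)
      \<bullet> asc G\<^sub>2 G\<^sub>1 T\<^sub>a \<bullet> (idc (G\<^sub>2 \<circ>\<circ> G\<^sub>1) \<diamondop> inv \<alpha>)
    = (\<delta> \<diamondop> idc (F\<^sub>2 \<circ>\<circ> F\<^sub>1)) \<bullet> asc T\<^sub>c F\<^sub>2 F\<^sub>1 \<bullet> (\<tau> \<diamondop> idc F\<^sub>1) \<bullet> inv (asc G\<^sub>2 T\<^sub>b F\<^sub>1) \<bullet> (idc G\<^sub>2 \<diamondop> \<sigma>)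
      \<bullet> asc G\<^sub>2 G\<^sub>1 T\<^sub>a \<bullet> (idc (G\<^sub>2 \<circ>\<circ> G\<^sub>1) \<diamondop> inv \<alpha>)"
    using vc_reduce[OF asc_natural[of "idc F\<^sub>1" "idc F\<^sub>2" \<delta>],
        of "(\<tau> \<diamondop> idc F\<^sub>1) \<bullet> inv (asc G\<^sub>2 T\<^sub>b F\<^sub>1) \<bullet> (idc G\<^sub>2 \<diamondop> \<sigma>) \<bullet> asc G\<^sub>2 G\<^sub>1 T\<^sub>a \<bullet> (idc (G\<^sub>2 \<circ>\<circ> G\<^sub>1) \<diamondop> inv \<alpha>)"]
    by simp
  also have "(idc T\<^sub>c' \<diamondop> \<phi>) \<bullet> (\<delta> \<diamondop> idc (F\<^sub>2 \<circ>\<circ> F\<^sub>1)) \<bullet> asc T\<^sub>c F\<^sub>2 F\<^sub>1 \<bullet> (\<tau> \<diamondop> idc F\<^sub>1)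
      \<bullet> inv (asc G\<^sub>2 T\<^sub>b F\<^sub>1) \<bullet> (idc G\<^sub>2 \<diamondop> \<sigma>) \<bullet> asc G\<^sub>2 G\<^sub>1 T\<^sub>a \<bullet> (idc (G\<^sub>2 \<circ>\<circ> G\<^sub>1) \<diamondop> inv \<alpha>)
    = (\<delta> \<diamondop> idc F\<^sub>3) \<bullet> (idc T\<^sub>c \<diamondop> \<phi>) \<bullet> asc T\<^sub>c F\<^sub>2 F\<^sub>1 \<bullet> (\<tau> \<diamondop> idc F\<^sub>1)
      \<bullet> inv (asc G\<^sub>2 T\<^sub>b F\<^sub>1) \<bullet> (idc G\<^sub>2 \<diamondop> \<sigma>) \<bullet> asc G\<^sub>2 G\<^sub>1 T\<^sub>a \<bullet> (idc (G\<^sub>2 \<circ>\<circ> G\<^sub>1) \<diamondop> inv \<alpha>)"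
  proof -
    have "(idc T\<^sub>c' \<diamondop> \<phi>) \<bullet> (\<delta> \<diamondop> idc (F\<^sub>2 \<circ>\<circ> F\<^sub>1)) = (\<delta> \<diamondop> idc F\<^sub>3) \<bullet> (idc T\<^sub>c \<diamondop> \<phi>)"
      by (simp add: interchange_cells)
    from vc_reduce[OF this, of "asc T\<^sub>c F\<^sub>2 F\<^sub>1 \<bullet> (\<tau> \<diamondop> idc F\<^sub>1)
      \<bullet> inv (asc G\<^sub>2 T\<^sub>b F\<^sub>1) \<bullet> (idc G\<^sub>2 \<diamondop> \<sigma>) \<bullet> asc G\<^sub>2 G\<^sub>1 T\<^sub>a \<bullet> (idc (G\<^sub>2 \<circ>\<circ> G\<^sub>1) \<diamondop> inv \<alpha>)"]
    show ?thesis by simp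
  qed
  also have "\<dots> = (\<delta> \<diamondop> idc F\<^sub>3) \<bullet> ((idc T\<^sub>c \<diamondop> \<phi>) \<bullet> asc T\<^sub>c F\<^sub>2 F\<^sub>1 \<bullet> (\<tau> \<diamondop> idc F\<^sub>1)
      \<bullet> inv (asc G\<^sub>2 T\<^sub>b F\<^sub>1) \<bullet> (idc G\<^sub>2 \<diamondop> \<sigma>) \<bullet> asc G\<^sub>2 G\<^sub>1 T\<^sub>a) \<bullet> (idc (G\<^sub>2 \<circ>\<circ> G\<^sub>1) \<diamondop> inv \<alpha>)"
    by simp
  also have "\<dots> = (\<delta> \<diamondop> idc F\<^sub>3) \<bullet> (\<rho> \<bullet> (\<gamma> \<diamondop> idc T\<^sub>a)) \<bullet> (idc (G\<^sub>2 \<circ>\<circ> G\<^sub>1) \<diamondop> inv \<alpha>)"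
    unfolding eq ..
  also have "\<dots> = ((\<delta> \<diamondop> idc F\<^sub>3) \<bullet> \<rho> \<bullet> (idc G\<^sub>3 \<diamondop> inv \<alpha>)) \<bullet> (\<gamma> \<diamondop> idc T\<^sub>a')"
    by (simp add: interchange_cells)
  finally show ?thesis ..
qed

text \<open>\<open>inv \<alpha>\<close> acts on another factor than \<open>\<gamma>\<close>, and
  \<open>\<beta>\<close> on another than \<open>\<phi>\<close>; interchange therefore pulls both out
  of the old naturality square \<open>eq\<close>.\<close>

lemma transport_natural:
  assumes [simp]: "cell \<sigma>" "dm \<sigma> = G\<^sub>1 \<circ>\<circ> T\<^sub>a" "cd \<sigma> = T\<^sub>b \<circ>\<circ> F\<^sub>1"
    "cell \<tau>" "dm \<tau> = G\<^sub>2 \<circ>\<circ> T\<^sub>a" "cd \<tau> = T\<^sub>b \<circ>\<circ> F\<^sub>2"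
    "cell \<gamma>" "dm \<gamma> = G\<^sub>1" "cd \<gamma> = G\<^sub>2" "cell \<phi>" "dm \<phi> = F\<^sub>1" "cd \<phi> = F\<^sub>2"
    "iso \<alpha>" "dm \<alpha> = T\<^sub>a" "cd \<alpha> = T\<^sub>a'" "iso \<beta>" "dm \<beta> = T\<^sub>b" "cd \<beta> = T\<^sub>b'"
    "arr T\<^sub>a" "arr T\<^sub>b" "arr T\<^sub>a'" "arr T\<^sub>b'" "src G\<^sub>1 = tgt T\<^sub>a" "src T\<^sub>b = tgt F\<^sub>1"
    and eq: "\<tau> \<bullet> (\<gamma> \<diamondop> idc T\<^sub>a) = (idc T\<^sub>b \<diamondop> \<phi>) \<bullet> \<sigma>"
  shows "((\<beta> \<diamondop> idc F\<^sub>2) \<bullet> \<tau> \<bullet> (idc G\<^sub>2 \<diamondop> inv \<alpha>)) \<bullet> (\<gamma> \<diamondop> idc T\<^sub>a') =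
    (idc T\<^sub>b' \<diamondop> \<phi>) \<bullet> ((\<beta> \<diamondop> idc F\<^sub>1) \<bullet> \<sigma> \<bullet> (idc G\<^sub>1 \<diamondop> inv \<alpha>))"
proof -
  have [simp]: "arr F\<^sub>1" "arr F\<^sub>2" "src F\<^sub>2 = src F\<^sub>1" "tgt F\<^sub>2 = tgt F\<^sub>1"
    "arr G\<^sub>1" "arr G\<^sub>2" "src G\<^sub>2 = tgt T\<^sub>a" "tgt G\<^sub>2 = tgt G\<^sub>1"
    "src T\<^sub>a' = src T\<^sub>a" "tgt T\<^sub>a' = tgt T\<^sub>a" "src T\<^sub>b' = tgt F\<^sub>1" "tgt T\<^sub>b' = tgt T\<^sub>b"
    using cellD[of \<phi>] cellD[of \<gamma>] cellD[of \<alpha>] cellD[of \<beta>] by simp_all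
  have "((\<beta> \<diamondop> idc F\<^sub>2) \<bullet> \<tau> \<bullet> (idc G\<^sub>2 \<diamondop> inv \<alpha>)) \<bullet> (\<gamma> \<diamondop> idc T\<^sub>a')
      = (\<beta> \<diamondop> idc F\<^sub>2) \<bullet> (\<tau> \<bullet> (\<gamma> \<diamondop> idc T\<^sub>a)) \<bullet> (idc G\<^sub>1 \<diamondop> inv \<alpha>)"
    by (simp add: interchange_cells)
  also have "\<dots> = ((\<beta> \<diamondop> idc F\<^sub>2) \<bullet> (idc T\<^sub>b \<diamondop> \<phi>)) \<bullet> \<sigma> \<bullet> (idc G\<^sub>1 \<diamondop> inv \<alpha>)"
    unfolding eq by simp
  also have "(\<beta> \<diamondop> idc F\<^sub>2) \<bullet> (idc T\<^sub>b \<diamondop> \<phi>) = (idc T\<^sub>b' \<diamondop> \<phi>) \<bullet> (\<beta> \<diamondop> idc F\<^sub>1)"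
    by (simp add: interchange_cells)
  finally show ?thesis by simp
qed

text \<open>A single \<open>\<alpha>\<close> occurs on both sides of \<open>\<sigma>\<close>, since
  a unit 1-morphism has equal source and target. Naturality of the two unitors brings
  \<open>\<alpha>\<close> and its inverse together.\<close>

lemma transport_unit:
  assumes [simp]: "a \<in> Ob B" "b \<in> Ob B" "cell \<sigma>" "dm \<sigma> = G \<circ>\<circ> T" "cd \<sigma> = T \<circ>\<circ> F"
    "cell \<gamma>" "dm \<gamma> = unit b" "cd \<gamma> = G" "cell \<phi>" "dm \<phi> = unit a" "cd \<phi> = F"
    "iso \<alpha>" "dm \<alpha> = T" "cd \<alpha> = T'" "arr T" "src T = a" "tgt T = b" "arr T'" "src T' = a" "tgt T' = b"
    and eq: "\<sigma> \<bullet> (\<gamma> \<diamondop> idc T) = (idc T \<diamondop> \<phi>) \<bullet> inv (ru T) \<bullet> lu T"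
  shows "((\<alpha> \<diamondop> idc F) \<bullet> \<sigma> \<bullet> (idc G \<diamondop> inv \<alpha>)) \<bullet> (\<gamma> \<diamondop> idc T') =
    (idc T' \<diamondop> \<phi>) \<bullet> inv (ru T') \<bullet> lu T'"
proof -
  have [simp]: "arr F" "src F = a" "tgt F = a" "arr G" "src G = b" "tgt G = b"
    using cellD[of \<phi>] cellD[of \<gamma>] by simp_all
  have "((\<alpha> \<diamondop> idc F) \<bullet> \<sigma> \<bullet> (idc G \<diamondop> inv \<alpha>)) \<bullet> (\<gamma> \<diamondop> idc T')
      = (\<alpha> \<diamondop> idc F) \<bullet> (\<sigma> \<bullet> (\<gamma> \<diamondop> idc T)) \<bullet> (idc (unit b) \<diamondop> inv \<alpha>)"
    by (simp add: interchange_cells)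
  also have "\<dots> = ((\<alpha> \<diamondop> idc F) \<bullet> (idc T \<diamondop> \<phi>)) \<bullet> inv (ru T) \<bullet> lu T \<bullet> (idc (unit b) \<diamondop> inv \<alpha>)"
    unfolding eq by simp
  also have "lu T \<bullet> (idc (unit b) \<diamondop> inv \<alpha>) = inv \<alpha> \<bullet> lu T'"
    using lu_natural[of "inv \<alpha>"] by simp
  also have "(\<alpha> \<diamondop> idc F) \<bullet> (idc T \<diamondop> \<phi>) = (idc T' \<diamondop> \<phi>) \<bullet> (\<alpha> \<diamondop> idc (unit a))"
    by (simp add: interchange_cells)
  also have "\<dots> \<bullet> inv (ru T) \<bullet> inv \<alpha> \<bullet> lu T' = (idc T' \<diamondop> \<phi>) \<bullet> (\<alpha> \<diamondop> idc (unit a)) \<bullet> inv (ru T) \<bullet> inv \<alpha> \<bullet> lu T'"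
    by simp
  also have "(\<alpha> \<diamondop> idc (unit a)) \<bullet> inv (ru T) \<bullet> inv \<alpha> \<bullet> lu T' = inv (ru T') \<bullet> lu T'"
    using vc_reduce[OF inv_ru_natural[of \<alpha>], of "inv \<alpha> \<bullet> lu T'"] by simp
  finally show ?thesis .
qed

text \<open>The composition axiom for the transformation \<open>id_trans\<close> below. The triangle
  at the middle object cancels \<open>ru G\<close> against \<open>inv (lu F)\<close>;
  \<open>lu_cmp\<close> and \<open>ru_cmp\<close> absorb the outer associators.\<close>

lemma unit_commute_cmp:
  assumes [simp]: "arr F" "arr G" "src G = tgt F"
  shows "inv (lu (G \<circ>\<circ> F)) \<bullet> ru (G \<circ>\<circ> F) = asc (unit (tgt G)) G F
    \<bullet> ((inv (lu G) \<bullet> ru G) \<diamondop> idc F) \<bullet> inv (asc G (unit (tgt F)) F)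
    \<bullet> (idc G \<diamondop> (inv (lu F) \<bullet> ru F)) \<bullet> asc G F (unit (src F))"
proof -
  define U where "U = unit (tgt F)"
  have [simp]: "arr U" "src U = tgt F" "tgt U = tgt F" "unit (tgt F) = U"
    by (simp_all add: U_def)
  have tri: "inv (asc G U F) \<bullet> (idc G \<diamondop> inv (lu F)) = inv (ru G \<diamondop> idc F)"
    using triangle_cells[of F G, symmetric] by (simp add: inv_vc inv_hc)
  have "asc (unit (tgt G)) G F \<bullet> ((inv (lu G) \<bullet> ru G) \<diamondop> idc F) \<bullet> inv (asc G U F)
      \<bullet> (idc G \<diamondop> (inv (lu F) \<bullet> ru F)) \<bullet> asc G F (unit (src F))
    = asc (unit (tgt G)) G F \<bullet> (inv (lu G) \<diamondop> idc F) \<bullet> (ru G \<diamondop> idc F) \<bullet> inv (asc G U F)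
      \<bullet> (idc G \<diamondop> inv (lu F)) \<bullet> (idc G \<diamondop> ru F) \<bullet> asc G F (unit (src F))"
    by (simp add: whisker_left whisker_right)
  also have "\<dots> = asc (unit (tgt G)) G F \<bullet> (inv (lu G) \<diamondop> idc F) \<bullet> (ru G \<diamondop> idc F) \<bullet> inv (asc G U F)
      \<bullet> (idc G \<diamondop> inv (lu F)) \<bullet> ru (G \<circ>\<circ> F)"
    by (simp add: ru_cmp)
  also have "\<dots> = asc (unit (tgt G)) G F \<bullet> (inv (lu G) \<diamondop> idc F) \<bullet> ru (G \<circ>\<circ> F)"
    using vc_reduce[OF tri, of "ru (G \<circ>\<circ> F)"] by simp
  also have "\<dots> = inv (lu (G \<circ>\<circ> F)) \<bullet> ru (G \<circ>\<circ> F)"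
    using vc_reduce[OF inv_lu_cmp[of F G], of "ru (G \<circ>\<circ> F)"] by simp
  finally show ?thesis by simp
qed

subsection \<open>Underlying 2-morphisms of mates\<close>

lemma und_mat:
  "tgt R = a \<Longrightarrow> und (mat L R \<zeta> R' \<theta> \<phi>) = mate B a (mor L) (mor R) (und \<zeta>) (mor R') (und \<theta>) (und \<phi>)"
  by (simp add: mat_def mate_def LUnitI_def)

lemma mat_simps [simp]: "dm (mat L R \<zeta> R' \<theta> \<phi>) = R" "cd (mat L R \<zeta> R' \<theta> \<phi>) = R'"
  by (simp_all add: mat_def)

lemma cell_mat:
  assumes [simp]: "arr L" "arr L'" "src L' = src L" "tgt L' = tgt L" "arr R" "src R = tgt L" "tgt R = src L"
    "arr R'" "src R' = tgt L" "tgt R' = src L"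
    "cell \<zeta>" "dm \<zeta> = L \<circ>\<circ> R" "cd \<zeta> = unit (tgt L)"
    "cell \<theta>" "dm \<theta> = unit (src L)" "cd \<theta> = R' \<circ>\<circ> L'" "cell \<phi>" "dm \<phi> = L'" "cd \<phi> = L"
  shows "cell (mat L R \<zeta> R' \<theta> \<phi>)"
  by (simp add: mat_def)

lemma und_isoI: "iso \<phi> \<Longrightarrow> und \<phi> \<in> Iso2 B (mor (dm \<phi>)) (mor (cd \<phi>))"
  by (simp only: iso_def)

lemma adjunction_adj:
  assumes "adjunction B a b l r u v" "a \<in> Ob B" "b \<in> Ob B"
  shows "adj (Arrow a b l) (Arrow b a r)
    (TwoCell (unit a) (Arrow b a r \<circ>\<circ> Arrow a b l) u) (TwoCell (Arrow a b l \<circ>\<circ> Arrow b a r) (unit b) v)"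
proof -
  have "arr (Arrow a b l)" "arr (Arrow b a r)"
    using assms by (simp_all add: adjunction_def arr_def del: arr_Ob)
  moreover from this have "cell (TwoCell (unit a) (Arrow b a r \<circ>\<circ> Arrow a b l) u)"
      "cell (TwoCell (Arrow a b l \<circ>\<circ> Arrow b a r) (unit b) v)"
    using assms unfolding cell_def by (simp_all add: adjunction_def)
  ultimately show ?thesis
    using assms by (auto simp: adj_def adjunction_def AssocI_def intro!: twocell.expand)
qed

definition comp_unit2 where
  "comp_unit2 F F' \<theta> G G' \<kappa> = inv (asc F' G' (G \<circ>\<circ> F)) \<bullet> (idc F' \<diamondop> asc G' G F)
    \<bullet> (idc F' \<diamondop> \<kappa> \<diamondop> idc F) \<bullet> (idc F' \<diamondop> inv (lu F)) \<bullet> \<theta>"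

definition comp_counit2 where
  "comp_counit2 F F' \<zeta> G G' \<xi> = \<xi> \<bullet> (idc G \<diamondop> lu G') \<bullet> (idc G \<diamondop> \<zeta> \<diamondop> idc G')
    \<bullet> (idc G \<diamondop> inv (asc F F' G')) \<bullet> asc G F (F' \<circ>\<circ> G')"

lemma und_comp_unit2:
  "tgt F = b \<Longrightarrow> und (comp_unit2 F F' \<theta> G G' \<kappa>)
    = comp_unit B b (mor F) (mor F') (und \<theta>) (mor G) (mor G') (und \<kappa>)"
  by (simp add: comp_unit2_def comp_unit_def AssocI_def LUnitI_def)

lemma und_comp_counit2:
  "und (comp_counit2 F F' \<zeta> G G' \<xi>) = comp_counit B (mor F) (mor F') (und \<zeta>) (mor G) (mor G') (und \<xi>)"
  by (simp add: comp_counit2_def comp_counit_def AssocI_def)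

text \<open>Part of the typing of the comparison cell \<open>dd_comp\<close>, which is what
  \<open>transport_cmp\<close> asks of it.\<close>

lemma comp_unit2_cell:
  assumes "adj F F' \<theta> \<zeta>" "adj G G' \<kappa> \<xi>" "src G = tgt F"
  shows "cell (comp_unit2 F F' \<theta> G G' \<kappa>)" "dm (comp_unit2 F F' \<theta> G G' \<kappa>) = unit (src F)"
    "cd (comp_unit2 F F' \<theta> G G' \<kappa>) = (F' \<circ>\<circ> G') \<circ>\<circ> (G \<circ>\<circ> F)"
  using assms by (simp_all add: comp_unit2_def adj_def)

lemma comp_counit2_cell:
  assumes "adj F F' \<theta> \<zeta>" "adj G G' \<kappa> \<xi>" "src G = tgt F"
  shows "cell (comp_counit2 F F' \<zeta> G G' \<xi>)" "cd (comp_counit2 F F' \<zeta> G G' \<xi>) = unit (tgt G)"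
    "dm (comp_counit2 F F' \<zeta> G G' \<xi>) = (G \<circ>\<circ> F) \<circ>\<circ> (F' \<circ>\<circ> G')"
  using assms by (simp_all add: comp_counit2_def adj_def)

end

section \<open>The double dual on typed 2-morphisms\<close>

context adj_bicategory
begin

definition dual where "dual F = Arrow (tgt F) (src F) ((mor F)\<^sup>\<or>)"

definition coev where "coev F = TwoCell (unit (src F)) (dual F \<circ>\<circ> F) (\<eta> (mor F))"

definition ev where "ev F = TwoCell (F \<circ>\<circ> dual F) (unit (tgt F)) (\<epsilon> (mor F))"

lemma dual_simps [simp]:
  "src (dual F) = tgt F" "tgt (dual F) = src F" "mor (dual F) = (mor F)\<^sup>\<or>"
  "dm (coev F) = unit (src F)" "cd (coev F) = dual F \<circ>\<circ> F" "und (coev F) = \<eta> (mor F)"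
  "dm (ev F) = F \<circ>\<circ> dual F" "cd (ev F) = unit (tgt F)" "und (ev F) = \<epsilon> (mor F)"
  by (simp_all add: dual_def coev_def ev_def)

lemma adj_dual: "arr F \<Longrightarrow> adj F (dual F) (coev F) (ev F)"
  using adjunction_adj[OF Dual_adjunction[of "src F" "tgt F" "mor F"]]
  by (simp add: arr_def dual_def coev_def ev_def del: arr_Ob)

lemma arr_dual [simp]: "arr F \<Longrightarrow> arr (dual F)"
  and cell_coev [simp]: "arr F \<Longrightarrow> cell (coev F)" and cell_ev [simp]: "arr F \<Longrightarrow> cell (ev F)"
  using adj_dual by (simp_all add: adj_def)

text \<open>Typed form of \<open>FCell\<close> of \<open>double_dual\<close>. The inner mate runs
  from the dual of the codomain to the dual of the domain; the outer one reverses the direction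
  again.\<close>

definition dd_cell where
  "dd_cell \<phi> = mat (dual (dm \<phi>)) (dual (dual (dm \<phi>))) (ev (dual (dm \<phi>))) (dual (dual (cd \<phi>))) (coev (dual (cd \<phi>)))
     (mat (cd \<phi>) (dual (cd \<phi>)) (ev (cd \<phi>)) (dual (dm \<phi>)) (coev (dm \<phi>)) \<phi>)"

definition dd_comp where
  "dd_comp G F = mat (dual F \<circ>\<circ> dual G) (dual (dual G) \<circ>\<circ> dual (dual F))
     (comp_counit2 (dual G) (dual (dual G)) (ev (dual G)) (dual F) (dual (dual F)) (ev (dual F)))
     (dual (dual (G \<circ>\<circ> F))) (coev (dual (G \<circ>\<circ> F)))
     (mat (G \<circ>\<circ> F) (dual (G \<circ>\<circ> F)) (ev (G \<circ>\<circ> F)) (dual F \<circ>\<circ> dual G)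
       (comp_unit2 F (dual F) (coev F) G (dual G) (coev G)) (idc (G \<circ>\<circ> F)))"

definition dd_unit where
  "dd_unit a = mat (unit a) (unit a) (lu (unit a)) (dual (dual (unit a))) (coev (dual (unit a)))
     (mat (unit a) (dual (unit a)) (ev (unit a)) (unit a) (inv (lu (unit a))) (idc (unit a)))"

lemma dd_simps [simp]:
  "dm (dd_cell \<phi>) = dual (dual (dm \<phi>))" "cd (dd_cell \<phi>) = dual (dual (cd \<phi>))"
  "dm (dd_comp G F) = dual (dual G) \<circ>\<circ> dual (dual F)" "cd (dd_comp G F) = dual (dual (G \<circ>\<circ> F))"
  "dm (dd_unit a) = unit a" "cd (dd_unit a) = dual (dual (unit a))"
  by (simp_all add: dd_cell_def dd_comp_def dd_unit_def)

lemma cell_dd_cell [simp]: "cell \<phi> \<Longrightarrow> cell (dd_cell \<phi>)"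
  unfolding dd_cell_def by (intro cell_mat) simp_all

lemma cell_dd_comp [simp]: "\<lbrakk>arr F; arr G; src G = tgt F\<rbrakk> \<Longrightarrow> cell (dd_comp G F)"
  unfolding dd_comp_def
  by (intro cell_mat)
    (simp_all add: comp_unit2_cell[OF adj_dual adj_dual] comp_counit2_cell[OF adj_dual adj_dual])

lemma cell_dd_unit [simp]: "a \<in> Ob B \<Longrightarrow> cell (dd_unit a)"
  unfolding dd_unit_def by (intro cell_mat) simp_all

lemma und_dd_cell:
  "und (dd_cell \<phi>) = FCell (double_dual B) (src (dm \<phi>)) (tgt (dm \<phi>)) (mor (dm \<phi>)) (mor (cd \<phi>)) (und \<phi>)"
  if "cell \<phi>"
  using that by (simp add: dd_cell_def und_mat[of _ "tgt (dm \<phi>)"] und_mat[of _ "src (dm \<phi>)"] double_dual_def dual_cell_def)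

lemma und_dd_comp:
  "und (dd_comp G F) = FComp (double_dual B) (src F) (tgt F) (tgt G) (mor G) (mor F)"
  by (simp add: dd_comp_def und_mat[of _ "tgt G"] und_mat[of _ "src F"] und_comp_unit2[of _ "tgt F"]
      und_comp_counit2 double_dual_def dual_comp_def radj_iso_def)

lemma und_dd_unit: "und (dd_unit a) = FUnit (double_dual B) a"
  by (simp add: dd_unit_def und_mat[of _ a] double_dual_def dual_unit_def radj_iso_def LUnitI_def)

end

section \<open>The strictification is a dagger 2-category\<close>

context SO2_volutive
begin

notation cmp (infixr "\<circ>\<circ>" 75)
notation vc (infixr "\<bullet>" 60)
notation hc (infixr "\<diamondop>" 70)

definition vol_ob where "vol_ob a = Arrow a a (TOb (Vol V) a)"

definition vol_cell where
  "vol_cell F = TwoCell (dual (dual F) \<circ>\<circ> vol_ob (src F)) (vol_ob (tgt F) \<circ>\<circ> F)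
     (THom (Vol V) (src F) (tgt F) (mor F))"

sublocale vol: invertible_transformation V V "id_psfun V" "double_dual V" "Vol V"
  by (rule Vol_invertible)

lemma vol_simps [simp]:
  "src (vol_ob a) = a" "tgt (vol_ob a) = a" "mor (vol_ob a) = TOb (Vol V) a"
  "dm (vol_cell F) = dual (dual F) \<circ>\<circ> vol_ob (src F)" "cd (vol_cell F) = vol_ob (tgt F) \<circ>\<circ> F"
  "und (vol_cell F) = THom (Vol V) (src F) (tgt F) (mor F)"
  by (simp_all add: vol_ob_def vol_cell_def)

lemma arr_vol_ob [simp]: "a \<in> Ob V \<Longrightarrow> arr (vol_ob a)"
  using vol.TOb_in[of a] by (simp add: arr_def id_psfun_def double_dual_def del: arr_Ob)

lemma iso_cellI: "\<lbrakk>arr (dm \<phi>); arr (cd \<phi>); src (cd \<phi>) = src (dm \<phi>); tgt (cd \<phi>) = tgt (dm \<phi>);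
    und \<phi> \<in> Iso2 V (mor (dm \<phi>)) (mor (cd \<phi>))\<rbrakk> \<Longrightarrow> iso \<phi>"
  unfolding iso_def cell_def Iso2_def by auto

lemma iso_vol_cell [simp]: "arr F \<Longrightarrow> iso (vol_cell F)"
proof (rule iso_cellI)
  assume "arr F"
  then have "src F \<in> Ob V" "tgt F \<in> Ob V" "mor F \<in> Hom V (src F) (tgt F)"
    by (simp_all only: arr_def)
  from vol.THom_iso[OF this] show "und (vol_cell F) \<in> Iso2 V (mor (dm (vol_cell F))) (mor (cd (vol_cell F)))"
    by (simp add: id_psfun_def double_dual_def)
qed simp_all

lemma vol_cell_natural:
  assumes "cell \<phi>"
  shows "vol_cell (cd \<phi>) \<bullet> (dd_cell \<phi> \<diamondop> idc (vol_ob (src (dm \<phi>))))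
    = (idc (vol_ob (tgt (dm \<phi>))) \<diamondop> \<phi>) \<bullet> vol_cell (dm \<phi>)"
proof -
  have "src (dm \<phi>) \<in> Ob V" "tgt (dm \<phi>) \<in> Ob V" "mor (dm \<phi>) \<in> Hom V (src (dm \<phi>)) (tgt (dm \<phi>))"
    "mor (cd \<phi>) \<in> Hom V (src (dm \<phi>)) (tgt (dm \<phi>))" "und \<phi> \<in> Cell V (mor (dm \<phi>)) (mor (cd \<phi>))"
    using assms by (simp_all only: cell_iff)
  from vol.THom_natural[OF this] show ?thesis
    by (intro twocell.expand) (simp add: assms und_dd_cell id_psfun_def)
qed

text \<open>The first factor on the right is an identity, kept because it stands for the comparison
  cell of \<open>id_psfun\<close>: under \<open>und\<close> the equation then becomes the axiom
  \<open>THom_Comp1\<close> word for word. This is also why \<open>hc_idc\<close> is switched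
  off.\<close>

lemma vol_cell_cmp:
  assumes "arr F" "arr G" "src G = tgt F"
  shows "vol_cell (G \<circ>\<circ> F) \<bullet> (dd_comp G F \<diamondop> idc (vol_ob (src F)))
    = (idc (vol_ob (tgt G)) \<diamondop> idc (G \<circ>\<circ> F)) \<bullet> asc (vol_ob (tgt G)) G F \<bullet> (vol_cell G \<diamondop> idc F)
      \<bullet> inv (asc (dual (dual G)) (vol_ob (tgt F)) F) \<bullet> (idc (dual (dual G)) \<diamondop> vol_cell F)
      \<bullet> asc (dual (dual G)) (dual (dual F)) (vol_ob (src F))"
proof -
  have *: "src F \<in> Ob V" "tgt F \<in> Ob V" "tgt G \<in> Ob V" "mor F \<in> Hom V (src F) (tgt F)"
    "mor G \<in> Hom V (tgt F) (tgt G)"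
    using assms by (simp_all add: arr_def del: arr_Ob)
  \<comment> \<open>Only \<open>FHom\<close> of \<open>double_dual\<close> is unfolded, so that its
    \<open>FComp\<close> stays in the form given by \<open>und_dd_comp\<close>.\<close>
  have "FHom (double_dual V) a b f = Dual V (Dual V f)" for a b f
    by (simp add: double_dual_def)
  with vol.THom_Comp1[OF *] show ?thesis
    using assms by (intro twocell.expand) (simp add: und_dd_comp id_psfun_def AssocI_def del: hc_idc)
qed

lemma vol_cell_unit:
  assumes "a \<in> Ob V"
  shows "vol_cell (unit a) \<bullet> (dd_unit a \<diamondop> idc (vol_ob a))
    = (idc (vol_ob a) \<diamondop> idc (unit a)) \<bullet> inv (ru (vol_ob a)) \<bullet> lu (vol_ob a)"
  using vol.THom_Id1[OF assms] assms
  by (intro twocell.expand) (simp add: und_dd_unit id_psfun_def RUnitI_def del: hc_idc)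

text \<open>Conjugation of \<open>vol_cell\<close> by the trivialisations \<open>snd p\<close> and
  \<open>snd q\<close>, in the shape produced by the transport lemmas; its underlying cell is
  \<open>THom\<close> of the strictification.\<close>

definition strict_cell where
  "strict_cell p q F = (TwoCell (vol_ob (fst q)) (unit (fst q)) (snd q) \<diamondop> idc F) \<bullet> vol_cell F
    \<bullet> (idc (dual (dual F)) \<diamondop> inv (TwoCell (vol_ob (fst p)) (unit (fst p)) (snd p)))"

section \<open>Change of objects along the first projection\<close>

lemma inv2_S_SO2: "inv2 (S_SO2 V) = inv2 V" "Iso2 (S_SO2 V) = Iso2 V"
  by (simp_all add: fun_eq_iff inv2_def Iso2_def inverse2_def S_SO2_def)

lemma S_SO2_simps [simp]:
  "p \<in> Ob (S_SO2 V) \<longleftrightarrow> fst p \<in> Ob V \<and> snd p \<in> Iso2 V (TOb (Vol V) (fst p)) (\<one>\<^bsub>V\<^esub> (fst p))"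
  "Hom (S_SO2 V) p q = Hom V (fst p) (fst q)" "Cell (S_SO2 V) = Cell V" "Id1 (S_SO2 V) p = Id1 V (fst p)"
  "Comp1 (S_SO2 V) = Comp1 V" "Id2 (S_SO2 V) = Id2 V" "VComp (S_SO2 V) = VComp V" "HComp (S_SO2 V) = HComp V"
  "Assoc (S_SO2 V) = Assoc V" "LUnit (S_SO2 V) = LUnit V" "RUnit (S_SO2 V) = RUnit V"
  "Dual (S_SO2 V) = Dual V" "Coev (S_SO2 V) = Coev V" "Ev (S_SO2 V) = Ev V"
  by (auto simp: S_SO2_def)

text \<open>Objects enter these constructions only through their unit 1-morphisms, hence through
  \<open>fst\<close>; the trivialisations affect nothing but \<open>Vol\<close>.\<close>

lemma derived_S_SO2:
  "AssocI (S_SO2 V) = AssocI V" "LUnitI (S_SO2 V) p = LUnitI V (fst p)" "RUnitI (S_SO2 V) p = RUnitI V (fst p)"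
  "mate (S_SO2 V) p = mate V (fst p)" "radj_iso (S_SO2 V) p = radj_iso V (fst p)"
  "comp_unit (S_SO2 V) p = comp_unit V (fst p)" "comp_counit (S_SO2 V) = comp_counit V"
  "dual_cell (S_SO2 V) p = dual_cell V (fst p)" "dual_comp (S_SO2 V) p q = dual_comp V (fst p) (fst q)"
  "dual_unit (S_SO2 V) p = dual_unit V (fst p)"
proof -
  show *: "AssocI (S_SO2 V) = AssocI V" "\<And>p. LUnitI (S_SO2 V) p = LUnitI V (fst p)" "RUnitI (S_SO2 V) p = RUnitI V (fst p)"
    by (simp_all add: fun_eq_iff AssocI_def LUnitI_def RUnitI_def inv2_S_SO2)
  show **: "\<And>p. mate (S_SO2 V) p = mate V (fst p)"
    by (simp add: fun_eq_iff mate_def *)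
  then show ***: "\<And>p. radj_iso (S_SO2 V) p = radj_iso V (fst p)"
    by (simp add: fun_eq_iff radj_iso_def)
  show ****: "\<And>p. comp_unit (S_SO2 V) p = comp_unit V (fst p)"  "comp_counit (S_SO2 V) = comp_counit V"
    by (simp_all add: fun_eq_iff comp_unit_def comp_counit_def *)
  show "dual_cell (S_SO2 V) p = dual_cell V (fst p)" "dual_comp (S_SO2 V) p q = dual_comp V (fst p) (fst q)"
    "dual_unit (S_SO2 V) p = dual_unit V (fst p)"
    by (simp_all add: fun_eq_iff dual_cell_def dual_comp_def dual_unit_def * ** *** ****)
qed

lemma bicategory_S_SO2: "bicategory (S_SO2 V)"
  by (unfold_locales, unfold S_SO2_simps inv2_S_SO2)
    (blast intro: Id1_in Comp1_in Id2_in VComp_in VComp_Id2_left VComp_Id2_right VComp_assoc HComp_in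
      HComp_Id2 interchange Assoc_iso LUnit_iso RUnit_iso Assoc_natural LUnit_natural RUnit_natural
      pentagon triangle)+

lemma adj_bicategory_S_SO2: "adj_bicategory (S_SO2 V)"
proof -
  interpret E: bicategory "S_SO2 V"
    by (rule bicategory_S_SO2)
  show ?thesis
  proof
    fix p q X
    assume "p \<in> Ob (S_SO2 V)" "q \<in> Ob (S_SO2 V)" "X \<in> Hom (S_SO2 V) p q"
    then show "adjunction (S_SO2 V) p q X (X\<^sup>\<or>\<^bsub>S_SO2 V\<^esub>) (\<eta>\<^bsub>S_SO2 V\<^esub> X) (\<epsilon>\<^bsub>S_SO2 V\<^esub> X)"
      using Dual_adjunction[of "fst p" "fst q" X] by (simp add: adjunction_def derived_S_SO2)
  qed
qed

lemma double_dual_S_SO2: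
  "FOb (double_dual (S_SO2 V)) p = p"
  "FHom (double_dual (S_SO2 V)) p q X = X\<^sup>\<or>\<^bsub>V\<^esub>\<^sup>\<or>\<^bsub>V\<^esub>"
  "FCell (double_dual (S_SO2 V)) p q X Y \<phi> = FCell (double_dual V) (fst p) (fst q) X Y \<phi>"
  "FComp (double_dual (S_SO2 V)) p q r Y X = FComp (double_dual V) (fst p) (fst q) (fst r) Y X"
  "FUnit (double_dual (S_SO2 V)) p = FUnit (double_dual V) (fst p)"
  by (simp_all add: double_dual_def derived_S_SO2)

lemma THom_S_SO2:
  assumes "p \<in> Ob (S_SO2 V)" "q \<in> Ob (S_SO2 V)" "X \<in> Hom V (fst p) (fst q)"
  shows "THom (Vol (S_SO2 V)) p q X = und (strict_cell p q (Arrow (fst p) (fst q) X))"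
  using assms by (simp add: S_SO2_def strict_cell_def split: prod.splits)

lemma iso_trivialization:
  assumes "p \<in> Ob (S_SO2 V)"
  shows "iso (TwoCell (vol_ob (fst p)) (unit (fst p)) (snd p))"
  by (rule iso_cellI) (use assms in simp_all)

lemma arr_Arrow: "arr (Arrow a b f) \<longleftrightarrow> a \<in> Ob V \<and> b \<in> Ob V \<and> f \<in> Hom V a b"
  by (simp add: arr_def del: arr_Ob)

lemma strict_cell:
  assumes "p \<in> Ob (S_SO2 V)" "q \<in> Ob (S_SO2 V)" "arr F" "src F = fst p" "tgt F = fst q"
  shows "iso (strict_cell p q F)" "dm (strict_cell p q F) = dual (dual F) \<circ>\<circ> unit (src F)"
    "cd (strict_cell p q F) = unit (tgt F) \<circ>\<circ> F"
  using assms iso_trivialization[of p] iso_trivialization[of q] by (simp_all add: strict_cell_def)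

text \<open>The new components at objects are units, hence equivalences. Each equation arises by
  applying \<open>und\<close> to a transport lemma in which the trivialisations replace the
  components \<open>vol_ob\<close> by units.\<close>

lemma Vol_S_SO2_invertible:
  "invertible_transformation (S_SO2 V) (S_SO2 V) (id_psfun (S_SO2 V)) (double_dual (S_SO2 V)) (Vol (S_SO2 V))"
proof -
  interpret E: adj_bicategory "S_SO2 V"
    by (rule adj_bicategory_S_SO2)
  have TOb: "TOb (Vol (S_SO2 V)) p = \<one>\<^bsub>V\<^esub> (fst p)" for p
    by (simp add: S_SO2_def)
  let ?t = "\<lambda>p. TwoCell (vol_ob (fst p)) (unit (fst p)) (snd p)"
  show ?thesis
  proof
    fix p assume p: "p \<in> Ob (S_SO2 V)"
    then have [simp]: "fst p \<in> Ob V" by simp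
    note [simp] = iso_trivialization[OF p]
    show "TOb (Vol (S_SO2 V)) p \<in> Hom (S_SO2 V) (FOb (id_psfun (S_SO2 V)) p) (FOb (double_dual (S_SO2 V)) p)"
      by (simp add: TOb double_dual_S_SO2 id_psfun_def Id1_in)
    \<comment> \<open>The unitor at a unit and its inverse supply the two isomorphisms by which the
      unit 1-morphism is its own quasi-inverse.\<close>
    have "iso (lu (unit (fst p)))" by simp
    from und_isoI[OF this] und_isoI[OF iso_inv[OF this]]
    show "equivalence1 (S_SO2 V) (FOb (id_psfun (S_SO2 V)) p) (FOb (double_dual (S_SO2 V)) p) (TOb (Vol (S_SO2 V)) p)"
      by (auto simp: equivalence1_def TOb double_dual_S_SO2 id_psfun_def Id1_in inv2_S_SO2
          intro!: bexI[of _ "\<one>\<^bsub>V\<^esub> (fst p)"])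
    have "strict_cell p p (unit (fst p)) \<bullet> (dd_unit (fst p) \<diamondop> idc (unit (fst p)))
      = (idc (unit (fst p)) \<diamondop> idc (unit (fst p))) \<bullet> inv (ru (unit (fst p))) \<bullet> lu (unit (fst p))"
      unfolding strict_cell_def
      by (rule transport_unit[where a = "fst p" and b = "fst p" and T = "vol_ob (fst p)"])
        (use vol_cell_unit[of "fst p"] in simp_all)
    from arg_cong[OF this, of und]
    show "VComp (S_SO2 V) (THom (Vol (S_SO2 V)) p p (\<one>\<^bsub>S_SO2 V\<^esub> p))
        (FUnit (double_dual (S_SO2 V)) p \<star>\<^bsub>S_SO2 V\<^esub> \<iota>\<^bsub>S_SO2 V\<^esub> (TOb (Vol (S_SO2 V)) p))
      = (\<iota>\<^bsub>S_SO2 V\<^esub> (TOb (Vol (S_SO2 V)) p) \<star>\<^bsub>S_SO2 V\<^esub> FUnit (id_psfun (S_SO2 V)) p)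
        \<cdot>\<^bsub>S_SO2 V\<^esub> RUnitI (S_SO2 V) (FOb (id_psfun (S_SO2 V)) p) (TOb (Vol (S_SO2 V)) p)
        \<cdot>\<^bsub>S_SO2 V\<^esub> \<l>\<^bsub>S_SO2 V\<^esub> (TOb (Vol (S_SO2 V)) p)"
      using p by (simp add: THom_S_SO2 Id1_in TOb double_dual_S_SO2 id_psfun_def und_dd_unit derived_S_SO2
          RUnitI_def unit_def[symmetric] del: hc_idc)
  next
    fix p q f assume pq: "p \<in> Ob (S_SO2 V)" "q \<in> Ob (S_SO2 V)" and "f \<in> Hom (S_SO2 V) p q"
    then have f: "f \<in> Hom V (fst p) (fst q)" "fst p \<in> Ob V" "fst q \<in> Ob V"
      by simp_all
    with und_isoI[OF strict_cell(1)[OF pq, of "Arrow (fst p) (fst q) f"]]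
    show "THom (Vol (S_SO2 V)) p q f \<in> Iso2 (S_SO2 V)
        (FHom (double_dual (S_SO2 V)) p q f \<odot>\<^bsub>S_SO2 V\<^esub> TOb (Vol (S_SO2 V)) p)
        (TOb (Vol (S_SO2 V)) q \<odot>\<^bsub>S_SO2 V\<^esub> FHom (id_psfun (S_SO2 V)) p q f)"
      using strict_cell(2,3)[OF pq, of "Arrow (fst p) (fst q) f"]
      by (simp add: THom_S_SO2[OF pq f(1)] TOb double_dual_S_SO2 id_psfun_def inv2_S_SO2 arr_Arrow)
  next
    fix p q f g \<phi>
    assume pq: "p \<in> Ob (S_SO2 V)" "q \<in> Ob (S_SO2 V)" and "f \<in> Hom (S_SO2 V) p q"
      "g \<in> Hom (S_SO2 V) p q" and "\<phi> \<in> Cell (S_SO2 V) f g"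
    then have fg: "f \<in> Hom V (fst p) (fst q)" "g \<in> Hom V (fst p) (fst q)"
      and \<phi>: "\<phi> \<in> Cell V f g" and [simp]: "fst p \<in> Ob V" "fst q \<in> Ob V"
      by simp_all
    note [simp] = iso_trivialization[OF pq(1)] iso_trivialization[OF pq(2)]
    define F G \<Phi> where "F = Arrow (fst p) (fst q) f" and "G = Arrow (fst p) (fst q) g"
      and "\<Phi> = TwoCell F G \<phi>"
    have [simp]: "arr F" "arr G" "src F = fst p" "tgt F = fst q" "src G = fst p" "tgt G = fst q"
      "mor F = f" "mor G = g"
      using fg by (simp_all add: F_def G_def arr_Arrow)
    have [simp]: "cell \<Phi>" "dm \<Phi> = F" "cd \<Phi> = G" "und \<Phi> = \<phi>"
      using fg \<phi> by (simp_all add: cell_iff \<Phi>_def del: cellD)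
    have "strict_cell p q G \<bullet> (dd_cell \<Phi> \<diamondop> idc (unit (fst p)))
      = (idc (unit (fst q)) \<diamondop> \<Phi>) \<bullet> strict_cell p q F"
      unfolding strict_cell_def
      by (rule transport_natural[where T\<^sub>a = "vol_ob (fst p)" and T\<^sub>b = "vol_ob (fst q)"])
        (use vol_cell_natural[of \<Phi>] in simp_all)
    from arg_cong[OF this, of und]
    show "THom (Vol (S_SO2 V)) p q g \<cdot>\<^bsub>S_SO2 V\<^esub>
        (FCell (double_dual (S_SO2 V)) p q f g \<phi> \<star>\<^bsub>S_SO2 V\<^esub> \<iota>\<^bsub>S_SO2 V\<^esub> (TOb (Vol (S_SO2 V)) p))
      = (\<iota>\<^bsub>S_SO2 V\<^esub> (TOb (Vol (S_SO2 V)) q) \<star>\<^bsub>S_SO2 V\<^esub> FCell (id_psfun (S_SO2 V)) p q f g \<phi>)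
        \<cdot>\<^bsub>S_SO2 V\<^esub> THom (Vol (S_SO2 V)) p q f"
      by (simp add: THom_S_SO2[OF pq fg(1)] THom_S_SO2[OF pq fg(2)] TOb double_dual_S_SO2 id_psfun_def
          und_dd_cell F_def[symmetric] G_def[symmetric])
  next
    fix p q r f g
    assume pqr: "p \<in> Ob (S_SO2 V)" "q \<in> Ob (S_SO2 V)" "r \<in> Ob (S_SO2 V)"
      and "f \<in> Hom (S_SO2 V) p q" "g \<in> Hom (S_SO2 V) q r"
    then have fg: "f \<in> Hom V (fst p) (fst q)" "g \<in> Hom V (fst q) (fst r)"
      and [simp]: "fst p \<in> Ob V" "fst q \<in> Ob V" "fst r \<in> Ob V"
      by simp_all
    then have gf: "g \<odot>\<^bsub>V\<^esub> f \<in> Hom V (fst p) (fst r)"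
      by (blast intro: Comp1_in)
    note [simp] = iso_trivialization[OF pqr(1)] iso_trivialization[OF pqr(2)] iso_trivialization[OF pqr(3)]
    define F G where "F = Arrow (fst p) (fst q) f" and "G = Arrow (fst q) (fst r) g"
    have GF: "Arrow (fst p) (fst r) (g \<odot>\<^bsub>V\<^esub> f) = G \<circ>\<circ> F"
      by (simp add: cmp_def F_def G_def)
    have [simp]: "arr F" "arr G" "src F = fst p" "tgt F = fst q" "src G = fst q" "tgt G = fst r"
      "mor F = f" "mor G = g"
      using fg by (simp_all add: F_def G_def arr_Arrow)
    have "strict_cell p r (G \<circ>\<circ> F) \<bullet> (dd_comp G F \<diamondop> idc (unit (fst p)))
      = (idc (unit (fst r)) \<diamondop> idc (G \<circ>\<circ> F)) \<bullet> asc (unit (fst r)) G F \<bullet> (strict_cell q r G \<diamondop> idc F)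
      \<bullet> inv (asc (dual (dual G)) (unit (fst q)) F) \<bullet> (idc (dual (dual G)) \<diamondop> strict_cell p q F)
      \<bullet> asc (dual (dual G)) (dual (dual F)) (unit (fst p))"
      unfolding strict_cell_def
      by (rule transport_cmp[where T\<^sub>a = "vol_ob (fst p)" and T\<^sub>b = "vol_ob (fst q)" and T\<^sub>c = "vol_ob (fst r)"])
        (use vol_cell_cmp[of F G] in simp_all)
    from arg_cong[OF this, of und]
    show "THom (Vol (S_SO2 V)) p r (g \<odot>\<^bsub>S_SO2 V\<^esub> f) \<cdot>\<^bsub>S_SO2 V\<^esub>
        (FComp (double_dual (S_SO2 V)) p q r g f \<star>\<^bsub>S_SO2 V\<^esub> \<iota>\<^bsub>S_SO2 V\<^esub> (TOb (Vol (S_SO2 V)) p))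
      = (\<iota>\<^bsub>S_SO2 V\<^esub> (TOb (Vol (S_SO2 V)) r) \<star>\<^bsub>S_SO2 V\<^esub> FComp (id_psfun (S_SO2 V)) p q r g f)
        \<cdot>\<^bsub>S_SO2 V\<^esub> \<a>\<^bsub>S_SO2 V\<^esub> (TOb (Vol (S_SO2 V)) r) (FHom (id_psfun (S_SO2 V)) q r g) (FHom (id_psfun (S_SO2 V)) p q f)
        \<cdot>\<^bsub>S_SO2 V\<^esub> (THom (Vol (S_SO2 V)) q r g \<star>\<^bsub>S_SO2 V\<^esub> \<iota>\<^bsub>S_SO2 V\<^esub> (FHom (id_psfun (S_SO2 V)) p q f))
        \<cdot>\<^bsub>S_SO2 V\<^esub> AssocI (S_SO2 V) (FHom (double_dual (S_SO2 V)) q r g) (TOb (Vol (S_SO2 V)) q) (FHom (id_psfun (S_SO2 V)) p q f)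
        \<cdot>\<^bsub>S_SO2 V\<^esub> (\<iota>\<^bsub>S_SO2 V\<^esub> (FHom (double_dual (S_SO2 V)) q r g) \<star>\<^bsub>S_SO2 V\<^esub> THom (Vol (S_SO2 V)) p q f)
        \<cdot>\<^bsub>S_SO2 V\<^esub> \<a>\<^bsub>S_SO2 V\<^esub> (FHom (double_dual (S_SO2 V)) q r g) (FHom (double_dual (S_SO2 V)) p q f) (TOb (Vol (S_SO2 V)) p)"
      by (simp add: THom_S_SO2[OF pqr(1,2) fg(1)] THom_S_SO2[OF pqr(2,3) fg(2)] THom_S_SO2[OF pqr(1,3) gf]
          GF TOb double_dual_S_SO2 id_psfun_def und_dd_comp derived_S_SO2 AssocI_def
          F_def[symmetric] G_def[symmetric] del: hc_idc)
  qed
qed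

theorem SO2_dagger_S_SO2: "SO2_dagger (S_SO2 V)"
  by (intro SO2_dagger.intro SO2_dagger_axioms.intro SO2_volutive.intro SO2_volutive_axioms.intro
      adj_bicategory_S_SO2 Vol_S_SO2_invertible) (simp add: S_SO2_def)

end

section \<open>The identity as an equivalence\<close>

context bicategory
begin

lemma pseudofunctor_id: "pseudofunctor B B (id_psfun B)"
proof
  fix a assume "a \<in> Ob B"
  then show "FUnit (id_psfun B) a \<in> Iso2 B (\<one> (FOb (id_psfun B) a)) (FHom (id_psfun B) a a (\<one> a))"
    using und_isoI[of "idc (unit a)"] by (simp add: id_psfun_def)
next
  fix a b f assume f: "a \<in> Ob B" "b \<in> Ob B" "f \<in> Hom B a b"
  define F where "F = Arrow a b f"
  have [simp]: "arr F" "src F = a" "tgt F = b" "mor F = f"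
    using f by (simp_all add: F_def arr_def del: arr_Ob)
  \<comment> \<open>Identity factors are written out so that \<open>und\<close> of these equations
    matches the comparison cells of \<open>id_psfun\<close>.\<close>
  have "lu F \<bullet> idc (unit b \<circ>\<circ> F) \<bullet> (idc (unit b) \<diamondop> idc F) = lu F"
    "ru F \<bullet> idc (F \<circ>\<circ> unit a) \<bullet> (idc F \<diamondop> idc (unit a)) = ru F"
    using f by simp_all
  from this[THEN arg_cong[of _ _ und]]
  show "FCell (id_psfun B) a b (\<one> b \<odot> f) f (\<l> f) \<cdot> FComp (id_psfun B) a b b (\<one> b) f
      \<cdot> (FUnit (id_psfun B) b \<star> \<iota> (FHom (id_psfun B) a b f)) = \<l> (FHom (id_psfun B) a b f)"
    "FCell (id_psfun B) a b (f \<odot> \<one> a) f (\<r> f) \<cdot> FComp (id_psfun B) a a b f (\<one> a)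
      \<cdot> (\<iota> (FHom (id_psfun B) a b f) \<star> FUnit (id_psfun B) a) = \<r> (FHom (id_psfun B) a b f)"
    by (simp_all add: id_psfun_def del: hc_idc)
next
  fix a b c f g assume fg: "a \<in> Ob B" "b \<in> Ob B" "c \<in> Ob B" "f \<in> Hom B a b" "g \<in> Hom B b c"
  define F G where "F = Arrow a b f" and "G = Arrow b c g"
  have "arr F" "src F = a" "tgt F = b" "mor F = f" "arr G" "src G = b" "tgt G = c" "mor G = g"
    using fg by (simp_all add: F_def G_def arr_def del: arr_Ob)
  then show "FComp (id_psfun B) a b c g f
      \<in> Iso2 B (FHom (id_psfun B) b c g \<odot> FHom (id_psfun B) a b f) (FHom (id_psfun B) a c (g \<odot> f))"
    using und_isoI[of "idc (G \<circ>\<circ> F)"] by (simp add: id_psfun_def)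
next
  fix a b c f f' g g' \<phi> \<psi>
  assume *: "a \<in> Ob B" "b \<in> Ob B" "c \<in> Ob B" "f \<in> Hom B a b" "f' \<in> Hom B a b" "g \<in> Hom B b c" "g' \<in> Hom B b c"
    "\<phi> \<in> Cell B f f'" "\<psi> \<in> Cell B g g'"
  from HComp_in[OF *] Comp1_in[OF *(1-4,6)] Comp1_in[OF *(1-3,5,7)]
  show "FComp (id_psfun B) a b c g' f' \<cdot> (FCell (id_psfun B) b c g g' \<psi> \<star> FCell (id_psfun B) a b f f' \<phi>)
    = FCell (id_psfun B) a c (g \<odot> f) (g' \<odot> f') (\<psi> \<star> \<phi>) \<cdot> FComp (id_psfun B) a b c g f"
    using VComp_Id2_left[of a c "g \<odot> f" "g' \<odot> f'"] VComp_Id2_right[of a c "g \<odot> f" "g' \<odot> f'"] *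
    by (simp add: id_psfun_def)
next
  fix a b c d f g h
  assume *: "a \<in> Ob B" "b \<in> Ob B" "c \<in> Ob B" "d \<in> Ob B" "f \<in> Hom B a b" "g \<in> Hom B b c" "h \<in> Hom B c d"
  define F G H where "F = Arrow a b f" and "G = Arrow b c g" and "H = Arrow c d h"
  have [simp]: "arr F" "src F = a" "tgt F = b" "mor F = f" "arr G" "src G = b" "tgt G = c" "mor G = g"
    "arr H" "src H = c" "tgt H = d" "mor H = h"
    using * by (simp_all add: F_def G_def H_def arr_def del: arr_Ob)
  have "asc H G F \<bullet> idc ((H \<circ>\<circ> G) \<circ>\<circ> F) \<bullet> (idc (H \<circ>\<circ> G) \<diamondop> idc F)
      = idc (H \<circ>\<circ> G \<circ>\<circ> F) \<bullet> (idc H \<diamondop> idc (G \<circ>\<circ> F)) \<bullet> asc H G F"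
    by simp
  from arg_cong[OF this, of und]
  show "FCell (id_psfun B) a d ((h \<odot> g) \<odot> f) (h \<odot> g \<odot> f) (\<a> h g f) \<cdot> FComp (id_psfun B) a b d (h \<odot> g) f
      \<cdot> (FComp (id_psfun B) b c d h g \<star> \<iota> (FHom (id_psfun B) a b f))
    = FComp (id_psfun B) a c d h (g \<odot> f) \<cdot> (\<iota> (FHom (id_psfun B) c d h) \<star> FComp (id_psfun B) a b c g f)
      \<cdot> \<a> (FHom (id_psfun B) c d h) (FHom (id_psfun B) b c g) (FHom (id_psfun B) a b f)"
    by (simp add: id_psfun_def del: hc_idc vc_idc)
qed (simp_all add: id_psfun_def)

text \<open>The composite of two identity 2-functors is not the record \<open>id_psfun\<close>: the comparison 2-morphisms
  agree only on composable 1-morphisms.\<close>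

definition identity_like :: "('o, 'm, 'c, 'o, 'm, 'c) psfun \<Rightarrow> bool" where
  "identity_like F \<longleftrightarrow> FOb F = (\<lambda>a. a) \<and> FHom F = (\<lambda>a b f. f) \<and> FCell F = (\<lambda>a b f g \<phi>. \<phi>) \<and>
     (\<forall>a \<in> Ob B. \<forall>b \<in> Ob B. \<forall>c \<in> Ob B. \<forall>f \<in> Hom B a b. \<forall>g \<in> Hom B b c. FComp F a b c g f = \<iota> (g \<odot> f)) \<and>
     (\<forall>a \<in> Ob B. FUnit F a = \<iota> (\<one> a))"

lemma identity_like_id_psfun: "identity_like (id_psfun B)"
  by (simp add: identity_like_def id_psfun_def)

lemma identity_like_comp_psfun: "identity_like (comp_psfun B B B (id_psfun B) (id_psfun B))"
proof -
  have "\<iota> (g \<odot> f) \<cdot> \<iota> (g \<odot> f) = \<iota> (g \<odot> f)"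
    if "a \<in> Ob B" "b \<in> Ob B" "c \<in> Ob B" "f \<in> Hom B a b" "g \<in> Hom B b c" for a b c f g
    using that VComp_Id2_left[of a c "g \<odot> f" "g \<odot> f"] Comp1_in[OF that] Id2_in[of a c "g \<odot> f"] by simp
  moreover have "\<iota> (\<one> a) \<cdot> \<iota> (\<one> a) = \<iota> (\<one> a)" if "a \<in> Ob B" for a
    using that VComp_Id2_left[of a a "\<one> a" "\<one> a"] Id1_in[OF that] Id2_in[of a a "\<one> a"] by simp
  ultimately show ?thesis
    by (auto simp: identity_like_def comp_psfun_def id_psfun_def)
qed

text \<open>Even with units as components, the cell at \<open>f\<close> has to lead from
  \<open>f \<odot> \<one> a\<close> to \<open>\<one> b \<odot> f\<close>; it is therefore built from
  the two unitors.\<close>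

definition id_trans :: "('o, 'm, 'm, 'c) trans" where
  "id_trans = \<lparr> TOb = Id1 B, THom = (\<lambda>a b f. LUnitI B b f \<cdot> \<r> f) \<rparr>"

lemma equivalence1_unit: "a \<in> Ob B \<Longrightarrow> equivalence1 B a a (\<one> a)"
proof -
  assume a: "a \<in> Ob B"
  then have "iso (lu (unit a))" by simp
  from und_isoI[OF this] und_isoI[OF iso_inv[OF this]] show ?thesis
    using a Id1_in by (auto simp: equivalence1_def intro!: bexI[of _ "\<one> a"])
qed

text \<open>Stated for two identity-like 2-functors because it serves both from the identity to a
  composite of identities and back. The axioms reduce to naturality of the unitors,
  \<open>lu_unit\<close> and \<open>unit_commute_cmp\<close>.\<close>

lemma invertible_id_trans:
  assumes F: "identity_like F" and G: "identity_like G"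
  shows "invertible_transformation B B F G id_trans"
proof
  fix a assume a: "a \<in> Ob B"
  then show "equivalence1 B (FOb F a) (FOb G a) (TOb id_trans a)"
    using F G by (simp add: identity_like_def id_trans_def equivalence1_unit)
  from a show "TOb id_trans a \<in> Hom B (FOb F a) (FOb G a)"
    using F G Id1_in by (simp add: identity_like_def id_trans_def)
  \<comment> \<open>The unit axiom amounts to the equality of the two unitors at
    \<open>unit a\<close>.\<close>
  have "(inv (lu (unit a)) \<bullet> ru (unit a)) \<bullet> (idc (unit a) \<diamondop> idc (unit a))
      = (idc (unit a) \<diamondop> idc (unit a)) \<bullet> inv (ru (unit a)) \<bullet> lu (unit a)"
    using a by (simp add: lu_unit)
  from arg_cong[OF this, of und]
  show "THom id_trans a a (\<one> a) \<cdot> (FUnit G a \<star> \<iota> (TOb id_trans a))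
      = (\<iota> (TOb id_trans a) \<star> FUnit F a) \<cdot> RUnitI B (FOb F a) (TOb id_trans a) \<cdot> \<l> (TOb id_trans a)"
    using a F G by (simp add: identity_like_def id_trans_def LUnitI_def RUnitI_def del: hc_idc vc_assoc)
next
  fix a b f assume f: "a \<in> Ob B" "b \<in> Ob B" "f \<in> Hom B a b"
  define F' where "F' = Arrow a b f"
  have [simp]: "arr F'" "src F' = a" "tgt F' = b" "mor F' = f"
    using f by (simp_all add: F'_def arr_def del: arr_Ob)
  show "THom id_trans a b f \<in> Iso2 B (FHom G a b f \<odot> TOb id_trans a) (TOb id_trans b \<odot> FHom F a b f)"
    using und_isoI[of "inv (lu F') \<bullet> ru F'"] F G by (simp add: identity_like_def id_trans_def LUnitI_def)
next
  fix a b f g \<phi>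
  assume *: "a \<in> Ob B" "b \<in> Ob B" "f \<in> Hom B a b" "g \<in> Hom B a b" "\<phi> \<in> Cell B f g"
  define \<Phi> where "\<Phi> = TwoCell (Arrow a b f) (Arrow a b g) \<phi>"
  have [simp]: "cell \<Phi>" "src (dm \<Phi>) = a" "tgt (dm \<Phi>) = b"
    using * by (simp_all add: cell_iff \<Phi>_def del: cellD)
  have "(inv (lu (cd \<Phi>)) \<bullet> ru (cd \<Phi>)) \<bullet> (\<Phi> \<diamondop> idc (unit a)) = inv (lu (cd \<Phi>)) \<bullet> \<Phi> \<bullet> ru (dm \<Phi>)"
    using * ru_natural[of \<Phi>] by simp
  also have "\<dots> = (idc (unit b) \<diamondop> \<Phi>) \<bullet> (inv (lu (dm \<Phi>)) \<bullet> ru (dm \<Phi>))"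
    using * vc_reduce[OF inv_lu_natural[of \<Phi>], of "ru (dm \<Phi>)"] by simp
  finally have "und ((inv (lu (cd \<Phi>)) \<bullet> ru (cd \<Phi>)) \<bullet> (\<Phi> \<diamondop> idc (unit a)))
      = und ((idc (unit b) \<diamondop> \<Phi>) \<bullet> (inv (lu (dm \<Phi>)) \<bullet> ru (dm \<Phi>)))"
    by (rule arg_cong)
  then show "THom id_trans a b g \<cdot> (FCell G a b f g \<phi> \<star> \<iota> (TOb id_trans a))
      = (\<iota> (TOb id_trans b) \<star> FCell F a b f g \<phi>) \<cdot> THom id_trans a b f"
    using F G by (simp add: identity_like_def id_trans_def LUnitI_def \<Phi>_def del: vc_assoc)
next
  fix a b c f g assume fg: "a \<in> Ob B" "b \<in> Ob B" "c \<in> Ob B" "f \<in> Hom B a b" "g \<in> Hom B b c"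
  define F' G' where "F' = Arrow a b f" and "G' = Arrow b c g"
  have [simp]: "arr F'" "src F' = a" "tgt F' = b" "mor F' = f" "arr G'" "src G' = b" "tgt G' = c" "mor G' = g"
    using fg by (simp_all add: F'_def G'_def arr_def del: arr_Ob)
  have "(inv (lu (G' \<circ>\<circ> F')) \<bullet> ru (G' \<circ>\<circ> F')) \<bullet> (idc (G' \<circ>\<circ> F') \<diamondop> idc (unit a))
    = (idc (unit c) \<diamondop> idc (G' \<circ>\<circ> F')) \<bullet> asc (unit c) G' F'
      \<bullet> ((inv (lu G') \<bullet> ru G') \<diamondop> idc F') \<bullet> inv (asc G' (unit b) F')
      \<bullet> (idc G' \<diamondop> (inv (lu F') \<bullet> ru F')) \<bullet> asc G' F' (unit a)"
    using fg unit_commute_cmp[of F' G'] by simp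
  from arg_cong[OF this, of und]
  show "THom id_trans a c (g \<odot> f) \<cdot> (FComp G a b c g f \<star> \<iota> (TOb id_trans a))
    = (\<iota> (TOb id_trans c) \<star> FComp F a b c g f) \<cdot> \<a> (TOb id_trans c) (FHom F b c g) (FHom F a b f)
      \<cdot> (THom id_trans b c g \<star> \<iota> (FHom F a b f)) \<cdot> AssocI B (FHom G b c g) (TOb id_trans b) (FHom F a b f)
      \<cdot> (\<iota> (FHom G b c g) \<star> THom id_trans a b f) \<cdot> \<a> (FHom G b c g) (FHom G a b f) (TOb id_trans a)"
    using fg F G by (simp add: identity_like_def id_trans_def LUnitI_def AssocI_def del: hc_idc vc_assoc)
qed

end

section \<open>Canonical isomorphisms for the identity 2-functor and for unit 1-morphisms\<close>

context adj_bicategory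
begin

text \<open>The identity carries an adjunction to itself, so the canonical isomorphism compares each
  right adjoint with itself, and \<open>mat_adj\<close> applies at both stages.\<close>

lemma image_dd_iso_id:
  assumes "a \<in> Ob B" "b \<in> Ob B" "X \<in> Hom B a b"
  shows "image_dd_iso B B (id_psfun B) a b X = \<iota> (X\<^sup>\<or>\<^sup>\<or>)"
proof -
  define F where "F = Arrow a b X"
  have [simp]: "arr F" "src F = a" "tgt F = b" "mor F = X"
    using assms by (simp_all add: F_def arr_def del: arr_Ob)
  have "inv (idc (dual F \<circ>\<circ> F)) \<bullet> coev F \<bullet> idc (unit a) = coev F"
    "inv (idc (unit a)) \<bullet> ev (dual F) \<bullet> idc (dual F \<circ>\<circ> dual (dual F)) = ev (dual F)"
    using assms by simp_all
  from this[THEN arg_cong[of _ _ und]]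
  have *: "image_unit B B (id_psfun B) a b X = \<eta> X"
    "image_counit B B (id_psfun B) b a (X\<^sup>\<or>) = \<epsilon> (X\<^sup>\<or>)"
    by (simp_all add: image_unit_def image_counit_def id_psfun_def del: inv_idc vc_idc)
  have "image_dual_iso B B (id_psfun B) a b X = und (mat F (dual F) (ev F) (dual F) (coev F) (idc F))"
    using * by (simp add: image_dual_iso_def radj_iso_def und_mat[of _ a] id_psfun_def)
  then have **: "image_dual_iso B B (id_psfun B) a b X = \<iota> (X\<^sup>\<or>)"
    by (simp add: mat_adj[OF adj_dual])
  have "image_dd_iso B B (id_psfun B) a b X
      = und (mat (dual F) (dual (dual F)) (ev (dual F)) (dual (dual F)) (coev (dual F)) (idc (dual F)))"
    using * ** by (simp add: image_dd_iso_def und_mat[of _ b] id_psfun_def)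
  then show ?thesis
    by (simp add: mat_adj[OF adj_dual])
qed

end

context SO2_dagger
begin

notation cmp (infixr "\<circ>\<circ>" 75)
notation vc (infixr "\<bullet>" 60)
notation hc (infixr "\<diamondop>" 70)

text \<open>\<open>?d\<close> and \<open>?e\<close> are both left inverse to the unit comparison
  \<open>dd_unit a\<close>. As \<open>?d\<close> is composed of isomorphisms,
  \<open>dd_unit a\<close> is its inverse, and cancelling it gives \<open>?e = ?d\<close>; a
  one-sided computation with \<open>?e\<close> is enough.\<close>

lemma dag_unit:
  assumes a: "a \<in> Ob V"
  shows "dag V a a (\<one>\<^bsub>V\<^esub> a) = equivalence_dd_iso V a a (\<one>\<^bsub>V\<^esub> a)"
proof -
  define U where "U = unit a"
  have [simp]: "arr U" "src U = a" "tgt U = a" "unit a = U" "mor U = \<one>\<^bsub>V\<^esub> a"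
    using a by (simp_all add: U_def)
  have [simp]: "vol_ob a = U"
    using a by (simp add: vol_ob_def TOb_Vol U_def unit_def)
  have lr [simp]: "lu U = ru U"
    using lu_unit[OF a] by simp
  let ?P = "dual (dual U)"
  let ?e = "mat (dual U) ?P (ev (dual U)) U (inv (ev U)) (idc (dual U))"
  let ?d = "lu U \<bullet> vol_cell U \<bullet> inv (ru ?P)"
  note adj = adj_dual[of U, folded U_def] adj_dual[of "dual U"]
  \<comment> \<open>Guarantees that \<open>inv (ev U)\<close> in \<open>?e\<close> is a genuine
    2-morphism.\<close>
  have iso_ev: "iso (ev U)"
    using double_dual_unit(1)[of a "dual U" "coev U" "ev U" ?P "coev (dual U)" "ev (dual U)"] adj a by simp
  have e: "cell ?e"
    by (rule cell_mat) (use iso_ev in simp_all)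
  have e_dd: "?e \<bullet> dd_unit a = idc U"
    using double_dual_unit(2)[of a "dual U" "coev U" "ev U" ?P "coev (dual U)" "ev (dual U)"] adj a
    by (simp add: dd_unit_def)
  have [simp]: "cell (dd_unit a)" "dm (dd_unit a) = U" "cd (dd_unit a) = ?P"
    using a by simp_all
  have "?d \<bullet> dd_unit a = ru U \<bullet> vol_cell U \<bullet> (dd_unit a \<diamondop> idc U) \<bullet> inv (ru U)"
    using inv_ru_natural[of "dd_unit a"] by simp
  \<comment> \<open>The unit axiom for \<open>S\<close>, whose right-hand side
    \<open>inv (ru U) \<bullet> lu U\<close> is an identity since the unitors of \<open>U\<close>
    agree.\<close>
  also have "(vol_cell U \<bullet> (dd_unit a \<diamondop> idc U) \<bullet> inv (ru U)) = inv (ru U)"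
    using vc_reduce[of "vol_cell U" "dd_unit a \<diamondop> idc U" "idc (U \<circ>\<circ> U)" "inv (ru U)"]
      vol_cell_unit[OF a] by simp
  finally have d_dd: "?d \<bullet> dd_unit a = idc U"
    by simp
  have "dd_unit a = inv ?d \<bullet> ?d \<bullet> dd_unit a"
    by (subst vc_inv_cancel) simp_all
  then have "dd_unit a = inv ?d"
    using d_dd by simp
  then have "?e \<bullet> inv ?d = ?d \<bullet> inv ?d"
    using e_dd by simp
  then have "?e = ?d"
    by (rule vc_cancel_right) (use e in simp_all)
  from arg_cong[OF this, of und] show ?thesis
    by (simp add: dag_def equivalence_dd_iso_def radj_iso_def und_mat[of _ a] RUnitI_def del: lr)
qed

end

lemma SO2_dagger_transformation_id:
  assumes "SO2_dagger V" "bicategory.identity_like V F" "bicategory.identity_like V G"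
  shows "SO2_dagger_transformation V V F G (bicategory.id_trans V)"
proof -
  interpret SO2_dagger V by fact
  show ?thesis
    using invertible_id_trans[OF assms(2,3)] dag_unit assms(2,3)
    by (simp add: SO2_dagger_transformation_def identity_like_def id_trans_def)
qed

section \<open>Dagger structures that differ only outside the carriers\<close>

lemma Vol_update [simp]:
  "inv2 (V\<lparr>Vol := T\<rparr>) = inv2 V" "Iso2 (V\<lparr>Vol := T\<rparr>) = Iso2 V"
  "AssocI (V\<lparr>Vol := T\<rparr>) = AssocI V" "LUnitI (V\<lparr>Vol := T\<rparr>) = LUnitI V" "RUnitI (V\<lparr>Vol := T\<rparr>) = RUnitI V"
  "adjunction (V\<lparr>Vol := T\<rparr>) = adjunction V" "mate (V\<lparr>Vol := T\<rparr>) = mate V"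
  "equivalence1 (V\<lparr>Vol := T\<rparr>) = equivalence1 V" "id_psfun (V\<lparr>Vol := T\<rparr>) = id_psfun V"
  by (simp_all add: fun_eq_iff inv2_def Iso2_def inverse2_def AssocI_def LUnitI_def RUnitI_def adjunction_def
      mate_def equivalence1_def id_psfun_def)

lemma double_dual_Vol_update [simp]: "double_dual (V\<lparr>Vol := T\<rparr>) = double_dual V"
  by (simp add: double_dual_def dual_comp_def dual_unit_def dual_cell_def radj_iso_def comp_unit_def comp_counit_def)

lemma bicategory_Vol_update [simp]: "bicategory (V\<lparr>Vol := T\<rparr>) \<longleftrightarrow> bicategory V"
  by (simp add: bicategory_def)

lemma adj_bicategory_Vol_update [simp]: "adj_bicategory (V\<lparr>Vol := T\<rparr>) \<longleftrightarrow> adj_bicategory V"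
  by (simp add: adj_bicategory_def adj_bicategory_axioms_def)

text \<open>The sense in which the Euler completion and the strictification carry the same
  structure: \<open>THom\<close> is a total function, and \<open>TOb (Vol V) a\<close> is known to
  be the unit for objects \<open>a\<close> only, so equality of the records is out of reach.\<close>

definition Vol_agrees :: "('o, 'm, 'c) vol_bicat \<Rightarrow> ('o, 'm, 'm, 'c) trans \<Rightarrow> bool" where
  "Vol_agrees V T \<longleftrightarrow> (\<forall>a \<in> Ob V. TOb T a = TOb (Vol V) a) \<and>
     (\<forall>a \<in> Ob V. \<forall>b \<in> Ob V. \<forall>X \<in> Hom V a b. THom T a b X = THom (Vol V) a b X)"

text \<open>The axioms evaluate the structure only on objects and on 1-morphisms between them;
  \<open>Comp1_in\<close> and \<open>Id1_in\<close> take care of the composites and units at which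
  it is evaluated.\<close>

lemma SO2_dagger_Vol_update:
  assumes "SO2_dagger V" "Vol_agrees V T"
  shows "SO2_dagger (V\<lparr>Vol := T\<rparr>)"
proof -
  interpret SO2_dagger V by fact
  have "invertible_transformation V V (id_psfun V) (double_dual V) T"
  proof
    show "a \<in> Ob V \<Longrightarrow> TOb T a \<in> Hom V (FOb (id_psfun V) a) (FOb (double_dual V) a)" for a
      using vol.TOb_in assms(2) by (simp add: Vol_agrees_def)
  next
    fix a b f assume *: "a \<in> Ob V" "b \<in> Ob V" "f \<in> Hom V a b"
    then show "THom T a b f \<in> Iso2 V (FHom (double_dual V) a b f \<odot>\<^bsub>V\<^esub> TOb T a) (TOb T b \<odot>\<^bsub>V\<^esub> FHom (id_psfun V) a b f)"
      using vol.THom_iso[OF *] assms(2) by (simp add: Vol_agrees_def)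
  next
    fix a b f g \<phi> assume *: "a \<in> Ob V" "b \<in> Ob V" "f \<in> Hom V a b" "g \<in> Hom V a b" "\<phi> \<in> Cell V f g"
    then show "THom T a b g \<cdot>\<^bsub>V\<^esub> (FCell (double_dual V) a b f g \<phi> \<star>\<^bsub>V\<^esub> \<iota>\<^bsub>V\<^esub> (TOb T a))
        = (\<iota>\<^bsub>V\<^esub> (TOb T b) \<star>\<^bsub>V\<^esub> FCell (id_psfun V) a b f g \<phi>) \<cdot>\<^bsub>V\<^esub> THom T a b f"
      using vol.THom_natural[OF *] assms(2) by (simp add: Vol_agrees_def)
  next
    fix a b c f g assume *: "a \<in> Ob V" "b \<in> Ob V" "c \<in> Ob V" "f \<in> Hom V a b" "g \<in> Hom V b c"
    from * Comp1_in[OF *]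
    show "THom T a c (g \<odot>\<^bsub>V\<^esub> f) \<cdot>\<^bsub>V\<^esub> (FComp (double_dual V) a b c g f \<star>\<^bsub>V\<^esub> \<iota>\<^bsub>V\<^esub> (TOb T a))
        = (\<iota>\<^bsub>V\<^esub> (TOb T c) \<star>\<^bsub>V\<^esub> FComp (id_psfun V) a b c g f)
          \<cdot>\<^bsub>V\<^esub> \<a>\<^bsub>V\<^esub> (TOb T c) (FHom (id_psfun V) b c g) (FHom (id_psfun V) a b f)
          \<cdot>\<^bsub>V\<^esub> (THom T b c g \<star>\<^bsub>V\<^esub> \<iota>\<^bsub>V\<^esub> (FHom (id_psfun V) a b f))
          \<cdot>\<^bsub>V\<^esub> AssocI V (FHom (double_dual V) b c g) (TOb T b) (FHom (id_psfun V) a b f)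
          \<cdot>\<^bsub>V\<^esub> (\<iota>\<^bsub>V\<^esub> (FHom (double_dual V) b c g) \<star>\<^bsub>V\<^esub> THom T a b f)
          \<cdot>\<^bsub>V\<^esub> \<a>\<^bsub>V\<^esub> (FHom (double_dual V) b c g) (FHom (double_dual V) a b f) (TOb T a)"
      using vol.THom_Comp1[OF *] assms(2) by (simp add: Vol_agrees_def)
  next
    fix a assume *: "a \<in> Ob V"
    from * Id1_in[OF *]
    show "THom T a a (\<one>\<^bsub>V\<^esub> a) \<cdot>\<^bsub>V\<^esub> (FUnit (double_dual V) a \<star>\<^bsub>V\<^esub> \<iota>\<^bsub>V\<^esub> (TOb T a))
        = (\<iota>\<^bsub>V\<^esub> (TOb T a) \<star>\<^bsub>V\<^esub> FUnit (id_psfun V) a)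
          \<cdot>\<^bsub>V\<^esub> RUnitI V (FOb (id_psfun V) a) (TOb T a) \<cdot>\<^bsub>V\<^esub> \<l>\<^bsub>V\<^esub> (TOb T a)"
      using vol.THom_Id1[OF *] assms(2) by (simp add: Vol_agrees_def)
  next
    show "a \<in> Ob V \<Longrightarrow> equivalence1 V (FOb (id_psfun V) a) (FOb (double_dual V) a) (TOb T a)" for a
      using vol.TOb_equivalence assms(2) by (simp add: Vol_agrees_def)
  qed
  then have "invertible_transformation (V\<lparr>Vol := T\<rparr>) (V\<lparr>Vol := T\<rparr>) (id_psfun V) (double_dual V) T"
    by (simp add: invertible_transformation_def transformation_def invertible_transformation_axioms_def
        transformation_axioms_def)
  then show ?thesis
    using assms(2) TOb_Vol adj_bicategory_axioms
    by (simp add: SO2_dagger_def SO2_dagger_axioms_def SO2_volutive_def SO2_volutive_axioms_def Vol_agrees_def)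
qed

text \<open>On the carriers the two values of \<open>dag\<close> agree and the canonical isomorphism
  is an identity, so preservation comes down to a right unit law for \<open>dag\<close>.\<close>

lemma SO2_dagger_functor_id:
  assumes V: "SO2_dagger V" and T: "Vol_agrees V T"
  shows "SO2_dagger_functor V (V\<lparr>Vol := T\<rparr>) (id_psfun V)"
proof -
  interpret SO2_dagger V by fact
  have "pseudofunctor V (V\<lparr>Vol := T\<rparr>) (id_psfun V)"
    using pseudofunctor_id by (simp add: pseudofunctor_def pseudofunctor_axioms_def)
  moreover have "dag V a b X = VComp V (dag (V\<lparr>Vol := T\<rparr>) a b X) (image_dd_iso V (V\<lparr>Vol := T\<rparr>) (id_psfun V) a b X)"
    if *: "a \<in> Ob V" "b \<in> Ob V" "X \<in> Hom V a b" for a b X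
  proof -
    define F where "F = Arrow a b X"
    have [simp]: "arr F" "src F = a" "tgt F = b" "mor F = X"
      using * by (simp_all add: F_def arr_def del: arr_Ob)
    have "dag (V\<lparr>Vol := T\<rparr>) a b X = dag V a b X"
      using T * by (simp add: dag_def Vol_agrees_def)
    moreover have "image_dd_iso V (V\<lparr>Vol := T\<rparr>) (id_psfun V) a b X = image_dd_iso V V (id_psfun V) a b X"
      by (simp add: image_dd_iso_def image_counit_def image_dual_iso_def image_unit_def radj_iso_def)
    moreover have "VComp V (dag V a b X) (\<iota>\<^bsub>V\<^esub> (X\<^sup>\<or>\<^bsub>V\<^esub>\<^sup>\<or>\<^bsub>V\<^esub>)) = dag V a b X"
    proof -
      \<comment> \<open>With \<open>vol_ob\<close> equal to the units, the unitors in
        \<open>dag\<close> are composable with \<open>vol_cell\<close> as typed cells, and the unit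
        law applies.\<close>
      have "vol_ob a = unit a" "vol_ob b = unit b"
        using * by (simp_all add: vol_ob_def unit_def TOb_Vol)
      then have "vc (vc (lu F) (vc (vol_cell F) (inv (ru (dual (dual F)))))) (idc (dual (dual F)))
          = vc (lu F) (vc (vol_cell F) (inv (ru (dual (dual F)))))"
        using * by (intro vc_idc) simp_all
      from arg_cong[OF this, of und] show ?thesis
        by (simp add: dag_def RUnitI_def)
    qed
    ultimately show ?thesis
      using image_dd_iso_id[OF *] by simp
  qed
  ultimately show ?thesis
    using V SO2_dagger_Vol_update[OF V T]
    by (simp add: SO2_dagger_functor_def SO2_dagger_functor_axioms_def id_psfun_def)
qed

lemma SO2_dagger_equivalent_Vol_update:
  assumes V: "SO2_dagger V" and T: "Vol_agrees V T"
  shows "SO2_dagger_equivalent (V\<lparr>Vol := T\<rparr>) V"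
proof -
  let ?W = "V\<lparr>Vol := T\<rparr>"
  have W: "SO2_dagger ?W"
    by (rule SO2_dagger_Vol_update[OF V T])
  \<comment> \<open>Updating \<open>?W\<close> with \<open>Vol V\<close> restores \<open>V\<close>,
    so the functor lemma also gives the identity in the other direction.\<close>
  have "Vol_agrees ?W (Vol V)"
    using T by (simp add: Vol_agrees_def)
  from SO2_dagger_functor_id[OF W this] have "SO2_dagger_functor ?W V (id_psfun V)"
    by simp
  moreover have "SO2_dagger_functor V ?W (id_psfun V)"
    by (rule SO2_dagger_functor_id[OF V T])
  \<comment> \<open>Composition of 2-functors reads only fields shared by \<open>V\<close> and
    \<open>?W\<close>, which brings both composites into the form of
    \<open>identity_like_comp_psfun\<close>.\<close>
  moreover have comp: "comp_psfun V ?W V (id_psfun V) (id_psfun V) = comp_psfun V V V (id_psfun V) (id_psfun V)"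
    "comp_psfun ?W V ?W (id_psfun V) (id_psfun V) = comp_psfun ?W ?W ?W (id_psfun ?W) (id_psfun ?W)"
    by (simp_all add: comp_psfun_def)
  moreover have bV: "bicategory V" and bW: "bicategory ?W"
    using V by (simp_all add: SO2_dagger_def SO2_volutive_def adj_bicategory_def)
  moreover note SO2_dagger_transformation_id[OF V bicategory.identity_like_comp_psfun[OF bV] bicategory.identity_like_id_psfun[OF bV]]
    SO2_dagger_transformation_id[OF W bicategory.identity_like_id_psfun[OF bW] bicategory.identity_like_comp_psfun[OF bW]]
  ultimately show ?thesis
    unfolding SO2_dagger_equivalent_def using V W by (metis Vol_update(9))
qed

theorem lemma3p31:
  fixes V :: "('o, 'm, 'c) vol_bicat"
  assumes "SO2_dagger V"
  shows "SO2_dagger_equivalent (euler V) (S_SO2 (T_SO2 V))"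
proof -
  interpret SO2_dagger V by fact
  have "euler V = (S_SO2 V)\<lparr>Vol := Vol (euler V)\<rparr>"
    using TOb_Vol by (auto simp: euler_def S_SO2_def)
  \<comment> \<open>The two versions of \<open>THom\<close> invert the trivialisation as a cell from
    \<open>TOb (Vol V) a\<close> to the unit, respectively from the unit to itself; at objects these
    inverses coincide.\<close>
  moreover have "Vol_agrees (S_SO2 V) (Vol (euler V))"
    using TOb_Vol by (auto simp: Vol_agrees_def euler_def S_SO2_def)
  ultimately show ?thesis
    using SO2_dagger_equivalent_Vol_update[OF SO2_dagger_S_SO2] by (metis T_SO2_def)
qed

end
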